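(* Let $G$ be a finite group, $k$ a field, $\alpha\in Z^2(G,k^{\times})$ a $2$-cocycle, $X$ a system of representatives of the conjugacy classes of $G$, and $n\ge 0$ an integer. a) The cochain maps $\nu^n_{G,x,\alpha}$ and $\pi^n_{G,x,\alpha}$ ($x\in Z(G)$) induce, on the cohomology of the symmetric subcomplexes, well-defined $k$-linear maps $$\nu^{n,S}_{G,x,\alpha}:\mathrm{HS}^n(G,k\bar x)\to \mathrm{HHS}^n(k_\alpha G),\quad [\psi]\mapsto[\nu^n_{G,x,\alpha}(\psi)],\qquad \pi^{n,S}_{G,x,\alpha}:\mathrm{HHS}^n(k_\alpha G)\to \mathrm{HS}^n(G,k\bar x),\quad [\varphi]\mapsto[\pi^n_{G,x,\alpha}(\varphi)],$$ and the map $$\bigoplus_{x\in Z(G)}\nu^{n,S}_{G,x,\alpha}:\bigoplus_{x\in Z(G)}\mathrm{HS}^n(G,k\bar x)\to \mathrm{HHS}^n(k_\alpha G),\qquad (c_x)_x\mapsto \sum_x \nu^{n,S}_{G,x,\alpha}(c_x),$$ is an injective $k$-linear map, with left inverse the surjective map $$\bigoplus_{x\in Z(G)}\pi^{n,S}_{G,x,\alpha}:\mathrm{HHS}^n(k_\alpha G)\to\bigoplus_{x\in Z(G)}\mathrm{HS}^n(G,k\bar x),\qquad c\mapsto (\pi^{n,S}_{G,x,\alpha}(c))_x .$$ b) In the case $\alpha=\mathbf 1_k$ (the trivial cocycle, so $k_\alpha G=kG$), the cochain maps $\nu^n_{G,x}$ and $\pi^n_{G,x}$ ($x\in X$) induce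 in the same way well-defined $k$-linear maps $\nu^{n,S}_{G,x}:\mathrm{HS}^n(C_G(x),k)\to\mathrm{HHS}^n(kG)$ and $\pi^{n,S}_{G,x}:\mathrm{HHS}^n(kG)\to\mathrm{HS}^n(C_G(x),k)$ (with $kx$ identified with the trivial module $k$), and $$\bigoplus_{x\in X}\nu^{n,S}_{G,x}:\bigoplus_{x\in X}\mathrm{HS}^n(C_G(x),k)\to \mathrm{HHS}^n(kG)$$ is an injective $k$-linear map, with left inverse the surjective map $$\bigoplus_{x\in X}\pi^{n,S}_{G,x}:\mathrm{HHS}^n(kG)\to\bigoplus_{x\in X}\mathrm{HS}^n(C_G(x),k).$$
   Context: Twisted group algebra. $\alpha:G\times G\to k^\times$ satisfies $\alpha(x,yz)\alpha(y,z)=\alpha(xy,z)\alpha(x,y)$ and $\alpha(x,1)=\alpha(1,x)=1$. $k_\alpha G$ is the $k$-algebra with $k$-basis $\{\bar g\mid g\in G\}$ and multiplication $\bar g\cdot\bar h=\alpha(g,h)\overline{gh}$; so $\bar g^{-1}=\alpha(g,g^{-1})^{-1}\overline{g^{-1}}$. $\mathbf 1_k$ denotes the constant cocycle $1_k$. Here $Z(G)\subseteq X$, and $C_G(x)$ is the centralizer. For $x\in X$, $k\bar x$ is the one-dimensional $kC_G(x)$-module with $h\bar x=\alpha(h,x)\alpha(x,h)^{-1}\bar x$ for $h\in C_G(x)$. If $\alpha=\mathbf 1_k$, bars are dropped and $k\bar x$ is written $kx$, a trivial module identified with $k$. Hochschild complex. For a $(k_\alpha G,k_\alpha G)$-bimodule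 $M$, $C^n(k_\alpha G,M)=\mathrm{Hom}_k((k_\alpha G)^{\otimes n},M)$ ($C^0=M$), with differential $\delta^n(\varphi)(a_1\otimes\dots\otimes a_{n+1})=a_1\cdot\varphi(a_2\otimes\dots\otimes a_{n+1})+\sum_{j=1}^n(-1)^j\varphi(a_1\otimes\dots\otimes a_j\cdot a_{j+1}\otimes\dots\otimes a_{n+1})+(-1)^{n+1}\varphi(a_1\otimes\dots\otimes a_n)\cdot a_{n+1}$, and $\delta^0(m)(a)=a\cdot m-m\cdot a$. $\Sigma_{n+1}$ acts on $C^n(k_\alpha G,M)$ through the transpositions $\sigma_i=(i,i+1)$, $1\le i\le n$, given on basis elements (and extended $k$-linearly) for $n\ge2$ by $(\sigma_1\varphi)(\overline{g_1}\otimes\dots\otimes\overline{g_n})=-\overline{g_1}\cdot\varphi(\overline{g_1}^{-1}\otimes\overline{g_1}\cdot\overline{g_2}\otimes\dots\otimes\overline{g_n})$; $(\sigma_i\varphi)(\overline{g_1}\otimes\dots\otimes\overline{g_n})=-\varphi(\overline{g_1}\otimes\dots\otimes\overline{g_{i-1}}\cdot\overline{g_i}\otimes\overline{g_i}^{-1}\otimes\overline{g_i}\cdot\overline{g_{i+1}}\otimes\dots\otimes\overline{g_n})$ for $1<i<n$; $(\sigma_n\varphi)(\overline{g_1}\otimes\dots\otimes\overline{g_n})=-\varphi(\overline{g_1}\otimes\dots\otimes\overline{g_{n-1}}\cdot\overline{g_n}\otimes\overline{g_n}^{-1})\cdot\overline{g_n}$; for $n=1$, $(\sigma_1\varphi)(\bar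 g)=-\bar g\cdot\varphi(\bar g^{-1})\cdot\bar g$. The invariants $CS^n(k_\alpha G,M)=C^n(k_\alpha G,M)^{\Sigma_{n+1}}$ form a subcomplex, whose cohomology is the symmetric Hochschild cohomology $\mathrm{HHS}^n(k_\alpha G,M)$; $\mathrm{HHS}^n(k_\alpha G):=\mathrm{HHS}^n(k_\alpha G,k_\alpha G)$. Symmetric group cohomology (Staic). For a group $H$ and an $H$-module $A$, $C^n(H,A)=\mathrm{Maps}(H^{n},A)$ ($C^0=A$) with the standard differential $\partial^n(\varphi)(g_1,\dots,g_{n+1})=g_1\varphi(g_2,\dots,g_{n+1})+\sum_{j=1}^n(-1)^j\varphi(g_1,\dots,g_jg_{j+1},\dots,g_{n+1})+(-1)^{n+1}\varphi(g_1,\dots,g_n)$. $\Sigma_{n+1}$ acts on $C^n(H,A)$ by $(\sigma_1\varphi)(g_1,\dots,g_n)=-g_1\varphi(g_1^{-1},g_1g_2,g_3,\dots,g_n)$ (for $n=1$: $-g_1\varphi(g_1^{-1})$); $(\sigma_i\varphi)(g_1,\dots,g_n)=-\varphi(g_1,\dots,g_{i-1}g_i,g_i^{-1},g_ig_{i+1},\dots,g_n)$ for $1<i<n$; $(\sigma_n\varphi)(g_1,\dots,g_n)=-\varphi(g_1,\dots,g_{n-1}g_n,g_n^{-1})$ for $n\ge2$. $CS^n(H,A)=C^n(H,A)^{\Sigma_{n+1}}$ is a subcomplex, whose cohomology is $\mathrm{HS}^n(H,A)$. The maps. For $x\in X$, $\pi^n_{G,x,\alpha}:C^n(k_\alpha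 G,k_\alpha G)\to C^n(C_G(x),k\bar x)$ is $\pi^n_{G,x,\alpha}(\varphi)(h_1,\dots,h_n)=a_{1,x}\bar x$, where $a_{1,x}$ is the coefficient of $\bar x$ in $\varphi(\overline{h_1}\otimes\dots\otimes\overline{h_n})\cdot\overline{h_n}^{-1}\cdots\overline{h_1}^{-1}$. For $\alpha=\mathbf 1_k$ it is denoted $\pi^n_{G,x}$. For $x\in Z(G)$, $\nu^n_{G,x,\alpha}:C^n(G,k\bar x)\to C^n(k_\alpha G,k_\alpha G)$ is $\nu^n_{G,x,\alpha}(\psi)(\overline{g_1}\otimes\dots\otimes\overline{g_n})=\psi(g_1,\dots,g_n)\cdot\overline{g_1}\cdots\overline{g_n}$. For $\alpha=\mathbf 1_k$ and $x\in X$: choose a right coset decomposition $G=\bigcup_{j=1}^{n_x}C_G(x)\gamma_{j,x}$ (disjoint) with $\gamma_{1,x}=1$, and set $x_j=\gamma_{j,x}^{-1}x\gamma_{j,x}$, so that $\{x_1=x,\dots,x_{n_x}\}$ is the conjugacy class of $x$. For $g_1,\dots,g_n\in G$ and each $j$, define uniquely $h_{j,i}\in C_G(x)$ and indices $s_j^i$ by $\gamma_{j,x}g_1=h_{j,1}\gamma_{s_j^1,x}$, $\gamma_{s_j^1,x}g_2=h_{j,2}\gamma_{s_j^2,x}$, ..., $\gamma_{s_j^{n-1},x}g_n=h_{j,n}\gamma_{s_j^n,x}$. Then $\nu^n_{G,x}:C^n(C_G(x),kx)\to C^n(kG,kG)$ is $\nu^n_{G,x}(\psi)(g_1\otimes\dots\otimes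 g_n)=\sum_{j=1}^{n_x}\psi(h_{j,1},\dots,h_{j,n})x^{-1}x_jg_1\cdots g_n$. *)

theory Defs
  imports
    "HOL-Algebra.Algebra"
    "HOL-Algebra.Algebraic_Closure_Type"
    "HOL-Library.Function_Algebras"
begin

text \<open>
  Conventions. Groups are HOL-Algebra groups, the ground field is a type \<open>'k\<close> of class \<open>field\<close>
  (as a ring record: \<open>ring_of_type_algebra\<close>). Elements of \<open>k\<^sub>\<alpha> G\<close> are functions \<open>'g \<Rightarrow> 'k\<close> (the
  coefficients) vanishing off \<open>carrier G\<close>. Cochains of degree \<open>n\<close> are functions on lists that vanish
  off the lists of length \<open>n\<close> over the relevant carrier. Vector space operations on all of these are
  pointwise; \<open>+\<close>, \<open>-\<close>, \<open>0\<close> and finite sums are those of \<open>Function_Algebras\<close>. Arguments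
  \<open>g\<^sub>1, \<dots>, g\<^sub>n\<close> form a list, so that \<open>g\<^sub>i\<close> is the list element with index \<open>i - 1\<close>.
\<close>

definition vscale :: "'k::field \<Rightarrow> ('b \<Rightarrow> 'k) \<Rightarrow> 'b \<Rightarrow> 'k"  (infixr "\<cdot>\<^sub>k" 75)
  where "c \<cdot>\<^sub>k v = (\<lambda>u. c * v u)"

definition tuples :: "'a set \<Rightarrow> nat \<Rightarrow> 'a list set"
  where "tuples S n = {xs. length xs = n \<and> set xs \<subseteq> S}"


section \<open>Vector spaces with carrier\<close>

text \<open>Only the module part of the records below is meaningful; the fields \<open>mult\<close> and \<open>one\<close>
  inherited from \<open>ring\<close> are not used by the locale \<open>module\<close>.\<close>

definition linear_hom ::
    "('k, 'm) ring_scheme \<Rightarrow> ('k, 'a, 'p) module_scheme \<Rightarrow> ('k, 'b, 'q) module_scheme \<Rightarrow> ('a \<Rightarrow> 'b) \<Rightarrow> bool"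
  where "linear_hom R M N f \<longleftrightarrow>
    module R M \<and> module R N \<and> f \<in> carrier M \<rightarrow> carrier N \<and>
    (\<forall>a\<in>carrier M. \<forall>b\<in>carrier M. f (a \<oplus>\<^bsub>M\<^esub> b) = f a \<oplus>\<^bsub>N\<^esub> f b) \<and>
    (\<forall>c\<in>carrier R. \<forall>a\<in>carrier M. f (c \<odot>\<^bsub>M\<^esub> a) = c \<odot>\<^bsub>N\<^esub> f a)"

definition quotient_module :: "('k, 'a, 'm) module_scheme \<Rightarrow> 'a set \<Rightarrow> ('k, 'a set) module"
  where "quotient_module M N =
    \<lparr>carrier = a_rcosets\<^bsub>M\<^esub> N, monoid.mult = undefined, one = undefined,
     ring.zero = N, ring.add = set_add M, module.smult = (\<lambda>c C. \<Union>z\<in>C. N +>\<^bsub>M\<^esub> (c \<odot>\<^bsub>M\<^esub> z))\<rparr>"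

definition direct_sum :: "'i set \<Rightarrow> ('i \<Rightarrow> ('k, 'a, 'm) module_scheme) \<Rightarrow> ('k, 'i \<Rightarrow> 'a) module"
  where "direct_sum I M =
    \<lparr>carrier = {f \<in> \<Pi>\<^sub>E i\<in>I. carrier (M i). finite {i \<in> I. f i \<noteq> \<zero>\<^bsub>M i\<^esub>}},
     monoid.mult = undefined, one = undefined,
     ring.zero = (\<lambda>i\<in>I. \<zero>\<^bsub>M i\<^esub>), ring.add = (\<lambda>f g. \<lambda>i\<in>I. f i \<oplus>\<^bsub>M i\<^esub> g i),
     module.smult = (\<lambda>c f. \<lambda>i\<in>I. c \<odot>\<^bsub>M i\<^esub> f i)\<rparr>"

definition sum_of_maps ::
    "'i set \<Rightarrow> ('k, 'b, 'm) module_scheme \<Rightarrow> ('i \<Rightarrow> 'a \<Rightarrow> 'b) \<Rightarrow> ('i \<Rightarrow> 'a) \<Rightarrow> 'b"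
  where "sum_of_maps I N F = (\<lambda>c. finsum N (\<lambda>i. F i (c i)) I)"

definition tuple_of_maps :: "'i set \<Rightarrow> ('i \<Rightarrow> 'a \<Rightarrow> 'b) \<Rightarrow> 'a \<Rightarrow> 'i \<Rightarrow> 'b"
  where "tuple_of_maps I F = (\<lambda>c. \<lambda>i\<in>I. F i c)"


section \<open>Cohomology of cochain complexes of function spaces\<close>

definition cocycles ::
    "(nat \<Rightarrow> ('x \<Rightarrow> 'b \<Rightarrow> 'k::field) set) \<Rightarrow> (nat \<Rightarrow> ('x \<Rightarrow> 'b \<Rightarrow> 'k) \<Rightarrow> 'x \<Rightarrow> 'b \<Rightarrow> 'k) \<Rightarrow> nat \<Rightarrow> ('x \<Rightarrow> 'b \<Rightarrow> 'k) set"
  where "cocycles C d n = {\<phi> \<in> C n. d n \<phi> = 0}"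

definition coboundaries ::
    "(nat \<Rightarrow> ('x \<Rightarrow> 'b \<Rightarrow> 'k::field) set) \<Rightarrow> (nat \<Rightarrow> ('x \<Rightarrow> 'b \<Rightarrow> 'k) \<Rightarrow> 'x \<Rightarrow> 'b \<Rightarrow> 'k) \<Rightarrow> nat \<Rightarrow> ('x \<Rightarrow> 'b \<Rightarrow> 'k) set"
  where "coboundaries C d n = (case n of 0 \<Rightarrow> {0} | Suc m \<Rightarrow> d m ` C m)"

definition function_space :: "('x \<Rightarrow> 'b \<Rightarrow> 'k::field) set \<Rightarrow> ('k, 'x \<Rightarrow> 'b \<Rightarrow> 'k) module"
  where "function_space S =
    \<lparr>carrier = S, monoid.mult = undefined, one = undefined,
     ring.zero = 0, ring.add = (+), module.smult = (\<lambda>c \<phi> x. c \<cdot>\<^sub>k \<phi> x)\<rparr>"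

definition cohomology ::
    "(nat \<Rightarrow> ('x \<Rightarrow> 'b \<Rightarrow> 'k::field) set) \<Rightarrow> (nat \<Rightarrow> ('x \<Rightarrow> 'b \<Rightarrow> 'k) \<Rightarrow> 'x \<Rightarrow> 'b \<Rightarrow> 'k) \<Rightarrow> nat \<Rightarrow>
      ('k, ('x \<Rightarrow> 'b \<Rightarrow> 'k) set) module"
  where "cohomology C d n = quotient_module (function_space (cocycles C d n)) (coboundaries C d n)"

definition cohomology_class ::
    "(nat \<Rightarrow> ('x \<Rightarrow> 'b \<Rightarrow> 'k::field) set) \<Rightarrow> (nat \<Rightarrow> ('x \<Rightarrow> 'b \<Rightarrow> 'k) \<Rightarrow> 'x \<Rightarrow> 'b \<Rightarrow> 'k) \<Rightarrow> nat \<Rightarrow>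
      ('x \<Rightarrow> 'b \<Rightarrow> 'k) \<Rightarrow> ('x \<Rightarrow> 'b \<Rightarrow> 'k) set"
  where "cohomology_class C d n \<phi> = coboundaries C d n +>\<^bsub>function_space (cocycles C d n)\<^esub> \<phi>"

definition cochain_map ::
    "(nat \<Rightarrow> ('x \<Rightarrow> 'b \<Rightarrow> 'k::field) set) \<Rightarrow> (nat \<Rightarrow> ('x \<Rightarrow> 'b \<Rightarrow> 'k) \<Rightarrow> 'x \<Rightarrow> 'b \<Rightarrow> 'k) \<Rightarrow>
     (nat \<Rightarrow> ('y \<Rightarrow> 'c \<Rightarrow> 'k) set) \<Rightarrow> (nat \<Rightarrow> ('y \<Rightarrow> 'c \<Rightarrow> 'k) \<Rightarrow> 'y \<Rightarrow> 'c \<Rightarrow> 'k) \<Rightarrow>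
     (nat \<Rightarrow> ('x \<Rightarrow> 'b \<Rightarrow> 'k) \<Rightarrow> 'y \<Rightarrow> 'c \<Rightarrow> 'k) \<Rightarrow> bool"
  where "cochain_map C d C' d' f \<longleftrightarrow>
    (\<forall>n. linear_hom ring_of_type_algebra (function_space (C n)) (function_space (C' n)) (f n) \<and>
         (\<forall>\<phi>\<in>C n. d' n (f n \<phi>) = f (Suc n) (d n \<phi>)))"

text \<open>The map on classes induced by \<open>f\<close>: the union of the classes of the images of all
  representatives. It sends \<open>[\<phi>]\<close> to \<open>[f \<phi>]\<close> precisely when that class does not depend on the
  representative, which is what \<open>induces_on_cohomology\<close> demands.\<close>

definition induced_map ::
    "(nat \<Rightarrow> ('y \<Rightarrow> 'c \<Rightarrow> 'k::field) set) \<Rightarrow> (nat \<Rightarrow> ('y \<Rightarrow> 'c \<Rightarrow> 'k) \<Rightarrow> 'y \<Rightarrow> 'c \<Rightarrow> 'k) \<Rightarrow> nat \<Rightarrow>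
     (('x \<Rightarrow> 'b \<Rightarrow> 'k) \<Rightarrow> 'y \<Rightarrow> 'c \<Rightarrow> 'k) \<Rightarrow> ('x \<Rightarrow> 'b \<Rightarrow> 'k) set \<Rightarrow> ('y \<Rightarrow> 'c \<Rightarrow> 'k) set"
  where "induced_map C' d' n f = (\<lambda>c. \<Union>\<phi>\<in>c. cohomology_class C' d' n (f \<phi>))"

definition induces_on_cohomology ::
    "(nat \<Rightarrow> ('x \<Rightarrow> 'b \<Rightarrow> 'k::field) set) \<Rightarrow> (nat \<Rightarrow> ('x \<Rightarrow> 'b \<Rightarrow> 'k) \<Rightarrow> 'x \<Rightarrow> 'b \<Rightarrow> 'k) \<Rightarrow>
     (nat \<Rightarrow> ('y \<Rightarrow> 'c \<Rightarrow> 'k) set) \<Rightarrow> (nat \<Rightarrow> ('y \<Rightarrow> 'c \<Rightarrow> 'k) \<Rightarrow> 'y \<Rightarrow> 'c \<Rightarrow> 'k) \<Rightarrow> nat \<Rightarrow>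
     (('x \<Rightarrow> 'b \<Rightarrow> 'k) \<Rightarrow> 'y \<Rightarrow> 'c \<Rightarrow> 'k) \<Rightarrow> bool"
  where "induces_on_cohomology C d C' d' n f \<longleftrightarrow>
    (\<forall>\<phi>\<in>cocycles C d n. f \<phi> \<in> cocycles C' d' n \<and>
       induced_map C' d' n f (cohomology_class C d n \<phi>) = cohomology_class C' d' n (f \<phi>)) \<and>
    linear_hom ring_of_type_algebra (cohomology C d n) (cohomology C' d' n) (induced_map C' d' n f)"


section \<open>Groups and twisted group algebras\<close>

definition centralizer :: "('g, 'm) monoid_scheme \<Rightarrow> 'g \<Rightarrow> 'g set"
  where "centralizer G x = {h \<in> carrier G. h \<otimes>\<^bsub>G\<^esub> x = x \<otimes>\<^bsub>G\<^esub> h}"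

definition group_center :: "('g, 'm) monoid_scheme \<Rightarrow> 'g set"
  where "group_center G = {x \<in> carrier G. \<forall>g\<in>carrier G. g \<otimes>\<^bsub>G\<^esub> x = x \<otimes>\<^bsub>G\<^esub> g}"

definition conjugacy_class :: "('g, 'm) monoid_scheme \<Rightarrow> 'g \<Rightarrow> 'g set"
  where "conjugacy_class G x = (\<lambda>g. inv\<^bsub>G\<^esub> g \<otimes>\<^bsub>G\<^esub> x \<otimes>\<^bsub>G\<^esub> g) ` carrier G"

definition class_representatives :: "('g, 'm) monoid_scheme \<Rightarrow> 'g set \<Rightarrow> bool"
  where "class_representatives G reps \<longleftrightarrow>
    reps \<subseteq> carrier G \<and> (\<forall>g\<in>carrier G. \<exists>!x. x \<in> reps \<and> g \<in> conjugacy_class G x)"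

definition two_cocycle :: "('g, 'm) monoid_scheme \<Rightarrow> ('g \<Rightarrow> 'g \<Rightarrow> 'k::field) \<Rightarrow> bool"
  where "two_cocycle G \<alpha> \<longleftrightarrow>
    (\<forall>x\<in>carrier G. \<forall>y\<in>carrier G. \<alpha> x y \<noteq> 0) \<and>
    (\<forall>x\<in>carrier G. \<forall>y\<in>carrier G. \<forall>z\<in>carrier G.
       \<alpha> x (y \<otimes>\<^bsub>G\<^esub> z) * \<alpha> y z = \<alpha> (x \<otimes>\<^bsub>G\<^esub> y) z * \<alpha> x y) \<and>
    (\<forall>x\<in>carrier G. \<alpha> x \<one>\<^bsub>G\<^esub> = 1 \<and> \<alpha> \<one>\<^bsub>G\<^esub> x = 1)"

abbreviation trivial_cocycle :: "'g \<Rightarrow> 'g \<Rightarrow> 'k::field"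
  where "trivial_cocycle \<equiv> (\<lambda>_ _. 1)"

definition bar :: "'g \<Rightarrow> 'g \<Rightarrow> 'k::field"
  where "bar g = (\<lambda>u. if u = g then 1 else 0)"

definition twisted_algebra ::
    "('g, 'm) monoid_scheme \<Rightarrow> ('g \<Rightarrow> 'g \<Rightarrow> 'k::field) \<Rightarrow> ('k, 'g \<Rightarrow> 'k) module"
  where "twisted_algebra G \<alpha> =
    \<lparr>carrier = {a. \<forall>g. g \<notin> carrier G \<longrightarrow> a g = 0},
     monoid.mult = (\<lambda>a b. \<Sum>g\<in>carrier G. \<Sum>h\<in>carrier G. (a g * b h * \<alpha> g h) \<cdot>\<^sub>k bar (g \<otimes>\<^bsub>G\<^esub> h)),
     one = bar \<one>\<^bsub>G\<^esub>, ring.zero = 0, ring.add = (+), module.smult = (\<cdot>\<^sub>k)\<rparr>"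

text \<open>The \<open>kC\<^sub>G(x)\<close>-module \<open>k x\<close>, realised as the line spanned by \<open>bar x\<close> in \<open>k\<^sub>\<alpha> G\<close>.\<close>

definition line :: "'g \<Rightarrow> ('g \<Rightarrow> 'k::field) set"
  where "line x = range (\<lambda>c. c \<cdot>\<^sub>k bar x)"

definition line_action :: "('g \<Rightarrow> 'g \<Rightarrow> 'k::field) \<Rightarrow> 'g \<Rightarrow> 'g \<Rightarrow> ('g \<Rightarrow> 'k) \<Rightarrow> 'g \<Rightarrow> 'k"
  where "line_action \<alpha> x h v = (\<alpha> h x * inverse (\<alpha> x h)) \<cdot>\<^sub>k v"

text \<open>For the trivial cocycle the line is thus the trivial module, identified with the field via
  the basis vector \<open>bar x\<close>.\<close>

lemma line_action_trivial: "line_action trivial_cocycle x h v = v"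
  by (simp add: line_action_def vscale_def)


section \<open>The argument lists of differentials and transpositions\<close>

text \<open>\<open>(a\<^sub>1, \<dots>, a\<^sub>j a\<^sub>j\<^sub>+\<^sub>1, \<dots>, a\<^sub>m)\<close>\<close>

definition merge_at :: "('a \<Rightarrow> 'a \<Rightarrow> 'a) \<Rightarrow> nat \<Rightarrow> 'a list \<Rightarrow> 'a list"
  where "merge_at mul j xs = take (j - 1) xs @ [mul (xs ! (j - 1)) (xs ! j)] @ drop (j + 1) xs"

text \<open>The arguments of \<open>\<phi>\<close> in \<open>\<sigma>\<^sub>i \<phi>\<close>, for \<open>1 \<le> i \<le> length xs\<close>.\<close>

definition transpose_args :: "('a \<Rightarrow> 'a \<Rightarrow> 'a) \<Rightarrow> ('a \<Rightarrow> 'a) \<Rightarrow> nat \<Rightarrow> 'a list \<Rightarrow> 'a list"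
  where "transpose_args mul iv i xs = (let n = length xs in
    if n = 1 then [iv (xs ! 0)]
    else if i = 1 then [iv (xs ! 0), mul (xs ! 0) (xs ! 1)] @ drop 2 xs
    else if i = n then take (n - 2) xs @ [mul (xs ! (n - 2)) (xs ! (n - 1)), iv (xs ! (n - 1))]
    else take (i - 2) xs @ [mul (xs ! (i - 2)) (xs ! (i - 1)), iv (xs ! (i - 1)), mul (xs ! (i - 1)) (xs ! i)]
           @ drop (i + 1) xs)"


section \<open>Symmetric group cohomology\<close>

text \<open>An \<open>H\<close>-module is given by its underlying set \<open>A\<close> and the action \<open>act\<close>.\<close>

definition group_cochains ::
    "('g, 'm) monoid_scheme \<Rightarrow> ('b \<Rightarrow> 'k::field) set \<Rightarrow> nat \<Rightarrow> ('g list \<Rightarrow> 'b \<Rightarrow> 'k) set"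
  where "group_cochains H A n =
    {\<phi>. (\<forall>gs\<in>tuples (carrier H) n. \<phi> gs \<in> A) \<and> (\<forall>gs. gs \<notin> tuples (carrier H) n \<longrightarrow> \<phi> gs = 0)}"

definition group_diff ::
    "('g, 'm) monoid_scheme \<Rightarrow> ('g \<Rightarrow> ('b \<Rightarrow> 'k) \<Rightarrow> 'b \<Rightarrow> 'k::field) \<Rightarrow> nat \<Rightarrow>
      ('g list \<Rightarrow> 'b \<Rightarrow> 'k) \<Rightarrow> 'g list \<Rightarrow> 'b \<Rightarrow> 'k"
  where "group_diff H act n \<phi> = (\<lambda>gs.
    if gs \<in> tuples (carrier H) (n + 1) then
      act (gs ! 0) (\<phi> (drop 1 gs))
      + (\<Sum>j=1..n. (-1) ^ j \<cdot>\<^sub>k \<phi> (merge_at (\<otimes>\<^bsub>H\<^esub>) j gs))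
      + (-1) ^ (n + 1) \<cdot>\<^sub>k \<phi> (take n gs)
    else 0)"

definition group_transposition ::
    "('g, 'm) monoid_scheme \<Rightarrow> ('g \<Rightarrow> ('b \<Rightarrow> 'k) \<Rightarrow> 'b \<Rightarrow> 'k::field) \<Rightarrow> nat \<Rightarrow> nat \<Rightarrow>
      ('g list \<Rightarrow> 'b \<Rightarrow> 'k) \<Rightarrow> 'g list \<Rightarrow> 'b \<Rightarrow> 'k"
  where "group_transposition H act n i \<phi> = (\<lambda>gs.
    if gs \<in> tuples (carrier H) n then
      (let v = \<phi> (transpose_args (\<otimes>\<^bsub>H\<^esub>) (m_inv H) i gs)
       in - (if i = 1 then act (gs ! 0) v else v))
    else 0)"

definition sym_group_cochains ::
    "('g, 'm) monoid_scheme \<Rightarrow> ('b \<Rightarrow> 'k::field) set \<Rightarrow> ('g \<Rightarrow> ('b \<Rightarrow> 'k) \<Rightarrow> 'b \<Rightarrow> 'k) \<Rightarrow> nat \<Rightarrow>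
      ('g list \<Rightarrow> 'b \<Rightarrow> 'k) set"
  where "sym_group_cochains H A act n =
    {\<phi> \<in> group_cochains H A n. \<forall>i\<in>{1..n}. group_transposition H act n i \<phi> = \<phi>}"

definition HS ::
    "('g, 'm) monoid_scheme \<Rightarrow> ('b \<Rightarrow> 'k::field) set \<Rightarrow> ('g \<Rightarrow> ('b \<Rightarrow> 'k) \<Rightarrow> 'b \<Rightarrow> 'k) \<Rightarrow> nat \<Rightarrow>
      ('k, ('g list \<Rightarrow> 'b \<Rightarrow> 'k) set) module"
  where "HS H A act n = cohomology (sym_group_cochains H A act) (group_diff H act) n"


section \<open>Symmetric Hochschild cohomology of twisted group algebras\<close>

text \<open>\<open>Hom\<^sub>k(A\<^sup>\<otimes>\<^sup>n, A)\<close> for \<open>A = k\<^sub>\<alpha> G\<close>, as the space of \<open>k\<close>-multilinear maps on \<open>n\<close>-tuples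
  of elements of \<open>A\<close>.\<close>

definition hoch_cochains ::
    "('g, 'm) monoid_scheme \<Rightarrow> ('g \<Rightarrow> 'g \<Rightarrow> 'k::field) \<Rightarrow> nat \<Rightarrow> (('g \<Rightarrow> 'k) list \<Rightarrow> 'g \<Rightarrow> 'k) set"
  where "hoch_cochains G \<alpha> n = (let A = twisted_algebra G \<alpha> in
    {\<phi>. (\<forall>as\<in>tuples (carrier A) n. \<phi> as \<in> carrier A) \<and>
        (\<forall>as. as \<notin> tuples (carrier A) n \<longrightarrow> \<phi> as = 0) \<and>
        (\<forall>as\<in>tuples (carrier A) n. \<forall>i<n. \<forall>a\<in>carrier A. \<forall>b\<in>carrier A. \<forall>c.
           \<phi> (as[i := a + b]) = \<phi> (as[i := a]) + \<phi> (as[i := b]) \<and>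
           \<phi> (as[i := c \<cdot>\<^sub>k a]) = c \<cdot>\<^sub>k \<phi> (as[i := a]))})"

text \<open>The multilinear map with value \<open>F [g\<^sub>1, \<dots>, g\<^sub>n]\<close> at \<open>[bar g\<^sub>1, \<dots>, bar g\<^sub>n]\<close>.\<close>

definition multilinear_extension ::
    "('g, 'm) monoid_scheme \<Rightarrow> ('g \<Rightarrow> 'g \<Rightarrow> 'k::field) \<Rightarrow> nat \<Rightarrow> ('g list \<Rightarrow> 'g \<Rightarrow> 'k) \<Rightarrow>
      ('g \<Rightarrow> 'k) list \<Rightarrow> 'g \<Rightarrow> 'k"
  where "multilinear_extension G \<alpha> n F = (\<lambda>as.
    if as \<in> tuples (carrier (twisted_algebra G \<alpha>)) n
    then (\<Sum>gs\<in>tuples (carrier G) n. (\<Prod>i<n. (as ! i) (gs ! i)) \<cdot>\<^sub>k F gs)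
    else 0)"

definition hoch_diff ::
    "('g, 'm) monoid_scheme \<Rightarrow> ('g \<Rightarrow> 'g \<Rightarrow> 'k::field) \<Rightarrow> nat \<Rightarrow>
      (('g \<Rightarrow> 'k) list \<Rightarrow> 'g \<Rightarrow> 'k) \<Rightarrow> ('g \<Rightarrow> 'k) list \<Rightarrow> 'g \<Rightarrow> 'k"
  where "hoch_diff G \<alpha> n \<phi> = (let A = twisted_algebra G \<alpha> in (\<lambda>as.
    if as \<in> tuples (carrier A) (n + 1) then
      (as ! 0) \<otimes>\<^bsub>A\<^esub> \<phi> (drop 1 as)
      + (\<Sum>j=1..n. (-1) ^ j \<cdot>\<^sub>k \<phi> (merge_at (\<otimes>\<^bsub>A\<^esub>) j as))
      + (-1) ^ (n + 1) \<cdot>\<^sub>k (\<phi> (take n as) \<otimes>\<^bsub>A\<^esub> (as ! n))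
    else 0))"

text \<open>For \<open>n = 1\<close> the action of the only transposition involves both outer multiplications.\<close>

definition hoch_transposition ::
    "('g, 'm) monoid_scheme \<Rightarrow> ('g \<Rightarrow> 'g \<Rightarrow> 'k::field) \<Rightarrow> nat \<Rightarrow> nat \<Rightarrow>
      (('g \<Rightarrow> 'k) list \<Rightarrow> 'g \<Rightarrow> 'k) \<Rightarrow> ('g \<Rightarrow> 'k) list \<Rightarrow> 'g \<Rightarrow> 'k"
  where "hoch_transposition G \<alpha> n i \<phi> = (let A = twisted_algebra G \<alpha> in
    multilinear_extension G \<alpha> n (\<lambda>gs.
      (let v = \<phi> (transpose_args (\<otimes>\<^bsub>A\<^esub>) (m_inv A) i (map bar gs));
           w = (if i = 1 then bar (gs ! 0) \<otimes>\<^bsub>A\<^esub> v else v)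
       in - (if i = n then w \<otimes>\<^bsub>A\<^esub> bar (gs ! (n - 1)) else w))))"

definition sym_hoch_cochains ::
    "('g, 'm) monoid_scheme \<Rightarrow> ('g \<Rightarrow> 'g \<Rightarrow> 'k::field) \<Rightarrow> nat \<Rightarrow> (('g \<Rightarrow> 'k) list \<Rightarrow> 'g \<Rightarrow> 'k) set"
  where "sym_hoch_cochains G \<alpha> n =
    {\<phi> \<in> hoch_cochains G \<alpha> n. \<forall>i\<in>{1..n}. hoch_transposition G \<alpha> n i \<phi> = \<phi>}"

definition HHS ::
    "('g, 'm) monoid_scheme \<Rightarrow> ('g \<Rightarrow> 'g \<Rightarrow> 'k::field) \<Rightarrow> nat \<Rightarrow> ('k, (('g \<Rightarrow> 'k) list \<Rightarrow> 'g \<Rightarrow> 'k) set) module"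
  where "HHS G \<alpha> n = cohomology (sym_hoch_cochains G \<alpha>) (hoch_diff G \<alpha>) n"


section \<open>The comparison maps\<close>

definition centralizer_group :: "('g, 'm) monoid_scheme \<Rightarrow> 'g \<Rightarrow> ('g, 'm) monoid_scheme"
  where "centralizer_group G x = G\<lparr>carrier := centralizer G x\<rparr>"

definition pi_map ::
    "('g, 'm) monoid_scheme \<Rightarrow> ('g \<Rightarrow> 'g \<Rightarrow> 'k::field) \<Rightarrow> 'g \<Rightarrow> nat \<Rightarrow>
      (('g \<Rightarrow> 'k) list \<Rightarrow> 'g \<Rightarrow> 'k) \<Rightarrow> 'g list \<Rightarrow> 'g \<Rightarrow> 'k"
  where "pi_map G \<alpha> x n \<phi> = (let A = twisted_algebra G \<alpha> in (\<lambda>hs.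
    if hs \<in> tuples (centralizer G x) n
    then (foldl (\<otimes>\<^bsub>A\<^esub>) (\<phi> (map bar hs)) (map (\<lambda>h. inv\<^bsub>A\<^esub> (bar h)) (rev hs))) x \<cdot>\<^sub>k bar x
    else 0))"

definition nu_central ::
    "('g, 'm) monoid_scheme \<Rightarrow> ('g \<Rightarrow> 'g \<Rightarrow> 'k::field) \<Rightarrow> nat \<Rightarrow>
      ('g list \<Rightarrow> 'g \<Rightarrow> 'k) \<Rightarrow> ('g \<Rightarrow> 'k) list \<Rightarrow> 'g \<Rightarrow> 'k"
  where "nu_central G \<alpha> n \<psi> = (let A = twisted_algebra G \<alpha> in
    multilinear_extension G \<alpha> n (\<lambda>gs. foldl (\<otimes>\<^bsub>A\<^esub>) (\<psi> gs) (map bar gs)))"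

definition right_coset_decomposition ::
    "('g, 'm) monoid_scheme \<Rightarrow> 'g set \<Rightarrow> nat \<Rightarrow> (nat \<Rightarrow> 'g) \<Rightarrow> bool"
  where "right_coset_decomposition G H m \<gamma> \<longleftrightarrow>
    (\<forall>j\<in>{1..m}. \<gamma> j \<in> carrier G) \<and> \<gamma> 1 = \<one>\<^bsub>G\<^esub> \<and>
    carrier G = (\<Union>j\<in>{1..m}. H #>\<^bsub>G\<^esub> \<gamma> j) \<and>
    disjoint_family_on (\<lambda>j. H #>\<^bsub>G\<^esub> \<gamma> j) {1..m}"

text \<open>The unique \<open>(h, s)\<close> with \<open>\<gamma>\<^sub>j g = h \<gamma>\<^sub>s\<close>, and its iteration along \<open>g\<^sub>1, \<dots>, g\<^sub>n\<close>, which yields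
  the list \<open>h\<^sub>j\<^sub>,\<^sub>1, \<dots>, h\<^sub>j\<^sub>,\<^sub>n\<close>.\<close>

definition coset_step ::
    "('g, 'm) monoid_scheme \<Rightarrow> 'g set \<Rightarrow> nat \<Rightarrow> (nat \<Rightarrow> 'g) \<Rightarrow> nat \<Rightarrow> 'g \<Rightarrow> 'g \<times> nat"
  where "coset_step G H m \<gamma> j g =
    (THE p. fst p \<in> H \<and> snd p \<in> {1..m} \<and> \<gamma> j \<otimes>\<^bsub>G\<^esub> g = fst p \<otimes>\<^bsub>G\<^esub> \<gamma> (snd p))"

primrec coset_walk ::
    "('g, 'm) monoid_scheme \<Rightarrow> 'g set \<Rightarrow> nat \<Rightarrow> (nat \<Rightarrow> 'g) \<Rightarrow> nat \<Rightarrow> 'g list \<Rightarrow> 'g list"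
  where
    "coset_walk G H m \<gamma> j [] = []"
  | "coset_walk G H m \<gamma> j (g # gs) =
       (let p = coset_step G H m \<gamma> j g in fst p # coset_walk G H m \<gamma> (snd p) gs)"

definition nu_class ::
    "('g, 'm) monoid_scheme \<Rightarrow> 'g \<Rightarrow> nat \<Rightarrow> (nat \<Rightarrow> 'g) \<Rightarrow> nat \<Rightarrow>
      ('g list \<Rightarrow> 'g \<Rightarrow> 'k) \<Rightarrow> ('g \<Rightarrow> 'k::field) list \<Rightarrow> 'g \<Rightarrow> 'k"
  where "nu_class G x m \<gamma> n \<psi> = (let A = twisted_algebra G trivial_cocycle in
    multilinear_extension G trivial_cocycle n (\<lambda>gs.
      \<Sum>j=1..m. foldl (\<otimes>\<^bsub>A\<^esub>) (\<psi> (coset_walk G (centralizer G x) m \<gamma> j gs))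
        (map bar ([inv\<^bsub>G\<^esub> x, inv\<^bsub>G\<^esub> (\<gamma> j) \<otimes>\<^bsub>G\<^esub> x \<otimes>\<^bsub>G\<^esub> \<gamma> j] @ gs))))"

end

theory Submission
  imports Defs
begin

text \<open>
  The left inverse already exists on cochains: \<open>\<pi>\<^sub>x \<circ> \<nu>\<^sub>y\<close> is the identity for \<open>x = y\<close> and zero otherwise.
  What has to be shown is that all these maps are chain maps that preserve symmetric cochains, and
  that the symmetric cochains form complexes at all. Two changes of coordinates make this transparent.

  The first one, \<open>twist\<close>, sends a Hochschild cochain \<open>\<phi>\<close> to the group cochain
  \<open>(g\<^sub>1, \<dots>, g\<^sub>n) \<mapsto> \<phi>(bar g\<^sub>1, \<dots>, bar g\<^sub>n) (bar g\<^sub>1 \<cdots> bar g\<^sub>n)\<^sup>-\<^sup>1\<close> with coefficients in the algebra, on which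
  \<open>G\<close> acts by conjugation. It is injective and carries the Hochschild differential and transpositions
  to those of group cochains (\<open>twist_diff\<close>, \<open>twist_transposition\<close>). No value of the
  cocycle has to be tracked for this: the expression depends only on the lines spanned by its arguments
  (\<open>twist_over\<close>), and on these lines multiplication is that of \<open>G\<close>. After twisting, \<open>\<pi>\<^sub>x\<close> is the
  coefficient at \<open>x\<close> restricted to the centralizer, \<open>\<nu>\<^sub>x\<close> for central \<open>x\<close> is the inclusion of the line of
  \<open>x\<close>, and for the trivial cocycle \<open>\<nu>\<^sub>x\<close> is the map of Shapiro's lemma, which spreads a cochain of the
  centralizer over the conjugacy class.

  The second one passes from a group cochain to the homogeneous cochain
  \<open>x\<^sub>0 \<cdot> \<phi>(x\<^sub>0\<^sup>-\<^sup>1x\<^sub>1, \<dots>, x\<^sub>n\<^sub>-\<^sub>1\<^sup>-\<^sup>1x\<^sub>n)\<close>. The differential becomes the alternating sum over omitted points and a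
  transposition becomes the exchange of two neighbouring points with a sign (\<open>homogeneous_diff\<close>,
  \<open>homogeneous_transposition\<close>). So \<open>d\<^sup>2 = 0\<close> and the stability of symmetric cochains are the usual
  cancellations for simplices. Moreover, any map whose coefficients are linear functionals of the
  homogeneous cochain at pointwise transformed arguments commutes with everything (\<open>natural_map\<close>). All
  the maps above have this form; for \<open>\<nu>\<^sub>x\<close> on a conjugacy class the coefficient at \<open>g\<^sup>-\<^sup>1xg\<close> is obtained by
  translating the points by \<open>g\<close> and taking the part in the centralizer with respect to the cosets
  (\<open>transfer_natural\<close>), because the elements \<open>h\<^sub>j\<^sub>,\<^sub>i\<close> are consecutive quotients of such parts
  (\<open>coset_walk_eq\<close>).

  The passage from cochains to cohomology and to direct sums is formal (\<open>split_family\<close>).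
\<close>

section \<open>Cohomology of complexes of function spaces\<close>

definition cscale :: "'k::field \<Rightarrow> ('x \<Rightarrow> 'b \<Rightarrow> 'k) \<Rightarrow> 'x \<Rightarrow> 'b \<Rightarrow> 'k"  (infixr "\<odot>\<^sub>c" 75)
  where "c \<odot>\<^sub>c \<phi> = (\<lambda>x. c \<cdot>\<^sub>k \<phi> x)"

lemma vscale_apply [simp]: "(c \<cdot>\<^sub>k v) u = c * v u"
  by (simp add: vscale_def)

lemma cscale_apply [simp]: "(c \<odot>\<^sub>c \<phi>) x = c \<cdot>\<^sub>k \<phi> x"
  by (simp add: cscale_def)

lemma fun_diff_apply [simp]: "(f - g) x = f x - (g x :: 'a::group_add)"
  by (simp add: fun_diff_def)

lemma fun_uminus_apply [simp]: "(- f) x = - (f x :: 'a::group_add)"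
  by (simp add: fun_Compl_def)

lemma fun_sum_apply: "(\<Sum>i\<in>I. f i) x = (\<Sum>i\<in>I. f i x)"
  by (induction I rule: infinite_finite_induct) auto

lemma vscale_simps [simp]:
  "(1 :: 'k::field) \<cdot>\<^sub>k v = v" "(0 :: 'k) \<cdot>\<^sub>k v = 0" "c \<cdot>\<^sub>k (0 :: 'b \<Rightarrow> 'k) = 0"
  "c \<cdot>\<^sub>k e \<cdot>\<^sub>k v = (c * e) \<cdot>\<^sub>k v"
  by (auto simp: fun_eq_iff)

lemma vscale_distrib:
  "c \<cdot>\<^sub>k (v + w) = c \<cdot>\<^sub>k v + c \<cdot>\<^sub>k w" "(c + e) \<cdot>\<^sub>k v = c \<cdot>\<^sub>k v + e \<cdot>\<^sub>k v"
  "c \<cdot>\<^sub>k (- v) = - (c \<cdot>\<^sub>k v)"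
  by (auto simp: fun_eq_iff algebra_simps)

lemma vscale_sum: "c \<cdot>\<^sub>k (\<Sum>i\<in>I. f i) = (\<Sum>i\<in>I. c \<cdot>\<^sub>k f i)"
  by (auto simp: fun_eq_iff fun_sum_apply sum_distrib_left)

definition vector_subspace :: "('b \<Rightarrow> 'k::field) set \<Rightarrow> bool"
  where "vector_subspace A \<longleftrightarrow>
    0 \<in> A \<and> (\<forall>v\<in>A. \<forall>w\<in>A. v + w \<in> A) \<and> (\<forall>c. \<forall>v\<in>A. c \<cdot>\<^sub>k v \<in> A)"

lemma vector_subspaceD:
  assumes "vector_subspace A"
  shows "0 \<in> A" "v \<in> A \<Longrightarrow> w \<in> A \<Longrightarrow> v + w \<in> A" "v \<in> A \<Longrightarrow> c \<cdot>\<^sub>k v \<in> A" "v \<in> A \<Longrightarrow> - v \<in> A"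
proof -
  show "- v \<in> A" if "v \<in> A"
  proof -
    have "- v = (-1) \<cdot>\<^sub>k v" by (auto simp: fun_eq_iff)
    with that assms show ?thesis by (metis vector_subspace_def)
  qed
qed (use assms in \<open>auto simp: vector_subspace_def\<close>)

lemma vector_subspace_sum:
  assumes "vector_subspace A" "\<And>i. i \<in> I \<Longrightarrow> f i \<in> A"
  shows "(\<Sum>i\<in>I. f i) \<in> A"
  using assms(2) by (induction I rule: infinite_finite_induct) (auto intro: vector_subspaceD[OF assms(1)])

text \<open>Cochains take values in spaces of functions, so scalars reach them through two arguments; hence
  a second notion of subspace, with \<open>\<odot>\<^sub>c\<close> in place of \<open>\<cdot>\<^sub>k\<close>.\<close>

definition cochain_subspace :: "('x \<Rightarrow> 'b \<Rightarrow> 'k::field) set \<Rightarrow> bool"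
  where "cochain_subspace S \<longleftrightarrow>
    0 \<in> S \<and> (\<forall>\<phi>\<in>S. \<forall>\<psi>\<in>S. \<phi> + \<psi> \<in> S) \<and> (\<forall>c. \<forall>\<phi>\<in>S. c \<odot>\<^sub>c \<phi> \<in> S)"

lemma cochain_subspaceD:
  assumes "cochain_subspace S"
  shows "0 \<in> S" "\<phi> \<in> S \<Longrightarrow> \<psi> \<in> S \<Longrightarrow> \<phi> + \<psi> \<in> S" "\<phi> \<in> S \<Longrightarrow> c \<odot>\<^sub>c \<phi> \<in> S"
    "\<phi> \<in> S \<Longrightarrow> - \<phi> \<in> S" "\<phi> \<in> S \<Longrightarrow> \<psi> \<in> S \<Longrightarrow> \<phi> - \<psi> \<in> S"
proof -
  have m: "- \<phi> \<in> S" if "\<phi> \<in> S" for \<phi>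
  proof -
    have "- \<phi> = (-1) \<odot>\<^sub>c \<phi>" by (auto simp: fun_eq_iff)
    with that assms show ?thesis by (metis cochain_subspace_def)
  qed
  show "\<phi> \<in> S \<Longrightarrow> - \<phi> \<in> S" by (rule m)
  show "\<phi> \<in> S \<Longrightarrow> \<psi> \<in> S \<Longrightarrow> \<phi> - \<psi> \<in> S"
    using m[of \<psi>] assms unfolding cochain_subspace_def by (metis add_uminus_conv_diff)
qed (use assms in \<open>auto simp: cochain_subspace_def\<close>)

lemma cochain_subspace_sum:
  assumes "cochain_subspace S" "\<And>i. i \<in> I \<Longrightarrow> f i \<in> S"
  shows "(\<Sum>i\<in>I. f i) \<in> S"
  using assms(2) by (induction I rule: infinite_finite_induct) (auto intro: cochain_subspaceD[OF assms(1)])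

definition linear_on :: "('x \<Rightarrow> 'b \<Rightarrow> 'k::field) set \<Rightarrow> (('x \<Rightarrow> 'b \<Rightarrow> 'k) \<Rightarrow> 'y \<Rightarrow> 'c \<Rightarrow> 'k) \<Rightarrow> bool"
  where "linear_on S f \<longleftrightarrow>
    (\<forall>\<phi>\<in>S. \<forall>\<psi>\<in>S. f (\<phi> + \<psi>) = f \<phi> + f \<psi>) \<and> (\<forall>c. \<forall>\<phi>\<in>S. f (c \<odot>\<^sub>c \<phi>) = c \<odot>\<^sub>c f \<phi>)"

lemma linear_onD:
  assumes "linear_on S f" "cochain_subspace S"
  shows "\<phi> \<in> S \<Longrightarrow> \<psi> \<in> S \<Longrightarrow> f (\<phi> + \<psi>) = f \<phi> + f \<psi>" "\<phi> \<in> S \<Longrightarrow> f (c \<odot>\<^sub>c \<phi>) = c \<odot>\<^sub>c f \<phi>"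
    "f 0 = 0" "\<phi> \<in> S \<Longrightarrow> \<psi> \<in> S \<Longrightarrow> f (\<phi> - \<psi>) = f \<phi> - f \<psi>"
proof -
  show a: "f (\<phi> + \<psi>) = f \<phi> + f \<psi>" if "\<phi> \<in> S" "\<psi> \<in> S" for \<phi> \<psi>
    using that assms by (auto simp: linear_on_def)
  show "f 0 = 0" using a[of 0 0] cochain_subspaceD(1)[OF assms(2)] by simp
  show "f (\<phi> - \<psi>) = f \<phi> - f \<psi>" if "\<phi> \<in> S" "\<psi> \<in> S"
    using a[of "\<phi> - \<psi>" \<psi>] that cochain_subspaceD(5)[OF assms(2)] by (simp add: eq_diff_eq)
qed (use assms in \<open>auto simp: linear_on_def\<close>)

lemma linear_on_sum:
  assumes "linear_on S f" "cochain_subspace S" "\<And>i. i \<in> I \<Longrightarrow> g i \<in> S"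
  shows "f (\<Sum>i\<in>I. g i) = (\<Sum>i\<in>I. f (g i))"
  using assms(3)
proof (induction I rule: infinite_finite_induct)
  case (insert x I)
  have "f (g x + sum g I) = f (g x) + f (sum g I)"
    by (intro linear_onD(1)[OF assms(1,2)] cochain_subspace_sum[OF assms(2)]) (use insert in auto)
  also have "f (sum g I) = (\<Sum>i\<in>I. f (g i))" using insert by blast
  finally show ?case unfolding sum.insert[OF insert(1,2)] .
qed (auto simp: linear_onD(3)[OF assms(1,2)])

lemma linear_on_subset: "linear_on S f \<Longrightarrow> T \<subseteq> S \<Longrightarrow> linear_on T f"
  unfolding linear_on_def by blast

lemma function_space_simps [simp]:
  "carrier (function_space S) = S" "\<zero>\<^bsub>function_space S\<^esub> = 0"
  "\<phi> \<oplus>\<^bsub>function_space S\<^esub> \<psi> = \<phi> + \<psi>" "c \<odot>\<^bsub>function_space S\<^esub> \<phi> = c \<odot>\<^sub>c \<phi>"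
  by (simp_all add: function_space_def cscale_def)

lemma field_record_simps [simp]:
  "carrier (ring_of_type_algebra :: 'k::field ring) = UNIV"
  "x \<oplus>\<^bsub>ring_of_type_algebra\<^esub> y = (x + y :: 'k)" "x \<otimes>\<^bsub>ring_of_type_algebra\<^esub> y = (x * y :: 'k)"
  "\<one>\<^bsub>ring_of_type_algebra\<^esub> = (1 :: 'k)" "\<zero>\<^bsub>ring_of_type_algebra\<^esub> = (0 :: 'k)"
  by (simp_all add: ring_of_type_algebra_def)

lemma module_function_space:
  assumes "cochain_subspace S"
  shows "module (ring_of_type_algebra :: 'k::field ring) (function_space (S :: ('x \<Rightarrow> 'b \<Rightarrow> 'k) set))"
proof (rule moduleI)
  note S = cochain_subspaceD[OF assms]
  show "cring (ring_of_type_algebra :: 'k ring)" by (rule cring_from_type_algebra)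
  show "abelian_group (function_space S)"
  proof (rule abelian_groupI)
    show "\<exists>y\<in>carrier (function_space S). y \<oplus>\<^bsub>function_space S\<^esub> x = \<zero>\<^bsub>function_space S\<^esub>"
      if "x \<in> carrier (function_space S)" for x
      using that S(4)[of x] by (intro bexI[of _ "- x"]) simp_all
  qed (use S in \<open>auto simp: add_ac\<close>)
qed (use cochain_subspaceD[OF assms] in \<open>auto simp: fun_eq_iff algebra_simps\<close>)

lemma linear_hom_function_space:
  fixes S :: "('x \<Rightarrow> 'b \<Rightarrow> 'k::field) set"
  assumes "cochain_subspace S" "cochain_subspace T" "\<And>\<phi>. \<phi> \<in> S \<Longrightarrow> f \<phi> \<in> T" "linear_on S f"
  shows "linear_hom ring_of_type_algebra (function_space S) (function_space T) f"
  using assms by (auto simp: linear_hom_def module_function_space linear_on_def)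

text \<open>The cosets \<open>B + \<phi>\<close>: written this way, every operation of the quotient module can be computed on
  arbitrary representatives, and the module axioms of the quotient reduce to pointwise identities.\<close>

definition coset_of :: "('x \<Rightarrow> 'b \<Rightarrow> 'k::field) set \<Rightarrow> ('x \<Rightarrow> 'b \<Rightarrow> 'k) \<Rightarrow> ('x \<Rightarrow> 'b \<Rightarrow> 'k) set"
  where "coset_of B \<phi> = (\<lambda>b. b + \<phi>) ` B"

lemma coset_of_eq_iff:
  assumes "cochain_subspace B"
  shows "coset_of B \<phi> = coset_of B \<psi> \<longleftrightarrow> \<phi> - \<psi> \<in> B"
proof
  note B = cochain_subspaceD[OF assms]
  assume "coset_of B \<phi> = coset_of B \<psi>"
  moreover have "\<phi> \<in> coset_of B \<phi>" using B(1) by (force simp: coset_of_def)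
  ultimately obtain b where "b \<in> B" "\<phi> = b + \<psi>" by (auto simp: coset_of_def)
  then show "\<phi> - \<psi> \<in> B" by simp
next
  note B = cochain_subspaceD[OF assms]
  have *: "coset_of B \<phi> \<subseteq> coset_of B \<psi>" if "\<phi> - \<psi> \<in> B" for \<phi> \<psi>
  proof
    fix \<chi> assume "\<chi> \<in> coset_of B \<phi>"
    then obtain b where b: "b \<in> B" "\<chi> = b + \<phi>" by (auto simp: coset_of_def)
    then have "\<chi> = (b + (\<phi> - \<psi>)) + \<psi>" by simp
    with b that B(2) show "\<chi> \<in> coset_of B \<psi>" unfolding coset_of_def by blast
  qed
  assume "\<phi> - \<psi> \<in> B"
  moreover from this have "\<psi> - \<phi> \<in> B" using B(4)[of "\<phi> - \<psi>"] by simp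
  ultimately show "coset_of B \<phi> = coset_of B \<psi>" using * by blast
qed

lemma r_coset_function_space: "B +>\<^bsub>function_space Z\<^esub> \<phi> = coset_of B \<phi>"
  by (auto simp: a_r_coset_def' coset_of_def)

locale quotient_space =
  fixes Z B :: "('x \<Rightarrow> 'b \<Rightarrow> 'k::field) set"
  assumes subspaces: "cochain_subspace Z" "cochain_subspace B" and sub: "B \<subseteq> Z"
begin

abbreviation Q where "Q \<equiv> quotient_module (function_space Z) B"

lemma carrier_Q: "carrier Q = coset_of B ` Z"
  by (auto simp: quotient_module_def A_RCOSETS_def' r_coset_function_space)

lemma zero_Q: "\<zero>\<^bsub>Q\<^esub> = coset_of B 0"
  by (simp add: quotient_module_def coset_of_def)

lemma add_Q: "coset_of B \<phi> \<oplus>\<^bsub>Q\<^esub> coset_of B \<psi> = coset_of B (\<phi> + \<psi>)"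
proof -
  note B = cochain_subspaceD[OF subspaces(2)]
  have "\<exists>b\<in>B. \<exists>e\<in>B. a + (\<phi> + \<psi>) = b + \<phi> + (e + \<psi>)" if "a \<in> B" for a
    using that B(1) by (intro bexI[of _ a] bexI[of _ 0]) (auto simp: add_ac)
  moreover have "\<exists>a\<in>B. b + \<phi> + (e + \<psi>) = a + (\<phi> + \<psi>)" if "b \<in> B" "e \<in> B" for b e
    using that B(2) by (intro bexI[of _ "b + e"]) (auto simp: add_ac)
  ultimately show ?thesis
    by (auto simp: quotient_module_def set_add_def' coset_of_def image_iff) 
qed

text \<open>The scalar multiple of a coset is a union of cosets over all representatives; they all coincide,
  since two representatives differ by an element of \<open>B\<close>.\<close>

lemma smult_Q: "c \<odot>\<^bsub>Q\<^esub> coset_of B \<phi> = coset_of B (c \<odot>\<^sub>c \<phi>)"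
proof -
  note B = cochain_subspaceD[OF subspaces(2)]
  have "coset_of B (c \<odot>\<^sub>c (b + \<phi>)) = coset_of B (c \<odot>\<^sub>c \<phi>)" if "b \<in> B" for b
  proof -
    have "c \<odot>\<^sub>c (b + \<phi>) - c \<odot>\<^sub>c \<phi> = c \<odot>\<^sub>c b" by (auto simp: fun_eq_iff algebra_simps)
    with B(3)[OF that] show ?thesis by (simp add: coset_of_eq_iff[OF subspaces(2)])
  qed
  moreover have "\<exists>b. b \<in> B" using B(1) by blast
  ultimately show ?thesis
    by (auto simp: quotient_module_def r_coset_function_space coset_of_def[of B \<phi>])
qed

lemma module_Q: "module ring_of_type_algebra Q"
proof (rule moduleI)
  note Z = cochain_subspaceD[OF subspaces(1)]
  note S = carrier_Q zero_Q add_Q smult_Q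
  show "cring (ring_of_type_algebra :: 'k ring)" by (rule cring_from_type_algebra)
  show "abelian_group Q"
  proof (rule abelian_groupI)
    show "\<exists>y\<in>carrier Q. y \<oplus>\<^bsub>Q\<^esub> x = \<zero>\<^bsub>Q\<^esub>" if x: "x \<in> carrier Q" for x
    proof -
      obtain \<phi> where "\<phi> \<in> Z" "x = coset_of B \<phi>" using x by (auto simp: S)
      then show ?thesis using Z(4)[of \<phi>] by (intro bexI[of _ "coset_of B (- \<phi>)"]) (auto simp: S)
    qed
  qed (use Z in \<open>auto simp: S add_ac\<close>)
  fix a b x y
  show "(a \<oplus>\<^bsub>ring_of_type_algebra\<^esub> b) \<odot>\<^bsub>Q\<^esub> x = a \<odot>\<^bsub>Q\<^esub> x \<oplus>\<^bsub>Q\<^esub> b \<odot>\<^bsub>Q\<^esub> x" if xy: "x \<in> carrier Q"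
  proof -
    obtain \<phi> where x: "x = coset_of B \<phi>" using xy unfolding carrier_Q by blast
    have "(a + b) \<odot>\<^sub>c \<phi> = a \<odot>\<^sub>c \<phi> + b \<odot>\<^sub>c \<phi>" by (auto simp: fun_eq_iff algebra_simps)
    then show ?thesis by (simp add: x S)
  qed
  show "a \<odot>\<^bsub>Q\<^esub> (x \<oplus>\<^bsub>Q\<^esub> y) = a \<odot>\<^bsub>Q\<^esub> x \<oplus>\<^bsub>Q\<^esub> a \<odot>\<^bsub>Q\<^esub> y" if xy: "x \<in> carrier Q" "y \<in> carrier Q"
  proof -
    obtain \<phi> \<psi> where x: "x = coset_of B \<phi>" "y = coset_of B \<psi>" using xy unfolding carrier_Q by blast
    have "a \<odot>\<^sub>c (\<phi> + \<psi>) = a \<odot>\<^sub>c \<phi> + a \<odot>\<^sub>c \<psi>" by (auto simp: fun_eq_iff algebra_simps)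
    then show ?thesis by (simp add: x S)
  qed
  show "(a \<otimes>\<^bsub>ring_of_type_algebra\<^esub> b) \<odot>\<^bsub>Q\<^esub> x = a \<odot>\<^bsub>Q\<^esub> (b \<odot>\<^bsub>Q\<^esub> x)" if xy: "x \<in> carrier Q"
  proof -
    obtain \<phi> where x: "x = coset_of B \<phi>" using xy unfolding carrier_Q by blast
    have "(a * b) \<odot>\<^sub>c \<phi> = a \<odot>\<^sub>c (b \<odot>\<^sub>c \<phi>)" by (auto simp: fun_eq_iff algebra_simps)
    then show ?thesis by (simp add: x S)
  qed
  show "\<one>\<^bsub>ring_of_type_algebra\<^esub> \<odot>\<^bsub>Q\<^esub> x = x" if xy: "x \<in> carrier Q"
  proof -
    obtain \<phi> where x: "x = coset_of B \<phi>" using xy unfolding carrier_Q by blast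
    have "1 \<odot>\<^sub>c \<phi> = \<phi>" by (auto simp: fun_eq_iff)
    then show ?thesis by (simp add: x S)
  qed
qed (use cochain_subspaceD[OF subspaces(1)] in \<open>auto simp: carrier_Q smult_Q\<close>)

lemma finsum_Q:
  assumes "finite I" "\<And>i. i \<in> I \<Longrightarrow> \<phi> i \<in> Z" "\<And>i. i \<in> I \<Longrightarrow> F i = coset_of B (\<phi> i)"
  shows "finsum Q F I = coset_of B (\<Sum>i\<in>I. \<phi> i)"
proof -
  interpret module "ring_of_type_algebra :: 'k ring" Q by (rule module_Q)
  show ?thesis using assms
  proof (induction I)
    case empty
    show ?case unfolding finsum_empty sum.empty by (rule zero_Q)
  next
    case (insert x I)
    then have "F \<in> I \<rightarrow> carrier Q" "F x \<in> carrier Q" by (auto simp: carrier_Q)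
    with insert have "finsum Q F (insert x I) = coset_of B (\<phi> x) \<oplus>\<^bsub>Q\<^esub> coset_of B (\<Sum>i\<in>I. \<phi> i)"
      by (simp add: finsum_insert)
    then show ?case unfolding sum.insert[OF insert(1,2)] add_Q .
  qed
qed

end

locale cochain_complex =
  fixes C :: "nat \<Rightarrow> ('x \<Rightarrow> 'b \<Rightarrow> 'k::field) set" and d
  assumes subspace: "cochain_subspace (C n)"
    and diff_closed: "\<phi> \<in> C n \<Longrightarrow> d n \<phi> \<in> C (Suc n)"
    and diff_linear: "linear_on (C n) (d n)"
    and diff_diff: "\<phi> \<in> C n \<Longrightarrow> d (Suc n) (d n \<phi>) = (0 :: 'x \<Rightarrow> 'b \<Rightarrow> 'k)"

sublocale cochain_complex \<subseteq> quotient_space "cocycles C d n" "coboundaries C d n" for n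
proof
  note L = linear_onD[OF diff_linear subspace] and S = cochain_subspaceD[OF subspace]
  show "cochain_subspace (cocycles C d n)"
    by (auto simp: cochain_subspace_def cocycles_def S L)
  show "cochain_subspace (coboundaries C d n)"
  proof (cases n)
    case (Suc m)
    have "0 \<in> d m ` C m" using L(3)[of m] S(1) by (metis imageI)
    then show ?thesis unfolding cochain_subspace_def coboundaries_def Suc
      by (auto simp: S simp flip: L(1,2))
  qed (auto simp: cochain_subspace_def coboundaries_def fun_eq_iff)
  show "coboundaries C d n \<subseteq> cocycles C d n"
    by (auto simp: coboundaries_def cocycles_def diff_closed diff_diff S L split: nat.splits)
qed

context cochain_complex
begin

lemma cohomology_eq: "cohomology C d n = Q n"
  by (simp add: cohomology_def)

lemma cohomology_class_eq: "cohomology_class C d n \<phi> = coset_of (coboundaries C d n) \<phi>"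
  by (simp add: cohomology_class_def r_coset_function_space)

lemma carrier_cohomology:
  "carrier (cohomology C d n) = cohomology_class C d n ` cocycles C d n"
  by (simp add: cohomology_eq carrier_Q cohomology_class_eq image_def)

lemma cohomology_class_add:
  "cohomology_class C d n \<phi> \<oplus>\<^bsub>cohomology C d n\<^esub> cohomology_class C d n \<psi>
    = cohomology_class C d n (\<phi> + \<psi>)"
  by (simp add: cohomology_eq add_Q cohomology_class_eq)

lemma cohomology_class_smult:
  "c \<odot>\<^bsub>cohomology C d n\<^esub> cohomology_class C d n \<phi> = cohomology_class C d n (c \<odot>\<^sub>c \<phi>)"
  by (simp add: cohomology_eq smult_Q cohomology_class_eq)

lemma cohomology_class_eq_iff:
  "cohomology_class C d n \<phi> = cohomology_class C d n \<psi> \<longleftrightarrow> \<phi> - \<psi> \<in> coboundaries C d n"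
  by (simp add: cohomology_class_eq coset_of_eq_iff subspaces(2))

lemma in_cohomology_class_iff:
  "\<psi> \<in> cohomology_class C d n \<phi> \<longleftrightarrow> \<psi> - \<phi> \<in> coboundaries C d n"
  by (force simp: cohomology_class_eq coset_of_def image_iff eq_diff_eq)

lemma cocycles_subspace: "cochain_subspace (cocycles C d n)"
  by (rule subspaces)

end

locale chain_map = source: cochain_complex C d + target: cochain_complex C' d'
  for C :: "nat \<Rightarrow> ('x \<Rightarrow> 'b \<Rightarrow> 'k::field) set" and d
    and C' :: "nat \<Rightarrow> ('y \<Rightarrow> 'c \<Rightarrow> 'k) set" and d' +
  fixes f :: "nat \<Rightarrow> ('x \<Rightarrow> 'b \<Rightarrow> 'k) \<Rightarrow> 'y \<Rightarrow> 'c \<Rightarrow> 'k"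
  assumes map_closed: "\<phi> \<in> C n \<Longrightarrow> f n \<phi> \<in> C' n"
    and map_linear: "linear_on (C n) (f n)"
    and map_diff: "\<phi> \<in> C n \<Longrightarrow> d' n (f n \<phi>) = f (Suc n) (d n \<phi>)"
begin

lemma cochain_map: "cochain_map C d C' d' f"
  unfolding cochain_map_def
  by (auto intro!: linear_hom_function_space source.subspace target.subspace map_closed map_linear map_diff)

lemma map_cocycles: "\<phi> \<in> cocycles C d n \<Longrightarrow> f n \<phi> \<in> cocycles C' d' n"
  using linear_onD(3)[OF map_linear source.subspace]
  by (auto simp: cocycles_def map_closed map_diff)

lemma map_coboundaries:
  assumes "\<phi> \<in> coboundaries C d n"
  shows "f n \<phi> \<in> coboundaries C' d' n"
proof (cases n)
  case 0
  then show ?thesis using assms linear_onD(3)[OF map_linear source.subspace] by (simp add: coboundaries_def)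
next
  case (Suc m)
  then obtain \<psi> where "\<psi> \<in> C m" "\<phi> = d m \<psi>" using assms by (auto simp: coboundaries_def)
  then have "f n \<phi> = d' m (f m \<psi>)" "f m \<psi> \<in> C' m" by (simp_all add: Suc map_diff map_closed)
  then show ?thesis by (simp add: coboundaries_def Suc)
qed

lemma map_linear_cocycles: "linear_on (cocycles C d n) (f n)"
  using map_linear by (rule linear_on_subset) (auto simp: cocycles_def)

text \<open>The union that defines the induced map collapses to one class: representatives differ by a
  coboundary, and a chain map sends coboundaries to coboundaries.\<close>

lemma induced_map_class:
  assumes "\<phi> \<in> cocycles C d n"
  shows "induced_map C' d' n (f n) (cohomology_class C d n \<phi>) = cohomology_class C' d' n (f n \<phi>)"
proof -
  have "cohomology_class C' d' n (f n \<psi>) = cohomology_class C' d' n (f n \<phi>)"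
    if "\<psi> \<in> cohomology_class C d n \<phi>" for \<psi>
  proof -
    have b: "\<psi> - \<phi> \<in> coboundaries C d n" using that by (simp add: source.in_cohomology_class_iff)
    then have "\<psi> - \<phi> \<in> cocycles C d n" using source.sub by blast
    with assms have "\<psi> \<in> cocycles C d n"
      using cochain_subspaceD(2)[OF source.cocycles_subspace, of "\<psi> - \<phi>" n \<phi>] by simp
    with assms have "f n (\<psi> - \<phi>) = f n \<psi> - f n \<phi>"
      by (intro linear_onD(4)[OF map_linear_cocycles source.cocycles_subspace])
    with map_coboundaries[OF b] show ?thesis by (simp add: target.cohomology_class_eq_iff)
  qed
  moreover have "\<phi> \<in> cohomology_class C d n \<phi>"
    using cochain_subspaceD(1)[OF source.subspaces(2)] by (simp add: source.in_cohomology_class_iff)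
  ultimately show ?thesis unfolding induced_map_def by blast
qed

lemma induces: "induces_on_cohomology C d C' d' n (f n)"
  unfolding induces_on_cohomology_def linear_hom_def
proof (intro conjI ballI)
  note L = linear_onD[OF map_linear_cocycles source.cocycles_subspace]
  note S = cochain_subspaceD[OF source.cocycles_subspace]
  show "module ring_of_type_algebra (cohomology C d n)"
    unfolding source.cohomology_eq by (rule source.module_Q)
  show "module ring_of_type_algebra (cohomology C' d' n)"
    unfolding target.cohomology_eq by (rule target.module_Q)
  show "induced_map C' d' n (f n) \<in> carrier (cohomology C d n) \<rightarrow> carrier (cohomology C' d' n)"
  proof
    fix a assume "a \<in> carrier (cohomology C d n)"
    then obtain \<phi> where "\<phi> \<in> cocycles C d n" "a = cohomology_class C d n \<phi>"
      unfolding source.carrier_cohomology by blast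
    then show "induced_map C' d' n (f n) a \<in> carrier (cohomology C' d' n)"
      by (simp add: target.carrier_cohomology induced_map_class map_cocycles)
  qed
  show "induced_map C' d' n (f n) (a \<oplus>\<^bsub>cohomology C d n\<^esub> b) =
      induced_map C' d' n (f n) a \<oplus>\<^bsub>cohomology C' d' n\<^esub> induced_map C' d' n (f n) b"
    if ab: "a \<in> carrier (cohomology C d n)" "b \<in> carrier (cohomology C d n)" for a b
  proof -
    obtain \<phi> \<psi> where "\<phi> \<in> cocycles C d n" "\<psi> \<in> cocycles C d n"
      "a = cohomology_class C d n \<phi>" "b = cohomology_class C d n \<psi>"
      using ab unfolding source.carrier_cohomology by blast
    then show ?thesis
      by (simp add: source.cohomology_class_add target.cohomology_class_add induced_map_class S(2) L(1))
  qed
  show "induced_map C' d' n (f n) (c \<odot>\<^bsub>cohomology C d n\<^esub> a) =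
      c \<odot>\<^bsub>cohomology C' d' n\<^esub> induced_map C' d' n (f n) a"
    if a: "a \<in> carrier (cohomology C d n)" for c a
  proof -
    obtain \<phi> where "\<phi> \<in> cocycles C d n" "a = cohomology_class C d n \<phi>"
      using a unfolding source.carrier_cohomology by blast
    then show ?thesis
      by (simp add: source.cohomology_class_smult target.cohomology_class_smult induced_map_class S(3) L(2))
  qed
qed (simp_all add: map_cocycles induced_map_class)

end

text \<open>For finite \<open>I\<close> the finiteness of supports is automatic, so the direct sum is the product of the
  carriers and all axioms hold componentwise.\<close>

lemma module_direct_sum:
  fixes M :: "'i \<Rightarrow> ('k, 'a) module"
  assumes fin: "finite I" and R: "cring R" and M: "\<And>i. i \<in> I \<Longrightarrow> module R (M i)"
  shows "module R (direct_sum I M)"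
proof (rule moduleI[OF R])
  have car: "carrier (direct_sum I M) = (\<Pi>\<^sub>E i\<in>I. carrier (M i))"
    using fin by (auto simp: direct_sum_def)
  have ops: "\<zero>\<^bsub>direct_sum I M\<^esub> = (\<lambda>i\<in>I. \<zero>\<^bsub>M i\<^esub>)"
    "f \<oplus>\<^bsub>direct_sum I M\<^esub> g = (\<lambda>i\<in>I. f i \<oplus>\<^bsub>M i\<^esub> g i)" "c \<odot>\<^bsub>direct_sum I M\<^esub> f = (\<lambda>i\<in>I. c \<odot>\<^bsub>M i\<^esub> f i)"
    for f g c by (auto simp: direct_sum_def)
  have ab: "abelian_group (M i)" if "i \<in> I" for i using M[OF that] by (simp add: module_def)
  have mon: "abelian_monoid (M i)" if "i \<in> I" for i
    using ab[OF that] by (rule abelian_group.axioms)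
  note D = abelian_monoid.a_lcomm[OF mon] abelian_monoid.r_zero[OF mon] abelian_monoid.a_closed[OF mon] abelian_monoid.zero_closed[OF mon]
    abelian_monoid.a_assoc[OF mon] abelian_monoid.a_comm[OF mon] abelian_monoid.l_zero[OF mon]
  show "abelian_group (direct_sum I M)"
  proof (rule abelian_groupI)
    fix f assume f: "f \<in> carrier (direct_sum I M)"
    have "\<exists>y\<in>carrier (direct_sum I M). y \<oplus>\<^bsub>direct_sum I M\<^esub> f = \<zero>\<^bsub>direct_sum I M\<^esub>"
      using f abelian_group.a_inv_closed[OF ab] abelian_group.l_neg[OF ab]
      by (intro bexI[of _ "\<lambda>i\<in>I. \<ominus>\<^bsub>M i\<^esub> f i"]) (auto simp: car ops PiE_iff intro!: restrict_ext)
    then show "\<exists>y\<in>carrier (direct_sum I M). y \<oplus>\<^bsub>direct_sum I M\<^esub> f = \<zero>\<^bsub>direct_sum I M\<^esub>" .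
  qed (auto simp: car ops PiE_iff D extensional_def fun_eq_iff)
  note E = module.smult_closed[OF M] module.smult_l_distr[OF M] module.smult_r_distr[OF M]
    module.smult_assoc1[OF M] module.smult_one[OF M]
  show "\<And>c f. c \<in> carrier R \<Longrightarrow> f \<in> carrier (direct_sum I M) \<Longrightarrow> c \<odot>\<^bsub>direct_sum I M\<^esub> f \<in> carrier (direct_sum I M)"
    by (auto simp: car ops PiE_iff E)
qed (auto simp: direct_sum_def PiE_iff extensional_def fun_eq_iff 
   module.smult_l_distr[OF M] module.smult_r_distr[OF M] module.smult_assoc1[OF M] module.smult_one[OF M])


text \<open>Chain maps \<open>f i\<close> and \<open>p i\<close> that satisfy \<open>p i \<circ> f j = \<delta>\<^sub>i\<^sub>j\<close> on cochains keep this relation on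
  class_sum. Evaluating the tuple of the \<open>p i\<close> at the sum of the \<open>f j\<close> then returns every component.\<close>

locale split_family =
  fixes I :: "'i set"
    and C :: "'i \<Rightarrow> nat \<Rightarrow> ('x \<Rightarrow> 'b \<Rightarrow> 'k::field) set" and d
    and D :: "nat \<Rightarrow> ('y \<Rightarrow> 'c \<Rightarrow> 'k) set" and \<delta>
    and f p
  assumes finite: "finite I"
    and target: "cochain_complex D \<delta>"
    and f: "i \<in> I \<Longrightarrow> chain_map (C i) (d i) D \<delta> (f i)"
    and p: "i \<in> I \<Longrightarrow> chain_map D \<delta> (C i) (d i) (p i)"
    and p_f: "i \<in> I \<Longrightarrow> j \<in> I \<Longrightarrow> \<phi> \<in> C j n \<Longrightarrow>
      p i n (f j n \<phi>) = (if i = j then \<phi> else (0 :: 'x \<Rightarrow> 'b \<Rightarrow> 'k))"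
begin

sublocale D: cochain_complex D \<delta> by (rule target)

lemma source: "i \<in> I \<Longrightarrow> cochain_complex (C i) (d i)"
  using f[of i] by (simp add: chain_map_def)

abbreviation class_sum where "class_sum n \<equiv> direct_sum I (\<lambda>i. cohomology (C i) (d i) n)"

abbreviation families where "families n \<equiv> (\<Pi> i\<in>I. cocycles (C i) (d i) n)"

abbreviation class_tuple where "class_tuple n \<phi> \<equiv> \<lambda>i\<in>I. cohomology_class (C i) (d i) n (\<phi> i)"

abbreviation sum_map where
  "sum_map n \<equiv> sum_of_maps I (cohomology D \<delta> n) (\<lambda>i. induced_map D \<delta> n (f i n))"

abbreviation tuple_map where
  "tuple_map n \<equiv> tuple_of_maps I (\<lambda>i. induced_map (C i) (d i) n (p i n))"

text \<open>Every element of the direct sum is the tuple of classes of a family of cocycles; the linearity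
  statements below are checked on such families.\<close>

lemma carrier_class_sum: "carrier (class_sum n) = class_tuple n ` families n"
proof -
  have "carrier (class_sum n) = (\<Pi>\<^sub>E i\<in>I. cohomology_class (C i) (d i) n ` cocycles (C i) (d i) n)"
    using finite by (auto simp: direct_sum_def cochain_complex.carrier_cohomology[OF source] intro!: PiE_cong)
  also have "\<dots> = class_tuple n ` families n"
  proof (intro equalityI subsetI)
    fix c assume c: "c \<in> (\<Pi>\<^sub>E i\<in>I. cohomology_class (C i) (d i) n ` cocycles (C i) (d i) n)"
    then have "\<forall>i\<in>I. \<exists>\<phi>. \<phi> \<in> cocycles (C i) (d i) n \<and> c i = cohomology_class (C i) (d i) n \<phi>"
      by (auto simp: PiE_iff)
    then obtain \<phi> where "\<forall>i\<in>I. \<phi> i \<in> cocycles (C i) (d i) n \<and> c i = cohomology_class (C i) (d i) n (\<phi> i)"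
      by metis
    with c show "c \<in> class_tuple n ` families n"
      by (intro image_eqI[of _ _ \<phi>]) (auto simp: PiE_iff extensional_def fun_eq_iff)
  qed auto
  finally show ?thesis .
qed

lemma class_sum_ops:
  "class_tuple n \<phi> \<oplus>\<^bsub>class_sum n\<^esub> class_tuple n \<psi> = class_tuple n (\<phi> + \<psi>)"
  "c \<odot>\<^bsub>class_sum n\<^esub> class_tuple n \<phi> = class_tuple n (\<lambda>i. c \<odot>\<^sub>c \<phi> i)"
  by (auto simp: direct_sum_def restrict_def fun_eq_iff cochain_complex.cohomology_class_add[OF source]
    cochain_complex.cohomology_class_smult[OF source])

lemma module_class_sum: "module ring_of_type_algebra (class_sum n)"
proof (rule module_direct_sum[OF finite])
  show "cring (ring_of_type_algebra :: 'k ring)" by (rule cring_from_type_algebra)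
  fix i assume "i \<in> I"
  then interpret cochain_complex "C i" "d i" by (rule source)
  show "module ring_of_type_algebra (cohomology (C i) (d i) n)"
    unfolding cohomology_eq by (rule module_Q)
qed

lemma module_target: "module ring_of_type_algebra (cohomology D \<delta> n)"
  unfolding D.cohomology_eq by (rule D.module_Q)

lemma sum_map_class:
  assumes "\<phi> \<in> families n"
  shows "sum_map n (class_tuple n \<phi>) = cohomology_class D \<delta> n (\<Sum>i\<in>I. f i n (\<phi> i))"
  unfolding sum_of_maps_def D.cohomology_eq D.cohomology_class_eq
proof (rule D.finsum_Q[OF finite])
  fix i assume i: "i \<in> I"
  interpret chain_map "C i" "d i" D \<delta> "f i" by (rule f[OF i])
  show "f i n (\<phi> i) \<in> cocycles D \<delta> n" using assms i by (intro map_cocycles) auto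
  show "induced_map D \<delta> n (f i n) (class_tuple n \<phi> i) = coset_of (coboundaries D \<delta> n) (f i n (\<phi> i))"
    using assms i induced_map_class[of "\<phi> i" n] by (auto simp: D.cohomology_class_eq)
qed

lemma sum_cocycle:
  assumes "\<phi> \<in> families n"
  shows "(\<Sum>i\<in>I. f i n (\<phi> i)) \<in> cocycles D \<delta> n"
proof (rule cochain_subspace_sum[OF D.cocycles_subspace])
  fix i assume i: "i \<in> I"
  interpret chain_map "C i" "d i" D \<delta> "f i" by (rule f[OF i])
  show "f i n (\<phi> i) \<in> cocycles D \<delta> n" using assms i by (intro map_cocycles) auto
qed

lemma tuple_map_class:
  assumes "\<psi> \<in> cocycles D \<delta> n"
  shows "tuple_map n (cohomology_class D \<delta> n \<psi>) = class_tuple n (\<lambda>i. p i n \<psi>)"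
  unfolding tuple_of_maps_def
  by (intro restrict_ext chain_map.induced_map_class[OF p] assms)

lemma cocycle_ops:
  assumes "\<phi> \<in> families n"
  shows "\<psi> \<in> families n \<Longrightarrow> \<phi> + \<psi> \<in> families n"
    "(\<lambda>i. c \<odot>\<^sub>c \<phi> i) \<in> families n"
  using assms cochain_subspaceD(2,3)[OF cochain_complex.cocycles_subspace[OF source]] by (auto simp: Pi_iff)

lemma map_sum:
  assumes "i \<in> I" "\<phi> \<in> families n"
  shows "\<psi> \<in> families n \<Longrightarrow> f i n ((\<phi> + \<psi>) i) = f i n (\<phi> i) + f i n (\<psi> i)"
    "f i n (c \<odot>\<^sub>c \<phi> i) = c \<odot>\<^sub>c f i n (\<phi> i)"
proof -
  interpret chain_map "C i" "d i" D \<delta> "f i" by (rule f[OF assms(1)])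
  note L = linear_onD[OF map_linear_cocycles source.cocycles_subspace]
  show "f i n ((\<phi> + \<psi>) i) = f i n (\<phi> i) + f i n (\<psi> i)" if "\<psi> \<in> families n"
    using assms that L(1)[of "\<phi> i" n "\<psi> i"] by (simp add: Pi_iff)
  show "f i n (c \<odot>\<^sub>c \<phi> i) = c \<odot>\<^sub>c f i n (\<phi> i)"
    using assms L(2)[of "\<phi> i" n c] by (simp add: Pi_iff)
qed

lemma linear_sum_map: "linear_hom ring_of_type_algebra (class_sum n) (cohomology D \<delta> n) (sum_map n)"
  unfolding linear_hom_def
proof (intro conjI ballI module_class_sum module_target)
  show "sum_map n \<in> carrier (class_sum n) \<rightarrow> carrier (cohomology D \<delta> n)"
  proof
    fix a assume "a \<in> carrier (class_sum n)"
    then obtain \<phi> where "\<phi> \<in> families n" "a = class_tuple n \<phi>"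
      unfolding carrier_class_sum by blast
    then show "sum_map n a \<in> carrier (cohomology D \<delta> n)"
      unfolding D.carrier_cohomology using sum_map_class sum_cocycle by blast
  qed
  fix a assume "a \<in> carrier (class_sum n)"
  then obtain \<phi> where \<phi>: "\<phi> \<in> families n" "a = class_tuple n \<phi>"
    unfolding carrier_class_sum by blast
  show "sum_map n (a \<oplus>\<^bsub>class_sum n\<^esub> b) = sum_map n a \<oplus>\<^bsub>cohomology D \<delta> n\<^esub> sum_map n b"
    if b: "b \<in> carrier (class_sum n)" for b
  proof -
    obtain \<psi> where \<psi>: "\<psi> \<in> families n" "b = class_tuple n \<psi>"
      using b unfolding carrier_class_sum by blast
    have "(\<Sum>i\<in>I. f i n ((\<phi> + \<psi>) i)) = (\<Sum>i\<in>I. f i n (\<phi> i)) + (\<Sum>i\<in>I. f i n (\<psi> i))"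
      unfolding sum.distrib[symmetric] by (intro sum.cong refl map_sum(1) \<phi> \<psi>)
    then show ?thesis
      unfolding \<phi>(2) \<psi>(2) class_sum_ops sum_map_class[OF \<phi>(1)] sum_map_class[OF \<psi>(1)]
        sum_map_class[OF cocycle_ops(1)[OF \<phi>(1) \<psi>(1)]] D.cohomology_class_add by (rule arg_cong)
  qed
  fix c
  have "(\<Sum>i\<in>I. f i n (c \<odot>\<^sub>c \<phi> i)) = (\<Sum>i\<in>I. c \<odot>\<^sub>c f i n (\<phi> i))"
    by (intro sum.cong refl map_sum(2) \<phi>)
  also have "\<dots> = c \<odot>\<^sub>c (\<Sum>i\<in>I. f i n (\<phi> i))"
    by (simp add: fun_eq_iff fun_sum_apply sum_distrib_left)
  finally show "sum_map n (c \<odot>\<^bsub>class_sum n\<^esub> a) = c \<odot>\<^bsub>cohomology D \<delta> n\<^esub> sum_map n a"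
    unfolding \<phi>(2) class_sum_ops sum_map_class[OF \<phi>(1)] sum_map_class[OF cocycle_ops(2)[OF \<phi>(1)]]
      D.cohomology_class_smult by (rule arg_cong)
qed

lemma p_cocycles:
  assumes "\<psi> \<in> cocycles D \<delta> n"
  shows "(\<lambda>i. p i n \<psi>) \<in> families n"
  using chain_map.map_cocycles[OF p] assms by auto

lemma linear_tuple_map: "linear_hom ring_of_type_algebra (cohomology D \<delta> n) (class_sum n) (tuple_map n)"
  unfolding linear_hom_def
proof (intro conjI ballI module_class_sum module_target)
  note S = cochain_subspaceD[OF D.cocycles_subspace[of n]]
  have L: "linear_on (cocycles D \<delta> n) (p i n)" if "i \<in> I" for i
    by (rule chain_map.map_linear_cocycles[OF p[OF that]])
  note L = linear_onD[OF L D.cocycles_subspace]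
  show "tuple_map n \<in> carrier (cohomology D \<delta> n) \<rightarrow> carrier (class_sum n)"
  proof
    fix a assume "a \<in> carrier (cohomology D \<delta> n)"
    then obtain \<phi> where \<phi>: "\<phi> \<in> cocycles D \<delta> n" "a = cohomology_class D \<delta> n \<phi>"
      unfolding D.carrier_cohomology by blast
    show "tuple_map n a \<in> carrier (class_sum n)"
      unfolding carrier_class_sum \<phi>(2) tuple_map_class[OF \<phi>(1)] by (rule imageI[OF p_cocycles[OF \<phi>(1)]])
  qed
  fix a assume "a \<in> carrier (cohomology D \<delta> n)"
  then obtain \<phi> where \<phi>: "\<phi> \<in> cocycles D \<delta> n" "a = cohomology_class D \<delta> n \<phi>"
    unfolding D.carrier_cohomology by blast
  show "tuple_map n (a \<oplus>\<^bsub>cohomology D \<delta> n\<^esub> b) = tuple_map n a \<oplus>\<^bsub>class_sum n\<^esub> tuple_map n b"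
    if b: "b \<in> carrier (cohomology D \<delta> n)" for b
  proof -
    obtain \<psi> where \<psi>: "\<psi> \<in> cocycles D \<delta> n" "b = cohomology_class D \<delta> n \<psi>"
      using b unfolding D.carrier_cohomology by blast
    show ?thesis
      unfolding \<phi>(2) \<psi>(2) D.cohomology_class_add tuple_map_class[OF \<phi>(1)] tuple_map_class[OF \<psi>(1)]
        tuple_map_class[OF S(2)[OF \<phi>(1) \<psi>(1)]] class_sum_ops
      by (intro restrict_ext) (simp add: L(1)[OF _ \<phi>(1) \<psi>(1)])
  qed
  show "tuple_map n (c \<odot>\<^bsub>cohomology D \<delta> n\<^esub> a) = c \<odot>\<^bsub>class_sum n\<^esub> tuple_map n a" for c
    unfolding \<phi>(2) D.cohomology_class_smult tuple_map_class[OF \<phi>(1)]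
      tuple_map_class[OF S(3)[OF \<phi>(1)]] class_sum_ops
    by (intro restrict_ext) (simp add: L(2)[OF _ \<phi>(1)])
qed

text \<open>Represent \<open>c\<close> by cocycles \<open>\<phi> j\<close>. The \<open>i\<close>-th component of the composite is the class of
  \<open>\<Sum>j. p i (f j (\<phi> j))\<close>, and only the summand \<open>\<phi> i\<close> survives.\<close>

lemma tuple_sum:
  assumes "c \<in> carrier (class_sum n)"
  shows "tuple_map n (sum_map n c) = c"
proof -
  obtain \<phi> where \<phi>: "\<phi> \<in> families n" "c = class_tuple n \<phi>"
    using assms unfolding carrier_class_sum by blast
  have "p i n (\<Sum>j\<in>I. f j n (\<phi> j)) = \<phi> i" if i: "i \<in> I" for i
  proof -
    interpret P: chain_map D \<delta> "C i" "d i" "p i" by (rule p[OF i])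
    have "p i n (\<Sum>j\<in>I. f j n (\<phi> j)) = (\<Sum>j\<in>I. p i n (f j n (\<phi> j)))"
    proof (rule linear_on_sum[OF P.map_linear_cocycles D.cocycles_subspace])
      show "f j n (\<phi> j) \<in> cocycles D \<delta> n" if "j \<in> I" for j
        using chain_map.map_cocycles[OF f[OF that]] \<phi>(1) that by auto
    qed
    also have "\<dots> = (\<Sum>j\<in>I. if i = j then \<phi> j else 0)"
    proof (rule sum.cong[OF refl])
      fix j assume j: "j \<in> I"
      with \<phi>(1) have "\<phi> j \<in> C j n" by (auto simp: cocycles_def)
      then show "p i n (f j n (\<phi> j)) = (if i = j then \<phi> j else 0)" by (rule p_f[OF i j])
    qed
    also have "\<dots> = \<phi> i" using finite i by (simp add: sum.delta)
    finally show ?thesis .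
  qed
  then show ?thesis
    unfolding \<phi>(2) sum_map_class[OF \<phi>(1)] tuple_map_class[OF sum_cocycle[OF \<phi>(1)]]
    by (intro restrict_ext) simp
qed

text \<open>Injectivity of the sum and surjectivity of the tuple both follow from the one-sided inverse.\<close>

lemma splitting:
  "linear_hom ring_of_type_algebra (class_sum n) (cohomology D \<delta> n) (sum_map n)"
  "inj_on (sum_map n) (carrier (class_sum n))"
  "linear_hom ring_of_type_algebra (cohomology D \<delta> n) (class_sum n) (tuple_map n)"
  "tuple_map n ` carrier (cohomology D \<delta> n) = carrier (class_sum n)"
  "\<forall>c\<in>carrier (class_sum n). tuple_map n (sum_map n c) = c"
proof -
  show "inj_on (sum_map n) (carrier (class_sum n))"
    by (rule inj_on_inverseI[of _ "tuple_map n"]) (rule tuple_sum)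
  have "sum_map n c \<in> carrier (cohomology D \<delta> n)" if "c \<in> carrier (class_sum n)" for c
    using linear_sum_map[of n] that unfolding linear_hom_def by blast
  then have "tuple_map n (sum_map n c) \<in> tuple_map n ` carrier (cohomology D \<delta> n)"
    if "c \<in> carrier (class_sum n)" for c using that by (intro imageI)
  then have "carrier (class_sum n) \<subseteq> tuple_map n ` carrier (cohomology D \<delta> n)"
    using tuple_sum by (intro subsetI) simp
  moreover have "tuple_map n ` carrier (cohomology D \<delta> n) \<subseteq> carrier (class_sum n)"
    using linear_tuple_map[of n] unfolding linear_hom_def by blast
  ultimately show "tuple_map n ` carrier (cohomology D \<delta> n) = carrier (class_sum n)"
    by (rule equalityI[rotated])
  show "\<forall>c\<in>carrier (class_sum n). tuple_map n (sum_map n c) = c"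
    by (intro ballI tuple_sum)
qed (rule linear_sum_map linear_tuple_map)+

end

section \<open>Group cochains in homogeneous coordinates\<close>

definition quotients :: "('g, 'm) monoid_scheme \<Rightarrow> nat \<Rightarrow> (nat \<Rightarrow> 'g) \<Rightarrow> 'g list"
  where "quotients H n x = map (\<lambda>i. inv\<^bsub>H\<^esub> (x i) \<otimes>\<^bsub>H\<^esub> x (Suc i)) [0..<n]"

definition partial_products :: "('g, 'm) monoid_scheme \<Rightarrow> 'g list \<Rightarrow> nat \<Rightarrow> 'g"
  where "partial_products H gs i = foldr (\<otimes>\<^bsub>H\<^esub>) (take i gs) \<one>\<^bsub>H\<^esub>"

text \<open>The homogeneous cochain \<open>x\<^sub>0 \<cdot> \<phi>(x\<^sub>0\<^sup>-\<^sup>1x\<^sub>1, \<dots>, x\<^sub>n\<^sub>-\<^sub>1\<^sup>-\<^sup>1x\<^sub>n)\<close> of \<open>\<phi>\<close>. Its arguments form an infinite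
  sequence, of which only \<open>x\<^sub>0, \<dots>, x\<^sub>n\<close> count; omitting or exchanging arguments then is composition
  with a map of indices.\<close>

definition homogeneous ::
    "('g, 'm) monoid_scheme \<Rightarrow> ('g \<Rightarrow> ('b \<Rightarrow> 'k) \<Rightarrow> 'b \<Rightarrow> 'k) \<Rightarrow> nat \<Rightarrow>
      ('g list \<Rightarrow> 'b \<Rightarrow> 'k) \<Rightarrow> (nat \<Rightarrow> 'g) \<Rightarrow> 'b \<Rightarrow> 'k"
  where "homogeneous H act n \<phi> x = act (x 0) (\<phi> (quotients H n x))"

text \<open>The sequence \<open>x \<circ> skip j\<close> omits \<open>x\<^sub>j\<close>, and \<open>x \<circ> swap k\<close> exchanges \<open>x\<^sub>k\<close> and \<open>x\<^sub>k\<^sub>+\<^sub>1\<close>.\<close>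

definition skip :: "nat \<Rightarrow> nat \<Rightarrow> nat"
  where "skip j i = (if i < j then i else Suc i)"

definition swap :: "nat \<Rightarrow> nat \<Rightarrow> nat"
  where "swap k i = (if i = k then Suc k else if i = Suc k then k else i)"

lemma skip_skip: "j < i \<Longrightarrow> skip i \<circ> skip j = skip j \<circ> skip (i - 1)"
  by (auto simp: skip_def fun_eq_iff)

lemma swap_skip:
  "j < k \<Longrightarrow> swap k \<circ> skip j = skip j \<circ> swap (k - 1)"
  "Suc k < j \<Longrightarrow> swap k \<circ> skip j = skip j \<circ> swap k"
  "swap k \<circ> skip k = skip (Suc k)"
  "swap k \<circ> skip (Suc k) = skip k"
  by (auto simp: skip_def swap_def fun_eq_iff)

lemma tuples_iff: "xs \<in> tuples S n \<longleftrightarrow> length xs = n \<and> (\<forall>i<n. xs ! i \<in> S)"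
  by (auto simp: tuples_def set_conv_nth)

lemma tuplesD: "xs \<in> tuples S n \<Longrightarrow> length xs = n" "xs \<in> tuples S n \<Longrightarrow> i < n \<Longrightarrow> xs ! i \<in> S"
  by (auto simp: tuples_iff)

lemma length_merge_at: "1 \<le> j \<Longrightarrow> j < length xs \<Longrightarrow> length (merge_at mul j xs) = length xs - 1"
  by (auto simp: merge_at_def)

lemma nth_merge_at:
  assumes "1 \<le> j" "j < length xs" "k < length xs - 1"
  shows "merge_at mul j xs ! k =
    (if k < j - 1 then xs ! k else if k = j - 1 then mul (xs ! (j - 1)) (xs ! j) else xs ! Suc k)"
  using assms by (auto simp: merge_at_def nth_append)

lemma length_transpose_args:
  "1 \<le> i \<Longrightarrow> i \<le> length xs \<Longrightarrow> length (transpose_args mul iv i xs) = length xs"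
  by (auto simp: transpose_args_def Let_def)

text \<open>Entrywise the four shapes of the transposed argument list are one: invert the entry \<open>i\<close> and multiply
  it into its neighbours, as far as they exist.\<close>

lemma nth_transpose_args:
  assumes "1 \<le> i" "i \<le> length xs" "k < length xs"
  shows "transpose_args mul iv i xs ! k =
    (if Suc k = i then iv (xs ! k) else if Suc (Suc k) = i then mul (xs ! k) (xs ! Suc k)
     else if k = i then mul (xs ! (k - 1)) (xs ! k) else xs ! k)"
proof -
  consider "length xs = 1" | "length xs \<noteq> 1" "i = 1" | "length xs \<noteq> 1" "i \<noteq> 1" "i = length xs"
    | "length xs \<noteq> 1" "i \<noteq> 1" "i < length xs" using assms by linarith
  then show ?thesis
  proof cases
    case 2
    then show ?thesis using assms
      by (cases k; cases "k - 1") (auto simp: transpose_args_def Let_def nth_append nth_Cons split: nat.splits)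
  next
    case 3
    then have m: "length xs = Suc (Suc (length xs - 2))" using assms by linarith
    define m where "m = length xs - 2"
    with m have m: "length xs = Suc (Suc m)" by simp
    consider "k < m" | "k = m" | "k = Suc m" using assms m by linarith
    then show ?thesis using 3 m by cases (auto simp: transpose_args_def Let_def nth_append)
  next
    case 4
    define p where "p = i - 2"
    have i: "i = Suc (Suc p)" using 4 assms by (simp add: p_def)
    consider "k < p" | "k = p" | "k = Suc p" | "k = Suc (Suc p)" | "Suc (Suc p) < k" by linarith
    then show ?thesis
    proof cases
      case 5
      then obtain q where "k = Suc (Suc (Suc (p + q)))" by (auto dest: less_imp_Suc_add)
      then show ?thesis using assms 4 by (simp add: i transpose_args_def Let_def nth_append)
    qed (use assms 4 in \<open>auto simp: i transpose_args_def Let_def nth_append\<close>)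
  qed (use assms in \<open>auto simp: transpose_args_def\<close>)
qed

lemma tuples_merge_at:
  assumes "xs \<in> tuples S (Suc n)" "1 \<le> j" "j \<le> n" "\<And>a b. a \<in> S \<Longrightarrow> b \<in> S \<Longrightarrow> mul a b \<in> S"
  shows "merge_at mul j xs \<in> tuples S n"
  using assms by (auto simp: tuples_iff length_merge_at nth_merge_at)

lemma tuples_transpose_args:
  assumes "xs \<in> tuples S n" "1 \<le> i" "i \<le> n" "\<And>a b. a \<in> S \<Longrightarrow> b \<in> S \<Longrightarrow> mul a b \<in> S"
    "\<And>a. a \<in> S \<Longrightarrow> iv a \<in> S"
  shows "transpose_args mul iv i xs \<in> tuples S n"
  using assms by (auto simp: tuples_iff length_transpose_args nth_transpose_args)

lemma tuples_drop: "xs \<in> tuples S (Suc n) \<Longrightarrow> drop 1 xs \<in> tuples S n"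
  by (auto simp: tuples_iff)

lemma tuples_take: "xs \<in> tuples S (Suc n) \<Longrightarrow> take n xs \<in> tuples S n"
  by (auto simp: tuples_iff)

context group
begin

lemma inv_cancel:
  assumes "x \<in> carrier G" "y \<in> carrier G" "z \<in> carrier G"
  shows "(inv x \<otimes> y) \<otimes> (inv y \<otimes> z) = inv x \<otimes> z"
proof -
  have "inv x \<otimes> y \<otimes> (inv y \<otimes> z) = inv x \<otimes> ((y \<otimes> inv y) \<otimes> z)"
    using assms by (simp only: m_assoc inv_closed m_closed)
  then show ?thesis using assms by (simp only: r_inv l_one)
qed

lemma quotients_tuple:
  assumes "\<And>i. x i \<in> carrier G"
  shows "quotients G n x \<in> tuples (carrier G) n"
  using assms by (auto simp: quotients_def tuples_iff)

lemma length_quotients [simp]: "length (quotients G n x) = n"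
  by (simp add: quotients_def)

lemma nth_quotients: "i < n \<Longrightarrow> quotients G n x ! i = inv (x i) \<otimes> x (Suc i)"
  by (simp add: quotients_def)

lemma quotients_translate:
  assumes "g \<in> carrier G" "\<And>i. x i \<in> carrier G"
  shows "quotients G n (\<lambda>i. g \<otimes> x i) = quotients G n x"
proof -
  have "inv (g \<otimes> a) \<otimes> (g \<otimes> b) = inv a \<otimes> b" if "a \<in> carrier G" "b \<in> carrier G" for a b
  proof -
    have "inv (g \<otimes> a) \<otimes> (g \<otimes> b) = inv a \<otimes> ((inv g \<otimes> g) \<otimes> b)"
      using that assms(1) by (simp only: inv_mult_group m_assoc inv_closed m_closed)
    then show ?thesis using that assms(1) by (simp only: l_inv l_one)
  qed
  with assms(2) show ?thesis by (auto simp: quotients_def)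
qed

text \<open>The quotients telescope: \<open>x\<^sub>j\<^sub>-\<^sub>1\<^sup>-\<^sup>1x\<^sub>j \<cdot> x\<^sub>j\<^sup>-\<^sup>1x\<^sub>j\<^sub>+\<^sub>1 = x\<^sub>j\<^sub>-\<^sub>1\<^sup>-\<^sup>1x\<^sub>j\<^sub>+\<^sub>1\<close>, so merging two neighbours of the list of
  quotients omits one point of the sequence.\<close>

lemma merge_quotients:
  assumes x: "\<And>i. x i \<in> carrier G" and j: "1 \<le> j" "j \<le> n"
  shows "merge_at (\<otimes>) j (quotients G (Suc n) x) = quotients G n (x \<circ> skip j)"
proof (rule nth_equalityI)
  fix k assume "k < length (merge_at (\<otimes>) j (quotients G (Suc n) x))"
  then have k: "k < n" using j by (simp add: length_merge_at)
  then show "merge_at (\<otimes>) j (quotients G (Suc n) x) ! k = quotients G n (x \<circ> skip j) ! k"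
    using j x by (cases "k = j - 1") (auto simp: nth_merge_at nth_quotients skip_def inv_cancel)
qed (use j in \<open>simp add: length_merge_at\<close>)

lemma drop_quotients:
  "drop 1 (quotients G (Suc n) x) = quotients G n (x \<circ> skip 0)"
  by (rule nth_equalityI) (auto simp: nth_quotients skip_def)

lemma take_quotients:
  "take n (quotients G (Suc n) x) = quotients G n (x \<circ> skip (Suc n))"
  by (rule nth_equalityI) (auto simp: nth_quotients skip_def)

text \<open>The \<open>i\<close>-th transposition of the arguments exchanges the points \<open>x\<^sub>i\<^sub>-\<^sub>1\<close> and \<open>x\<^sub>i\<close>: their quotient is
  inverted, and the two adjacent quotients absorb it.\<close>

lemma transpose_quotients:
  assumes x: "\<And>i. x i \<in> carrier G" and i: "1 \<le> i" "i \<le> n"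
  shows "transpose_args (\<otimes>) (m_inv G) i (quotients G n x)
    = quotients G n (x \<circ> swap (i - 1))"
proof (rule nth_equalityI)
  fix k assume "k < length (transpose_args (\<otimes>) (m_inv G) i (quotients G n x))"
  then have k: "k < n" using i by (simp add: length_transpose_args)
  consider "Suc k = i" | "Suc (Suc k) = i" | "k = i" | "Suc k < i - 1" | "k > i" using i by linarith
  then show "transpose_args (\<otimes>) (m_inv G) i (quotients G n x) ! k
      = quotients G n (x \<circ> swap (i - 1)) ! k"
    using k i x
    by cases (auto simp: nth_transpose_args nth_quotients swap_def inv_cancel inv_mult_group)
qed (use i in \<open>simp add: length_transpose_args\<close>)

lemma partial_products_closed:
  assumes "gs \<in> tuples (carrier G) n"
  shows "partial_products G gs i \<in> carrier G"
proof -
  have "set hs \<subseteq> carrier G \<Longrightarrow> foldr (\<otimes>) hs \<one> \<in> carrier G" for hs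
    by (induction hs) auto
  moreover have "set (take i gs) \<subseteq> carrier G"
    using assms set_take_subset[of i gs] by (auto simp: tuples_def)
  ultimately show ?thesis by (simp add: partial_products_def)
qed

lemma partial_products_simps:
  "partial_products G gs 0 = \<one>" "partial_products G (g # gs) (Suc i) = g \<otimes> partial_products G gs i"
  by (simp_all add: partial_products_def)

lemma quotients_Suc:
  "quotients G (Suc n) x = (inv (x 0) \<otimes> x (Suc 0)) # quotients G n (x \<circ> Suc)"
  unfolding quotients_def by (simp add: upt_conv_Cons map_Suc_upt[symmetric] del: upt_Suc)

text \<open>Every argument list arises from a sequence, so a cochain is determined by its homogeneous form.\<close>

lemma quotients_partial_products:
  assumes "gs \<in> tuples (carrier G) n"
  shows "quotients G n (partial_products G gs) = gs"
  using assms
proof (induction gs arbitrary: n)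
  case Nil
  then show ?case by (auto simp: tuples_def quotients_def)
next
  case (Cons g gs)
  then obtain m where n: "n = Suc m" and gs: "gs \<in> tuples (carrier G) m" "g \<in> carrier G"
    by (cases n) (auto simp: tuples_def)
  have p: "partial_products G gs i \<in> carrier G" for i by (rule partial_products_closed[OF gs(1)])
  have "partial_products G (g # gs) \<circ> Suc = (\<lambda>i. g \<otimes> partial_products G gs i)"
    by (simp add: fun_eq_iff partial_products_simps)
  then show ?case using gs p Cons.IH[OF gs(1)]
    by (simp add: n quotients_Suc partial_products_simps quotients_translate)
qed

end

text \<open>Cancellation in pairs: the faces \<open>x \<circ> skip i \<circ> skip j\<close> with \<open>j < i\<close> are the faces
  \<open>x \<circ> skip j \<circ> skip (i - 1)\<close>, which occur with the opposite sign.\<close>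

lemma alternating_faces_square:
  fixes F :: "(nat \<Rightarrow> 'g) \<Rightarrow> 'b \<Rightarrow> 'k::field"
  shows "(\<Sum>i\<le>Suc n. (-1) ^ i \<cdot>\<^sub>k (\<Sum>j\<le>n. (-1) ^ j \<cdot>\<^sub>k F (x \<circ> skip i \<circ> skip j))) = 0"
proof -
  let ?g = "\<lambda>(i, j). (-1) ^ (i + j) \<cdot>\<^sub>k F (x \<circ> skip i \<circ> skip j)"
  let ?P = "{..Suc n} \<times> {..n}"
  have "(\<Sum>i\<le>Suc n. (-1) ^ i \<cdot>\<^sub>k (\<Sum>j\<le>n. (-1) ^ j \<cdot>\<^sub>k F (x \<circ> skip i \<circ> skip j))) = sum ?g ?P"
    by (simp add: sum.cartesian_product[symmetric] vscale_sum power_add del: sum.atMost_Suc)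
  also have "?P = {p \<in> ?P. snd p < fst p} \<union> {p \<in> ?P. fst p \<le> snd p}" by auto
  also have "sum ?g \<dots> = sum ?g {p \<in> ?P. snd p < fst p} + sum ?g {p \<in> ?P. fst p \<le> snd p}"
    by (rule sum.union_disjoint) auto
  also have "sum ?g {p \<in> ?P. snd p < fst p} = (\<Sum>p\<in>{p \<in> ?P. fst p \<le> snd p}. - ?g p)"
  proof (rule sum.reindex_bij_witness[where i = "\<lambda>(i, j). (Suc j, i)" and j = "\<lambda>(i, j). (j, i - 1)"])
    fix p assume p: "p \<in> {p \<in> ?P. snd p < fst p}"
    obtain i j where ij: "p = (i, j)" by force
    with p have "j < i" by simp
    then obtain m where m: "i = Suc m" by (cases i) auto
    show "- ?g (case p of (i, j) \<Rightarrow> (j, i - 1)) = ?g p"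
      using skip_skip[OF \<open>j < i\<close>] by (simp add: ij m comp_assoc add.commute) (auto simp: fun_eq_iff)
  qed auto
  also have "\<dots> = - sum ?g {p \<in> ?P. fst p \<le> snd p}" by (rule sum_negf)
  also have "\<dots> + sum ?g {p \<in> ?P. fst p \<le> snd p} = 0" by (rule left_minus)
  finally show ?thesis .
qed

text \<open>Exchanging two neighbours exchanges the two faces that omit one of them, whose signs are
  opposite; in every other face it exchanges two neighbours again.\<close>

lemma alternating_faces_swap:
  fixes F :: "(nat \<Rightarrow> 'g) \<Rightarrow> 'b \<Rightarrow> 'k::field"
  assumes k: "k \<le> n" and alt: "\<And>l y. l < n \<Longrightarrow> range y \<subseteq> range x \<Longrightarrow> F (y \<circ> swap l) = - F y"
  shows "(\<Sum>j\<le>Suc n. (-1) ^ j \<cdot>\<^sub>k F (x \<circ> swap k \<circ> skip j)) = - (\<Sum>j\<le>Suc n. (-1) ^ j \<cdot>\<^sub>k F (x \<circ> skip j))"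
proof -
  have "(\<Sum>j\<le>Suc n. (-1) ^ j \<cdot>\<^sub>k F (x \<circ> swap k \<circ> skip j)) = (\<Sum>j\<le>Suc n. - ((-1) ^ j \<cdot>\<^sub>k F (x \<circ> skip j)))"
  proof (rule sum.reindex_bij_witness[where i = "swap k" and j = "swap k"])
    fix j assume j: "j \<in> {..Suc n}"
    have r: "range (x \<circ> skip j) \<subseteq> range x" by auto
    consider "j < k" | "Suc k < j" | "j = k" | "j = Suc k" by linarith
    then show "- ((-1) ^ swap k j \<cdot>\<^sub>k F (x \<circ> skip (swap k j))) = (-1) ^ j \<cdot>\<^sub>k F (x \<circ> swap k \<circ> skip j)"
    proof cases
      case 1
      then show ?thesis using k alt[OF _ r, of "k - 1"]
        by (simp add: comp_assoc swap_skip vscale_distrib) (simp add: swap_def)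
    next
      case 2
      then show ?thesis using j alt[OF _ r, of k]
        by (simp add: comp_assoc swap_skip vscale_distrib) (simp add: swap_def)
    next
      case 3
      then show ?thesis by (simp add: comp_assoc swap_skip) (auto simp: swap_def fun_eq_iff)
    next
      case 4
      then show ?thesis by (simp add: comp_assoc swap_skip) (auto simp: swap_def fun_eq_iff)
    qed
  qed (use k in \<open>auto simp: swap_def\<close>)
  also have "\<dots> = - (\<Sum>j\<le>Suc n. (-1) ^ j \<cdot>\<^sub>k F (x \<circ> skip j))" by (rule sum_negf)
  finally show ?thesis .
qed

text \<open>An \<open>H\<close>-module \<open>A\<close> inside a space of functions. Linearity is assumed on all functions, so that the
  differential is linear without side conditions on the values of the cochains.\<close>

locale linear_action = group H for H :: "('g, 'm) monoid_scheme" (structure) +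
  fixes A :: "('b \<Rightarrow> 'k::field) set" and act :: "'g \<Rightarrow> ('b \<Rightarrow> 'k) \<Rightarrow> 'b \<Rightarrow> 'k"
  assumes module_subspace: "vector_subspace A"
    and act_closed: "g \<in> carrier H \<Longrightarrow> v \<in> A \<Longrightarrow> act g v \<in> A"
    and act_add: "g \<in> carrier H \<Longrightarrow> act g (v + w) = act g v + act g w"
    and act_scale: "g \<in> carrier H \<Longrightarrow> act g (c \<cdot>\<^sub>k v) = c \<cdot>\<^sub>k act g v"
    and act_one: "v \<in> A \<Longrightarrow> act \<one> v = v"
    and act_mult: "g \<in> carrier H \<Longrightarrow> h \<in> carrier H \<Longrightarrow> v \<in> A \<Longrightarrow> act (g \<otimes> h) v = act g (act h v)"
begin

abbreviation cochains where "cochains \<equiv> group_cochains H A"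
abbreviation sym_cochains where "sym_cochains \<equiv> sym_group_cochains H A act"
abbreviation diff where "diff \<equiv> group_diff H act"
abbreviation hmg where "hmg \<equiv> homogeneous H act"

lemmas A = vector_subspaceD[OF module_subspace]

lemma act_zero: "g \<in> carrier H \<Longrightarrow> act g 0 = 0"
  using act_scale[of g 0 0] by simp

lemma act_uminus: "g \<in> carrier H \<Longrightarrow> act g (- v) = - act g v"
proof -
  have "- v = (-1) \<cdot>\<^sub>k v" for v :: "'b \<Rightarrow> 'k" by (auto simp: fun_eq_iff)
  then show "g \<in> carrier H \<Longrightarrow> act g (- v) = - act g v" using act_scale by metis
qed

lemma act_sum: "g \<in> carrier H \<Longrightarrow> act g (\<Sum>i\<in>I. f i) = (\<Sum>i\<in>I. act g (f i))"
  by (induction I rule: infinite_finite_induct) (simp_all add: act_zero act_add)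

lemma cochains_iff:
  "\<phi> \<in> cochains n \<longleftrightarrow> (\<forall>gs\<in>tuples (carrier H) n. \<phi> gs \<in> A) \<and> (\<forall>gs. gs \<notin> tuples (carrier H) n \<longrightarrow> \<phi> gs = 0)"
  by (simp add: group_cochains_def)

lemma cochain_in: "\<phi> \<in> cochains n \<Longrightarrow> gs \<in> tuples (carrier H) n \<Longrightarrow> \<phi> gs \<in> A"
  by (simp add: cochains_iff)

lemma cochains_subspace: "cochain_subspace (cochains n)"
  by (auto simp: cochain_subspace_def cochains_iff A)

lemma diff_linear: "linear_on S (diff n)"
proof -
  have "diff n (\<phi> + \<psi>) gs = diff n \<phi> gs + diff n \<psi> gs" for \<phi> \<psi> gs
    using act_add[of "gs ! 0"] tuplesD(2)[of gs "carrier H" "Suc n" 0]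
    by (simp add: group_diff_def vscale_distrib sum.distrib)
  moreover have "diff n (c \<odot>\<^sub>c \<phi>) gs = c \<cdot>\<^sub>k diff n \<phi> gs" for c \<phi> gs
    using act_scale[of "gs ! 0" c] tuplesD(2)[of gs "carrier H" "Suc n" 0]
    by (simp add: group_diff_def vscale_distrib vscale_sum mult.commute)
  ultimately show ?thesis by (auto simp: linear_on_def fun_eq_iff)
qed

lemma diff_closed:
  assumes "\<phi> \<in> cochains n"
  shows "diff n \<phi> \<in> cochains (Suc n)"
proof -
  have "diff n \<phi> gs \<in> A" if gs: "gs \<in> tuples (carrier H) (Suc n)" for gs
  proof -
    have "act (gs ! 0) (\<phi> (drop 1 gs)) \<in> A"
      by (intro act_closed cochain_in[OF assms] tuples_drop gs tuplesD(2)[OF gs]) simp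
    moreover have "(\<Sum>j=1..n. (-1) ^ j \<cdot>\<^sub>k \<phi> (merge_at (\<otimes>) j gs)) \<in> A"
      by (intro vector_subspace_sum[OF module_subspace] A(3) cochain_in[OF assms] tuples_merge_at[OF gs]) auto
    moreover have "(-1) ^ (n + 1) \<cdot>\<^sub>k \<phi> (take n gs) \<in> A"
      by (intro A(3) cochain_in[OF assms] tuples_take gs)
    ultimately show ?thesis using gs by (simp add: group_diff_def A)
  qed
  then show ?thesis by (simp add: cochains_iff) (simp add: group_diff_def)
qed

lemma transposition_closed:
  assumes "\<phi> \<in> cochains n" "1 \<le> i" "i \<le> n"
  shows "group_transposition H act n i \<phi> \<in> cochains n"
proof -
  have "group_transposition H act n i \<phi> gs \<in> A" if gs: "gs \<in> tuples (carrier H) n" for gs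
  proof -
    have "\<phi> (transpose_args (\<otimes>) (m_inv H) i gs) \<in> A"
      by (intro cochain_in[OF assms(1)] tuples_transpose_args[OF gs] assms) auto
    moreover have "gs ! 0 \<in> carrier H" using tuplesD(2)[OF gs, of 0] assms by simp
    ultimately show ?thesis using gs by (auto simp: group_transposition_def Let_def A act_closed)
  qed
  then show ?thesis by (simp add: cochains_iff) (simp add: group_transposition_def)
qed

lemma homogeneous_linear:
  assumes "x 0 \<in> carrier H"
  shows "hmg n 0 x = 0" "hmg n (\<phi> + \<psi>) x = hmg n \<phi> x + hmg n \<psi> x"
    "hmg n (c \<odot>\<^sub>c \<phi>) x = c \<cdot>\<^sub>k hmg n \<phi> x"
  using assms by (simp_all add: homogeneous_def act_zero act_add act_scale fun_eq_iff)

lemma homogeneous_partial_products: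
  assumes "\<phi> \<in> cochains n" "gs \<in> tuples (carrier H) n"
  shows "hmg n \<phi> (partial_products H gs) = \<phi> gs"
  using assms by (simp add: homogeneous_def quotients_partial_products partial_products_simps act_one cochain_in)

lemma cochain_eqI:
  assumes "\<phi> \<in> cochains n" "\<psi> \<in> cochains n"
    and "\<And>x. (\<And>i. x i \<in> carrier H) \<Longrightarrow> hmg n \<phi> x = hmg n \<psi> x"
  shows "\<phi> = \<psi>"
proof
  fix gs
  show "\<phi> gs = \<psi> gs"
  proof (cases "gs \<in> tuples (carrier H) n")
    case True
    then show ?thesis
      using homogeneous_partial_products[OF assms(1) True] homogeneous_partial_products[OF assms(2) True]
        assms(3)[of "partial_products H gs"] partial_products_closed[OF True] by simp
  qed (use assms in \<open>auto simp: cochains_iff\<close>)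
qed

text \<open>The differential becomes the alternating sum over the faces. The group acts in the term \<open>j = 0\<close>
  because the face that omits \<open>x\<^sub>0\<close> starts at \<open>x\<^sub>1 = x\<^sub>0 (x\<^sub>0\<^sup>-\<^sup>1x\<^sub>1)\<close>.\<close>

lemma homogeneous_diff:
  assumes \<phi>: "\<phi> \<in> cochains n" and x: "\<And>i. x i \<in> carrier H"
  shows "hmg (Suc n) (diff n \<phi>) x = (\<Sum>j\<le>Suc n. (-1) ^ j \<cdot>\<^sub>k hmg n \<phi> (x \<circ> skip j))"
proof -
  let ?q = "quotients H"
  have q: "?q (Suc n) x \<in> tuples (carrier H) (n + 1)" using quotients_tuple[OF x, of "Suc n"] by simp
  have q0: "\<phi> (?q n (x \<circ> skip j)) \<in> A" for j
    by (intro cochain_in[OF \<phi>] quotients_tuple) (simp add: x)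
  have h: "act (x 0) (act (inv (x 0) \<otimes> x (Suc 0)) v) = act (x (Suc 0)) v" if "v \<in> A" for v
    using x that by (simp flip: act_mult m_assoc)
  have "hmg (Suc n) (diff n \<phi>) x =
      act (x 0) (act (?q (Suc n) x ! 0) (\<phi> (drop 1 (?q (Suc n) x)))
        + (\<Sum>j=1..n. (-1) ^ j \<cdot>\<^sub>k \<phi> (merge_at (\<otimes>) j (?q (Suc n) x)))
        + (-1) ^ (n + 1) \<cdot>\<^sub>k \<phi> (take n (?q (Suc n) x)))"
    using q by (simp add: homogeneous_def group_diff_def)
  also have "(\<Sum>j=1..n. (-1) ^ j \<cdot>\<^sub>k \<phi> (merge_at (\<otimes>) j (?q (Suc n) x))) =
      (\<Sum>j=1..n. (-1) ^ j \<cdot>\<^sub>k \<phi> (?q n (x \<circ> skip j)))"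
    by (intro sum.cong refl) (simp add: merge_quotients x)
  also have "act (x 0) (act (?q (Suc n) x ! 0) (\<phi> (drop 1 (?q (Suc n) x)))
        + (\<Sum>j=1..n. (-1) ^ j \<cdot>\<^sub>k \<phi> (?q n (x \<circ> skip j)))
        + (-1) ^ (n + 1) \<cdot>\<^sub>k \<phi> (take n (?q (Suc n) x))) =
      act (x (Suc 0)) (\<phi> (?q n (x \<circ> skip 0)))
        + (\<Sum>j=1..n. (-1) ^ j \<cdot>\<^sub>k act (x 0) (\<phi> (?q n (x \<circ> skip j))))
        + (-1) ^ (n + 1) \<cdot>\<^sub>k act (x 0) (\<phi> (?q n (x \<circ> skip (Suc n))))"
    using x q0 by (simp only: drop_quotients take_quotients act_add act_scale act_sum nth_quotients zero_less_Suc h)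
  also have "\<dots> = (-1) ^ 0 \<cdot>\<^sub>k hmg n \<phi> (x \<circ> skip 0)
      + (\<Sum>j=1..n. (-1) ^ j \<cdot>\<^sub>k hmg n \<phi> (x \<circ> skip j)) + (-1) ^ (n + 1) \<cdot>\<^sub>k hmg n \<phi> (x \<circ> skip (Suc n))"
  proof -
    have "hmg n \<phi> (x \<circ> skip 0) = act (x (Suc 0)) (\<phi> (?q n (x \<circ> skip 0)))"
      "hmg n \<phi> (x \<circ> skip (Suc n)) = act (x 0) (\<phi> (?q n (x \<circ> skip (Suc n))))"
      by (simp_all add: homogeneous_def skip_def)
    moreover have "(\<Sum>j=1..n. (-1) ^ j \<cdot>\<^sub>k hmg n \<phi> (x \<circ> skip j)) =
        (\<Sum>j=1..n. (-1) ^ j \<cdot>\<^sub>k act (x 0) (\<phi> (?q n (x \<circ> skip j))))"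
      by (intro sum.cong refl) (simp add: homogeneous_def skip_def)
    ultimately show ?thesis by simp
  qed
  also have "\<dots> = (\<Sum>j\<le>Suc n. (-1) ^ j \<cdot>\<^sub>k hmg n \<phi> (x \<circ> skip j))"
  proof -
    have "{..Suc n} = insert 0 (insert (Suc n) {1..n})" by auto
    then show ?thesis by (simp add: add_ac del: sum.atMost_Suc)
  qed
  finally show ?thesis .
qed

text \<open>The transpositions become exchanges of neighbours with a sign; the action of \<open>g\<^sub>1\<close> for \<open>i = 1\<close> again
  accounts for the new first point.\<close>

lemma homogeneous_transposition:
  assumes \<phi>: "\<phi> \<in> cochains n" and x: "\<And>i. x i \<in> carrier H" and i: "1 \<le> i" "i \<le> n"
  shows "hmg n (group_transposition H act n i \<phi>) x = - hmg n \<phi> (x \<circ> swap (i - 1))"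
proof -
  let ?q = "quotients H"
  have q0: "\<phi> (?q n (x \<circ> swap (i - 1))) \<in> A"
    by (intro cochain_in[OF \<phi>] quotients_tuple) (simp add: x)
  have h: "act (x 0) (act (inv (x 0) \<otimes> x (Suc 0)) v) = act (x (Suc 0)) v" if "v \<in> A" for v
    using x that by (simp flip: act_mult m_assoc)
  have "i = 1 \<Longrightarrow> (x \<circ> swap (i - 1)) 0 = x (Suc 0)" "i \<noteq> 1 \<Longrightarrow> (x \<circ> swap (i - 1)) 0 = x 0"
    using i by (auto simp: swap_def)
  moreover have "?q n x ! 0 = inv (x 0) \<otimes> x (Suc 0)" using i by (simp add: nth_quotients)
  ultimately show ?thesis
    using quotients_tuple[of x n, OF x] q0 i x
    by (cases "i = 1")
      (simp_all add: homogeneous_def group_transposition_def Let_def transpose_quotients act_uminus h fun_eq_iff)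
qed

lemma diff_diff:
  assumes "\<phi> \<in> cochains n"
  shows "diff (Suc n) (diff n \<phi>) = 0"
proof (rule cochain_eqI[of _ "Suc (Suc n)"])
  show "0 \<in> cochains (Suc (Suc n))" by (rule cochain_subspaceD(1)[OF cochains_subspace])
  fix x :: "nat \<Rightarrow> 'g" assume x: "\<And>i. x i \<in> carrier H"
  have "hmg (Suc (Suc n)) (diff (Suc n) (diff n \<phi>)) x
      = (\<Sum>i\<le>Suc (Suc n). (-1) ^ i \<cdot>\<^sub>k (\<Sum>j\<le>Suc n. (-1) ^ j \<cdot>\<^sub>k hmg n \<phi> (x \<circ> skip i \<circ> skip j)))"
    by (subst homogeneous_diff[OF diff_closed[OF assms] x], intro sum.cong refl, subst homogeneous_diff[OF assms])
      (simp_all add: x)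
  also have "\<dots> = 0" by (rule alternating_faces_square)
  also have "0 = hmg (Suc (Suc n)) 0 x" by (simp add: homogeneous_def act_zero x fun_eq_iff)
  finally show "hmg (Suc (Suc n)) (diff (Suc n) (diff n \<phi>)) x = hmg (Suc (Suc n)) 0 x" .
qed (intro diff_closed assms)

text \<open>Symmetric cochains are those whose homogeneous form changes sign when neighbours are exchanged.\<close>

lemma sym_cochains_iff:
  "\<phi> \<in> sym_cochains n \<longleftrightarrow> \<phi> \<in> cochains n \<and>
    (\<forall>k x. k < n \<longrightarrow> (\<forall>i. x i \<in> carrier H) \<longrightarrow> hmg n \<phi> (x \<circ> swap k) = - hmg n \<phi> x)"
proof (intro iffI conjI allI impI)
  assume s: "\<phi> \<in> sym_cochains n"
  then show \<phi>: "\<phi> \<in> cochains n" by (simp add: sym_group_cochains_def)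
  fix k and x :: "nat \<Rightarrow> 'g" assume k: "k < n" and x: "\<forall>i. x i \<in> carrier H"
  have "group_transposition H act n (Suc k) \<phi> = \<phi>" using s k by (simp add: sym_group_cochains_def)
  then show "hmg n \<phi> (x \<circ> swap k) = - hmg n \<phi> x"
    using homogeneous_transposition[OF \<phi>, of x "Suc k"] k x by simp
next
  assume a: "\<phi> \<in> cochains n \<and>
    (\<forall>k x. k < n \<longrightarrow> (\<forall>i. x i \<in> carrier H) \<longrightarrow> hmg n \<phi> (x \<circ> swap k) = - hmg n \<phi> x)"
  have "group_transposition H act n i \<phi> = \<phi>" if i: "1 \<le> i" "i \<le> n" for i
  proof (rule cochain_eqI)
    fix x :: "nat \<Rightarrow> 'g" assume x: "\<And>i. x i \<in> carrier H"
    have "hmg n \<phi> (x \<circ> swap (i - 1)) = - hmg n \<phi> x" using a x i by simp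
    then show "hmg n (group_transposition H act n i \<phi>) x = hmg n \<phi> x"
      using a x i by (simp add: homogeneous_transposition)
  qed (use a i transposition_closed in auto)
  then show "\<phi> \<in> sym_cochains n" using a by (simp add: sym_group_cochains_def)
qed

lemma sym_cochains_subspace: "cochain_subspace (sym_cochains n)"
proof -
  note S = cochain_subspaceD[OF cochains_subspace]
  show ?thesis
    unfolding cochain_subspace_def by (auto simp: sym_cochains_iff S homogeneous_linear vscale_distrib)
qed

lemma sym_diff_closed:
  assumes "\<phi> \<in> sym_cochains n"
  shows "diff n \<phi> \<in> sym_cochains (Suc n)"
  unfolding sym_cochains_iff
proof (intro conjI allI impI)
  have \<phi>: "\<phi> \<in> cochains n" using assms by (simp add: sym_cochains_iff)
  then show "diff n \<phi> \<in> cochains (Suc n)" by (rule diff_closed)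
  fix k and x :: "nat \<Rightarrow> 'g" assume k: "k < Suc n" and x: "\<forall>i. x i \<in> carrier H"
  have "hmg (Suc n) (diff n \<phi>) (x \<circ> swap k) = (\<Sum>j\<le>Suc n. (-1) ^ j \<cdot>\<^sub>k hmg n \<phi> (x \<circ> swap k \<circ> skip j))"
    by (rule homogeneous_diff[OF \<phi>]) (use x in simp)
  also have "\<dots> = - (\<Sum>j\<le>Suc n. (-1) ^ j \<cdot>\<^sub>k hmg n \<phi> (x \<circ> skip j))"
  proof (rule alternating_faces_swap)
    fix l and y :: "nat \<Rightarrow> 'g" assume l: "l < n" and "range y \<subseteq> range x"
    then have "y i \<in> range x" for i by blast
    then have "\<forall>i. y i \<in> carrier H" using x by (metis imageE)
    then show "hmg n \<phi> (y \<circ> swap l) = - hmg n \<phi> y" using assms l unfolding sym_cochains_iff by blast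
  qed (use k in simp)
  also have "(\<Sum>j\<le>Suc n. (-1) ^ j \<cdot>\<^sub>k hmg n \<phi> (x \<circ> skip j)) = hmg (Suc n) (diff n \<phi>) x"
    by (rule homogeneous_diff[OF \<phi>, symmetric]) (use x in blast)
  finally show "hmg (Suc n) (diff n \<phi>) (x \<circ> swap k) = - hmg (Suc n) (diff n \<phi>) x" .
qed

lemma complex: "cochain_complex cochains diff"
  by unfold_locales (auto intro: cochains_subspace diff_closed diff_linear diff_diff)

lemma sym_complex: "cochain_complex sym_cochains diff"
proof
  show "diff (Suc n) (diff n \<phi>) = 0" if "\<phi> \<in> sym_cochains n" for n \<phi>
    using that diff_diff by (simp add: sym_cochains_iff)
qed (intro sym_cochains_subspace sym_diff_closed diff_linear; assumption)+

end

text \<open>In homogeneous coordinates differentials and transpositions only rearrange the arguments, so a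
  map of cochains respects both as soon as each coefficient of its value is a linear functional of
  the original cochain, evaluated at pointwise transformed arguments.\<close>

locale natural_map = source: linear_action H A act + target: linear_action G B act'
  for H :: "('h, 'm) monoid_scheme" and A :: "('b \<Rightarrow> 'k::field) set" and act
    and G :: "('g, 'l) monoid_scheme" and B :: "('c \<Rightarrow> 'k) set" and act' +
  fixes F :: "nat \<Rightarrow> ('h list \<Rightarrow> 'b \<Rightarrow> 'k) \<Rightarrow> 'g list \<Rightarrow> 'c \<Rightarrow> 'k"
  assumes closed: "\<phi> \<in> group_cochains H A n \<Longrightarrow> F n \<phi> \<in> group_cochains G B n"
    and coefficient: "\<And>u. \<exists>t s. t \<in> carrier G \<rightarrow> carrier H \<and>
      (\<forall>v w. s (v + w) = s v + s w) \<and> (\<forall>c v. s (c \<cdot>\<^sub>k v) = c * s v) \<and>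
      (\<forall>n \<phi> y. \<phi> \<in> group_cochains H A n \<longrightarrow> (\<forall>i. y i \<in> carrier G) \<longrightarrow>
        homogeneous G act' n (F n \<phi>) y u = s (homogeneous H act n \<phi> (t \<circ> y)))"
begin

lemma linear: "linear_on (source.cochains n) (F n)"
  unfolding linear_on_def
proof (intro conjI ballI allI)
  note S = cochain_subspaceD[OF source.cochains_subspace] and T = cochain_subspaceD[OF target.cochains_subspace]
  fix \<phi> assume \<phi>: "\<phi> \<in> source.cochains n"
  show "F n (\<phi> + \<psi>) = F n \<phi> + F n \<psi>" if \<psi>: "\<psi> \<in> source.cochains n" for \<psi>
  proof (rule target.cochain_eqI)
    fix y :: "nat \<Rightarrow> 'g" assume y: "\<And>i. y i \<in> carrier G"
    show "target.hmg n (F n (\<phi> + \<psi>)) y = target.hmg n (F n \<phi> + F n \<psi>) y"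
    proof
      fix u
      obtain t s where t: "t \<in> carrier G \<rightarrow> carrier H"
        and s: "\<And>v w. s (v + w) = s v + s w"
        and ts: "\<And>\<phi>. \<phi> \<in> source.cochains n \<Longrightarrow> target.hmg n (F n \<phi>) y u = s (source.hmg n \<phi> (t \<circ> y))"
        using coefficient[of u] y by blast
      have ty: "(t \<circ> y) 0 \<in> carrier H" using t y by auto
      show "target.hmg n (F n (\<phi> + \<psi>)) y u = target.hmg n (F n \<phi> + F n \<psi>) y u"
        using y by (simp only: target.homogeneous_linear[of y, OF y[of 0]] source.homogeneous_linear[of "t \<circ> y", OF ty]
          ts \<phi> \<psi> S(2)[OF \<phi> \<psi>] s plus_fun_apply)
    qed
  qed (intro closed S T \<phi> \<psi>)+
  fix c
  show "F n (c \<odot>\<^sub>c \<phi>) = c \<odot>\<^sub>c F n \<phi>"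
  proof (rule target.cochain_eqI)
    fix y :: "nat \<Rightarrow> 'g" assume y: "\<And>i. y i \<in> carrier G"
    show "target.hmg n (F n (c \<odot>\<^sub>c \<phi>)) y = target.hmg n (c \<odot>\<^sub>c F n \<phi>) y"
    proof
      fix u
      obtain t s where t: "t \<in> carrier G \<rightarrow> carrier H"
        and s: "\<And>c v. s (c \<cdot>\<^sub>k v) = c * s v"
        and ts: "\<And>\<phi>. \<phi> \<in> source.cochains n \<Longrightarrow> target.hmg n (F n \<phi>) y u = s (source.hmg n \<phi> (t \<circ> y))"
        using coefficient[of u] y by blast
      have ty: "(t \<circ> y) 0 \<in> carrier H" using t y by auto
      show "target.hmg n (F n (c \<odot>\<^sub>c \<phi>)) y u = target.hmg n (c \<odot>\<^sub>c F n \<phi>) y u"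
        using y by (simp only: target.homogeneous_linear[of y, OF y[of 0]] source.homogeneous_linear[of "t \<circ> y", OF ty]
          ts \<phi> S(3)[OF \<phi>] s vscale_apply)
    qed
  qed (intro closed S T \<phi>)+
qed

lemma commutes:
  assumes \<phi>: "\<phi> \<in> source.cochains n"
  shows "target.diff n (F n \<phi>) = F (Suc n) (source.diff n \<phi>)"
proof (rule target.cochain_eqI)
  fix y :: "nat \<Rightarrow> 'g" assume y: "\<And>i. y i \<in> carrier G"
  show "target.hmg (Suc n) (target.diff n (F n \<phi>)) y = target.hmg (Suc n) (F (Suc n) (source.diff n \<phi>)) y"
  proof
    fix u
    obtain t s where t: "t \<in> carrier G \<rightarrow> carrier H"
      and s: "\<And>v w. s (v + w) = s v + s w" "\<And>c v. s (c \<cdot>\<^sub>k v) = c * s v"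
      and ts: "\<And>n \<phi> y. \<phi> \<in> source.cochains n \<Longrightarrow> (\<forall>i. y i \<in> carrier G) \<Longrightarrow>
        target.hmg n (F n \<phi>) y u = s (source.hmg n \<phi> (t \<circ> y))"
      using coefficient[of u] by blast
    have s0: "s 0 = 0" using s(2)[of 0 0] by simp
    have s_sum: "s (\<Sum>j\<in>J. f j) = (\<Sum>j\<in>J. s (f j))" for f :: "nat \<Rightarrow> _" and J
      using sum_comp_morphism[of s f J, OF s0 s(1)] by (simp add: o_def)
    have "target.hmg (Suc n) (target.diff n (F n \<phi>)) y u
        = (\<Sum>j\<le>Suc n. (-1) ^ j * target.hmg n (F n \<phi>) (y \<circ> skip j) u)"
      by (simp add: target.homogeneous_diff[OF closed[OF \<phi>] y] fun_sum_apply del: sum.atMost_Suc)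
    also have "\<dots> = (\<Sum>j\<le>Suc n. (-1) ^ j * s (source.hmg n \<phi> (t \<circ> y \<circ> skip j)))"
      by (intro sum.cong refl) (simp add: ts[OF \<phi>] y comp_assoc)
    also have "\<dots> = s (source.hmg (Suc n) (source.diff n \<phi>) (t \<circ> y))"
      using t y by (subst source.homogeneous_diff[OF \<phi>]) (auto simp: s_sum s simp del: sum.atMost_Suc)
    also have "\<dots> = target.hmg (Suc n) (F (Suc n) (source.diff n \<phi>)) y u"
      using y by (intro ts[symmetric] source.diff_closed[OF \<phi>]) simp
    finally show "target.hmg (Suc n) (target.diff n (F n \<phi>)) y u
        = target.hmg (Suc n) (F (Suc n) (source.diff n \<phi>)) y u" .
  qed
qed (intro target.diff_closed source.diff_closed closed \<phi>)+

lemma sym_closed: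
  assumes "\<phi> \<in> source.sym_cochains n"
  shows "F n \<phi> \<in> target.sym_cochains n"
  unfolding target.sym_cochains_iff
proof (intro conjI allI impI)
  have \<phi>: "\<phi> \<in> source.cochains n" using assms by (simp add: source.sym_cochains_iff)
  then show "F n \<phi> \<in> target.cochains n" by (rule closed)
  fix k and y :: "nat \<Rightarrow> 'g" assume k: "k < n" and y: "\<forall>i. y i \<in> carrier G"
  show "target.hmg n (F n \<phi>) (y \<circ> swap k) = - target.hmg n (F n \<phi>) y"
  proof
    fix u
    obtain t s where t: "t \<in> carrier G \<rightarrow> carrier H" and s: "\<And>c v. s (c \<cdot>\<^sub>k v) = c * s v"
      and ts: "\<And>y. (\<forall>i. y i \<in> carrier G) \<Longrightarrow> target.hmg n (F n \<phi>) y u = s (source.hmg n \<phi> (t \<circ> y))"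
      using coefficient[of u] \<phi> by blast
    have "s (- v) = - s v" for v using s[of "-1" v] by (simp add: vscale_def fun_Compl_def)
    moreover have "source.hmg n \<phi> (t \<circ> y \<circ> swap k) = - source.hmg n \<phi> (t \<circ> y)"
    proof -
      have "\<forall>i. (t \<circ> y) i \<in> carrier H" using t y by auto
      with assms k show ?thesis unfolding source.sym_cochains_iff by blast
    qed
    ultimately show "target.hmg n (F n \<phi>) (y \<circ> swap k) u = (- target.hmg n (F n \<phi>) y) u"
      using y by (simp add: ts comp_assoc)
  qed
qed

lemma chain_map: "chain_map source.cochains source.diff target.cochains target.diff F"
  by (intro chain_map.intro source.complex target.complex chain_map_axioms.intro closed linear commutes)

lemma sym_chain_map: "chain_map source.sym_cochains source.diff target.sym_cochains target.diff F"
proof (intro chain_map.intro source.sym_complex target.sym_complex chain_map_axioms.intro sym_closed)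
  show "linear_on (source.sym_cochains n) (F n)" for n
    by (rule linear_on_subset[OF linear]) (auto simp: source.sym_cochains_iff)
  show "\<phi> \<in> source.sym_cochains n \<Longrightarrow> target.diff n (F n \<phi>) = F (Suc n) (source.diff n \<phi>)" for n \<phi>
    by (rule commutes) (simp add: source.sym_cochains_iff)
qed

end

section \<open>Twisted group algebras\<close>

locale twisted_group_algebra = group G for G :: "('g, 'm) monoid_scheme" (structure) +
  fixes \<alpha> :: "'g \<Rightarrow> 'g \<Rightarrow> 'k::field"
  assumes finite_carrier: "finite (carrier G)" and two_cocycle: "two_cocycle G \<alpha>"
begin

abbreviation alg where "alg \<equiv> twisted_algebra G \<alpha>"
abbreviation amult (infixl "\<bullet>" 70) where "a \<bullet> b \<equiv> a \<otimes>\<^bsub>alg\<^esub> b"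
abbreviation ainv where "ainv \<equiv> m_inv alg"

lemma cocycle:
  "x \<in> carrier G \<Longrightarrow> y \<in> carrier G \<Longrightarrow> \<alpha> x y \<noteq> 0"
  "x \<in> carrier G \<Longrightarrow> y \<in> carrier G \<Longrightarrow> z \<in> carrier G \<Longrightarrow>
    \<alpha> x (y \<otimes> z) * \<alpha> y z = \<alpha> (x \<otimes> y) z * \<alpha> x y"
  "x \<in> carrier G \<Longrightarrow> \<alpha> x \<one> = 1" "x \<in> carrier G \<Longrightarrow> \<alpha> \<one> x = 1"
  using two_cocycle by (auto simp: two_cocycle_def)

lemma alg_simps:
  "a \<in> carrier alg \<longleftrightarrow> (\<forall>g. g \<notin> carrier G \<longrightarrow> a g = 0)" "\<one>\<^bsub>alg\<^esub> = bar \<one>"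
  by (auto simp: twisted_algebra_def)

lemma alg_subspace: "vector_subspace (carrier alg)"
  by (auto simp: vector_subspace_def alg_simps)

text \<open>The coefficient at \<open>u\<close> collects the pairs \<open>(g, h)\<close> with \<open>gh = u\<close>, that is, \<open>h = g\<^sup>-\<^sup>1u\<close>.\<close>

lemma amult_apply:
  "(a \<bullet> b) u = (if u \<in> carrier G then \<Sum>g\<in>carrier G. a g * b (inv g \<otimes> u) * \<alpha> g (inv g \<otimes> u) else 0)"
proof -
  have "(a \<bullet> b) u = (\<Sum>g\<in>carrier G. \<Sum>h\<in>carrier G. a g * b h * \<alpha> g h * bar (g \<otimes> h) u)"
    by (simp add: twisted_algebra_def fun_sum_apply)
  also have "\<dots> = (\<Sum>g\<in>carrier G.
      if u \<in> carrier G then a g * b (inv g \<otimes> u) * \<alpha> g (inv g \<otimes> u) else 0)"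
  proof (rule sum.cong[OF refl])
    fix g assume g: "g \<in> carrier G"
    have "(\<Sum>h\<in>carrier G. a g * b h * \<alpha> g h * bar (g \<otimes> h) u) =
        (\<Sum>h\<in>carrier G. if h = inv g \<otimes> u \<and> u \<in> carrier G then a g * b h * \<alpha> g h else 0)"
    proof (rule sum.cong[OF refl])
      fix h assume h: "h \<in> carrier G"
      have "u = g \<otimes> h \<longleftrightarrow> h = inv g \<otimes> u \<and> u \<in> carrier G" using g h inv_solve_left[of h g u] by auto
      then show "a g * b h * \<alpha> g h * bar (g \<otimes> h) u
          = (if h = inv g \<otimes> u \<and> u \<in> carrier G then a g * b h * \<alpha> g h else 0)"
        by (simp add: bar_def)
    qed
    also have "\<dots> = (if u \<in> carrier G then a g * b (inv g \<otimes> u) * \<alpha> g (inv g \<otimes> u) else 0)"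
      using g finite_carrier by (auto simp: sum.delta)
    finally show "(\<Sum>h\<in>carrier G. a g * b h * \<alpha> g h * bar (g \<otimes> h) u) =
        (if u \<in> carrier G then a g * b (inv g \<otimes> u) * \<alpha> g (inv g \<otimes> u) else 0)" .
  qed
  finally show ?thesis by simp
qed

lemma amult_closed: "a \<bullet> b \<in> carrier alg"
  by (simp add: alg_simps amult_apply)

lemma amult_linear:
  "(a + b) \<bullet> c = a \<bullet> c + b \<bullet> c" "a \<bullet> (b + c) = a \<bullet> b + a \<bullet> c"
  "(s \<cdot>\<^sub>k a) \<bullet> b = s \<cdot>\<^sub>k (a \<bullet> b)" "a \<bullet> (s \<cdot>\<^sub>k b) = s \<cdot>\<^sub>k (a \<bullet> b)"
  by (auto simp: fun_eq_iff amult_apply sum.distrib[symmetric] sum_distrib_left algebra_simps intro!: sum.cong)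

lemma amult_zero: "0 \<bullet> a = 0" "a \<bullet> 0 = 0"
  by (auto simp: fun_eq_iff amult_apply)

lemma amult_uminus: "(- a) \<bullet> b = - (a \<bullet> b)" "a \<bullet> (- b) = - (a \<bullet> b)"
  by (auto simp: fun_eq_iff amult_apply sum_negf)

lemma amult_sum: "(\<Sum>i\<in>I. f i) \<bullet> b = (\<Sum>i\<in>I. f i \<bullet> b)"
  using sum_comp_morphism[of "\<lambda>a. a \<bullet> b" f I] by (simp add: amult_zero amult_linear o_def)

lemma bar_amult: "g \<in> carrier G \<Longrightarrow> u \<in> carrier G \<Longrightarrow> (bar g \<bullet> a) u = \<alpha> g (inv g \<otimes> u) * a (inv g \<otimes> u)"
  using finite_carrier by (simp add: amult_apply bar_def if_distrib[of "\<lambda>x. x * _"] sum.delta cong: if_cong)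

lemma amult_bar:
  assumes "g \<in> carrier G" "u \<in> carrier G"
  shows "(a \<bullet> bar g) (u \<otimes> g) = a u * \<alpha> u g"
proof -
  have "(a \<bullet> bar g) (u \<otimes> g) = (\<Sum>h\<in>carrier G. if h = u then a u * \<alpha> u g else 0)"
    unfolding amult_apply using assms
    by (auto simp: bar_def inv_solve_left' intro!: sum.cong) (auto simp flip: m_assoc)
  then show ?thesis using assms finite_carrier by (simp add: sum.delta)
qed

lemma bar_closed: "g \<in> carrier G \<Longrightarrow> bar g \<in> carrier alg"
  by (auto simp: alg_simps bar_def)

lemma bar_bar: "g \<in> carrier G \<Longrightarrow> h \<in> carrier G \<Longrightarrow> bar g \<bullet> bar h = \<alpha> g h \<cdot>\<^sub>k bar (g \<otimes> h)"
proof
  fix u assume g: "g \<in> carrier G" "h \<in> carrier G"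
  show "(bar g \<bullet> bar h) u = (\<alpha> g h \<cdot>\<^sub>k bar (g \<otimes> h)) u"
  proof (cases "u \<in> carrier G")
    case True
    then have "u = g \<otimes> h \<longleftrightarrow> inv g \<otimes> u = h" using g inv_solve_left[of h g u] by auto
    then show ?thesis using g True by (auto simp: bar_amult) (auto simp: bar_def)
  qed (use g in \<open>auto simp: amult_apply bar_def\<close>)
qed

text \<open>Substituting \<open>g = hl\<close> turns the inner sum of one side into that of the other, and the two products
  of values of \<open>\<alpha>\<close> agree by the cocycle identity for \<open>h\<close>, \<open>l\<close>, \<open>g\<^sup>-\<^sup>1u\<close>.\<close>

lemma amult_assoc:
  assumes "c \<in> carrier alg"
  shows "(a \<bullet> b) \<bullet> c = a \<bullet> (b \<bullet> c)"
proof
  fix u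
  show "((a \<bullet> b) \<bullet> c) u = (a \<bullet> (b \<bullet> c)) u"
  proof (cases "u \<in> carrier G")
    case u: True
    have "((a \<bullet> b) \<bullet> c) u = (\<Sum>g\<in>carrier G. \<Sum>h\<in>carrier G.
        a h * b (inv h \<otimes> g) * \<alpha> h (inv h \<otimes> g) * c (inv g \<otimes> u) * \<alpha> g (inv g \<otimes> u))"
      using u by (simp add: amult_apply sum_distrib_right)
    also have "\<dots> = (\<Sum>h\<in>carrier G. \<Sum>g\<in>carrier G.
        a h * b (inv h \<otimes> g) * \<alpha> h (inv h \<otimes> g) * c (inv g \<otimes> u) * \<alpha> g (inv g \<otimes> u))"
      by (rule sum.swap)
    also have "\<dots> = (\<Sum>h\<in>carrier G. \<Sum>l\<in>carrier G.
        a h * (b l * c (inv l \<otimes> (inv h \<otimes> u)) * \<alpha> l (inv l \<otimes> (inv h \<otimes> u))) * \<alpha> h (inv h \<otimes> u))"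
    proof (rule sum.cong[OF refl])
      fix h assume h: "h \<in> carrier G"
      have e: "inv h \<otimes> (h \<otimes> l) = l" if "l \<in> carrier G" for l
        using that h by (simp flip: m_assoc)
      have swap: "A * (B * C * Q) * P = A * B * S * C * R" if "P * Q = R * S" for A B C P Q R S :: 'k
      proof -
        have "A * (B * C * Q) * P = A * B * C * (P * Q)" by (simp only: mult_ac)
        also have "\<dots> = A * B * S * C * R" unfolding that by (simp only: mult_ac)
        finally show ?thesis .
      qed
      have hg: "h \<otimes> (inv h \<otimes> g) = g" if "g \<in> carrier G" for g
        using that h by (simp flip: m_assoc)
      have summand: "a h * (b (inv h \<otimes> g) * c (inv (inv h \<otimes> g) \<otimes> (inv h \<otimes> u)) *
          \<alpha> (inv h \<otimes> g) (inv (inv h \<otimes> g) \<otimes> (inv h \<otimes> u))) * \<alpha> h (inv h \<otimes> u) =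
        a h * b (inv h \<otimes> g) * \<alpha> h (inv h \<otimes> g) * c (inv g \<otimes> u) * \<alpha> g (inv g \<otimes> u)"
        if g: "g \<in> carrier G" for g
      proof -
        have r: "inv (inv h \<otimes> g) \<otimes> (inv h \<otimes> u) = inv g \<otimes> u"
        proof -
          have "inv (inv h \<otimes> g) \<otimes> (inv h \<otimes> u) = inv g \<otimes> ((h \<otimes> inv h) \<otimes> u)"
            using g h u by (simp only: inv_mult_group inv_inv m_assoc inv_closed m_closed)
          then show ?thesis using g h u by (simp only: r_inv l_one)
        qed
        have gu: "(inv h \<otimes> g) \<otimes> (inv g \<otimes> u) = inv h \<otimes> u" using inv_cancel[OF h g u] .
        have "\<alpha> h (inv h \<otimes> u) * \<alpha> (inv h \<otimes> g) (inv g \<otimes> u) = \<alpha> g (inv g \<otimes> u) * \<alpha> h (inv h \<otimes> g)"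
          using cocycle(2)[of h "inv h \<otimes> g" "inv g \<otimes> u"] g h u by (simp only: hg gu inv_closed m_closed)
        then show ?thesis unfolding r by (rule swap)
      qed
      show "(\<Sum>g\<in>carrier G.
          a h * b (inv h \<otimes> g) * \<alpha> h (inv h \<otimes> g) * c (inv g \<otimes> u) * \<alpha> g (inv g \<otimes> u)) =
        (\<Sum>l\<in>carrier G.
          a h * (b l * c (inv l \<otimes> (inv h \<otimes> u)) * \<alpha> l (inv l \<otimes> (inv h \<otimes> u))) * \<alpha> h (inv h \<otimes> u))"
        by (rule sum.reindex_bij_witness[where i = "\<lambda>l. h \<otimes> l" and j = "\<lambda>g. inv h \<otimes> g"])
          (use h hg e summand in simp_all)
    qed
    also have "\<dots> = (a \<bullet> (b \<bullet> c)) u"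
      using u by (simp add: amult_apply sum_distrib_left sum_distrib_right)
    finally show ?thesis .
  qed (simp add: amult_apply)
qed

sublocale alg: monoid alg
proof
  show "\<one>\<^bsub>alg\<^esub> \<in> carrier alg" by (simp add: alg_simps(2) bar_closed)
  show "\<one>\<^bsub>alg\<^esub> \<bullet> a = a" if a: "a \<in> carrier alg" for a
  proof
    fix u show "(\<one>\<^bsub>alg\<^esub> \<bullet> a) u = a u"
    proof (cases "u \<in> carrier G")
      case True
      then show ?thesis by (simp add: alg_simps(2) bar_amult cocycle)
    qed (use a in \<open>simp add: alg_simps amult_apply\<close>)
  qed
  show "a \<bullet> \<one>\<^bsub>alg\<^esub> = a" if a: "a \<in> carrier alg" for a
  proof
    fix u show "(a \<bullet> \<one>\<^bsub>alg\<^esub>) u = a u"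
    proof (cases "u \<in> carrier G")
      case True
      then show ?thesis using amult_bar[of \<one> u a] by (simp add: alg_simps(2) cocycle)
    qed (use a in \<open>simp add: alg_simps amult_apply\<close>)
  qed
qed (simp_all add: amult_closed amult_assoc)

text \<open>The nonzero multiples of basis elements are closed under products and inverses of \<open>alg\<close>; a
  construction that ignores scalars may therefore compute with them as in \<open>G\<close>.\<close>

definition lies_over :: "('g \<Rightarrow> 'k) \<Rightarrow> 'g \<Rightarrow> bool"
  where "lies_over u g \<longleftrightarrow> g \<in> carrier G \<and> (\<exists>c. c \<noteq> 0 \<and> u = c \<cdot>\<^sub>k bar g)"

lemma over_bar: "g \<in> carrier G \<Longrightarrow> lies_over (bar g) g"
  by (auto simp: lies_over_def intro!: exI[of _ 1])

lemma over_amult: "lies_over u g \<Longrightarrow> lies_over v h \<Longrightarrow> lies_over (u \<bullet> v) (g \<otimes> h)"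
proof -
  assume "lies_over u g" "lies_over v h"
  then obtain c e where "c \<noteq> 0" "e \<noteq> 0" "u = c \<cdot>\<^sub>k bar g" "v = e \<cdot>\<^sub>k bar h" and g: "g \<in> carrier G" "h \<in> carrier G"
    by (auto simp: lies_over_def)
  then have "u \<bullet> v = (c * e * \<alpha> g h) \<cdot>\<^sub>k bar (g \<otimes> h)" "c * e * \<alpha> g h \<noteq> 0"
    by (simp_all add: amult_linear bar_bar cocycle mult_ac)
  then show "lies_over (u \<bullet> v) (g \<otimes> h)" using g unfolding lies_over_def by blast
qed

lemma unit_inv:
  assumes "a \<in> carrier alg" "b \<in> carrier alg" "a \<bullet> b = \<one>\<^bsub>alg\<^esub>" "b \<bullet> a = \<one>\<^bsub>alg\<^esub>"
  shows "a \<in> Units alg" "ainv a = b"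
  using assms alg.inv_char by (auto simp: Units_def)

text \<open>The candidate inverse of \<open>c \<cdot> bar g\<close> is a multiple of \<open>bar (inv g)\<close>. It is two-sided because
  \<open>\<alpha> (inv g) g = \<alpha> g (inv g)\<close>, the cocycle identity for \<open>g\<close>, \<open>inv g\<close>, \<open>g\<close>.\<close>

lemma over_inverse:
  assumes "lies_over u g"
  shows "u \<in> Units alg" "lies_over (ainv u) (inv g)"
proof -
  obtain c where c: "c \<noteq> 0" "u = c \<cdot>\<^sub>k bar g" and g: "g \<in> carrier G"
    using assms by (auto simp: lies_over_def)
  define v where "v = inverse (c * \<alpha> g (inv g)) \<cdot>\<^sub>k bar (inv g)"
  have "\<alpha> (inv g) g = \<alpha> g (inv g)" using cocycle(2)[of g "inv g" g] g by (simp add: cocycle)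
  then have "u \<bullet> v = \<one>\<^bsub>alg\<^esub>" "v \<bullet> u = \<one>\<^bsub>alg\<^esub>"
    using c g cocycle(1)[of g "inv g"]
    by (simp_all add: v_def amult_linear bar_bar alg_simps(2) mult.left_commute[of "inverse _"]
      mult.assoc[of "inverse _"])
  moreover have "u \<in> carrier alg" "v \<in> carrier alg"
    using g c vector_subspaceD(3)[OF alg_subspace] by (simp_all add: v_def bar_closed)
  ultimately have "u \<in> Units alg" "ainv u = v" using unit_inv by auto
  moreover have "lies_over v (inv g)" 
    unfolding lies_over_def v_def using c g cocycle(1)[of g "inv g"]
    by (intro conjI exI[of _ "inverse (c * \<alpha> g (inv g))"]) simp_all
  ultimately show "u \<in> Units alg" "lies_over (ainv u) (inv g)" by simp_all
qed

lemmas over_unit = over_inverse(1)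

lemma ainv_amult:
  assumes "u \<in> Units alg" "v \<in> Units alg"
  shows "ainv (u \<bullet> v) = ainv v \<bullet> ainv u"
proof (rule unit_inv(2))
  note U = assms alg.Units_closed[OF assms(1)] alg.Units_closed[OF assms(2)]
  have "(u \<bullet> v) \<bullet> (ainv v \<bullet> ainv u) = u \<bullet> (v \<bullet> ainv v) \<bullet> ainv u"
    using U by (simp only: alg.m_assoc alg.m_closed alg.Units_inv_closed)
  then show "(u \<bullet> v) \<bullet> (ainv v \<bullet> ainv u) = \<one>\<^bsub>alg\<^esub>" using U by simp
  have "(ainv v \<bullet> ainv u) \<bullet> (u \<bullet> v) = ainv v \<bullet> (ainv u \<bullet> u) \<bullet> v"
    using U by (simp only: alg.m_assoc alg.m_closed alg.Units_inv_closed)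
  then show "(ainv v \<bullet> ainv u) \<bullet> (u \<bullet> v) = \<one>\<^bsub>alg\<^esub>" using U by simp
qed (use assms alg.Units_closed in auto)

lemma ainv_scale:
  assumes "u \<in> Units alg" "c \<noteq> 0"
  shows "c \<cdot>\<^sub>k u \<in> Units alg" "ainv (c \<cdot>\<^sub>k u) = inverse c \<cdot>\<^sub>k ainv u"
proof -
  have "c \<cdot>\<^sub>k u \<in> carrier alg" "inverse c \<cdot>\<^sub>k ainv u \<in> carrier alg"
    using assms by (intro vector_subspaceD(3)[OF alg_subspace]; simp add: alg.Units_closed)+
  then show "c \<cdot>\<^sub>k u \<in> Units alg" "ainv (c \<cdot>\<^sub>k u) = inverse c \<cdot>\<^sub>k ainv u"
    using assms unit_inv[of "c \<cdot>\<^sub>k u" "inverse c \<cdot>\<^sub>k ainv u"] by (simp_all add: amult_linear)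
qed

definition product :: "('g \<Rightarrow> 'k) list \<Rightarrow> 'g \<Rightarrow> 'k"
  where "product us = foldr (\<bullet>) us \<one>\<^bsub>alg\<^esub>"

lemma product_simps: "product [] = \<one>\<^bsub>alg\<^esub>" "product (u # us) = u \<bullet> product us"
  by (simp_all add: product_def)

lemma product_unit: "set us \<subseteq> Units alg \<Longrightarrow> product us \<in> Units alg"
  by (induction us) (auto simp: product_simps)

lemma product_closed: "set us \<subseteq> carrier alg \<Longrightarrow> product us \<in> carrier alg"
  by (induction us) (auto simp: product_simps)

lemma product_append:
  "set us \<subseteq> carrier alg \<Longrightarrow> set vs \<subseteq> carrier alg \<Longrightarrow> product (us @ vs) = product us \<bullet> product vs"
  by (induction us) (auto simp: product_simps product_closed alg.m_assoc)

lemma foldl_amult: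
  "v \<in> carrier alg \<Longrightarrow> set us \<subseteq> carrier alg \<Longrightarrow> foldl (\<bullet>) v us = v \<bullet> product us"
  by (induction us arbitrary: v) (auto simp: product_simps product_closed alg.m_assoc)

lemma foldl_inverses:
  assumes "v \<in> carrier alg" "set us \<subseteq> Units alg"
  shows "foldl (\<bullet>) v (map ainv (rev us)) = v \<bullet> ainv (product us)"
  using assms(2)
proof (induction us)
  case (Cons u us)
  then show ?case using assms(1)
    by (simp add: product_simps ainv_amult product_unit alg.m_assoc)
qed (simp add: product_simps assms(1))

lemma product_update_scale:
  assumes "k < length us" "set us \<subseteq> carrier alg" "b \<in> carrier alg"
  shows "product (us[k := c \<cdot>\<^sub>k b]) = c \<cdot>\<^sub>k product (us[k := b])"
proof -
  have s: "set (take k us) \<subseteq> carrier alg" "set (drop (Suc k) us) \<subseteq> carrier alg"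
    using assms(2) set_take_subset set_drop_subset by fast+
  have c: "c \<cdot>\<^sub>k b \<in> carrier alg" using assms(3) vector_subspaceD(3)[OF alg_subspace] by blast
  show ?thesis
    using assms(1,3) s c
    by (simp add: upd_conv_take_nth_drop product_append product_simps amult_linear)
qed

lemma product_merge:
  assumes "set us \<subseteq> carrier alg" "1 \<le> j" "j < length us"
  shows "product (merge_at (\<bullet>) j us) = product us"
proof -
  have us: "us = take (j - 1) us @ us ! (j - 1) # us ! j # drop (Suc j) us"
    using assms(2,3) id_take_nth_drop[of "j - 1" us] Cons_nth_drop_Suc[of j us] by simp
  have "set (take (j - 1) us) \<subseteq> carrier alg" "set (drop (Suc j) us) \<subseteq> carrier alg"
    "us ! (j - 1) \<in> carrier alg" "us ! j \<in> carrier alg"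
    using assms set_take_subset set_drop_subset by fastforce+
  then have "product (merge_at (\<bullet>) j us)
      = product (take (j - 1) us @ us ! (j - 1) # us ! j # drop (Suc j) us)"
    by (simp add: merge_at_def product_append product_simps product_closed alg.m_assoc)
  then show ?thesis unfolding us[symmetric] .
qed

text \<open>An interior transposition does not change the product of the list. At either end one neighbour is
  missing, and the product is divided by the outer factor there; this is what the outer
  multiplications in the action on Hochschild cochains compensate.\<close>

lemma product_transpose:
  assumes "set us \<subseteq> Units alg" "1 \<le> i" "i \<le> length us"
  shows "product (transpose_args (\<bullet>) ainv i us) =
    (if i = 1 then ainv (us ! 0) else \<one>\<^bsub>alg\<^esub>) \<bullet> product us \<bullet>
    (if i = length us then ainv (us ! (length us - 1)) else \<one>\<^bsub>alg\<^esub>)"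
proof -
  have U: "u \<in> carrier alg" if "u \<in> Units alg" for u using that by (rule alg.Units_closed)
  have cancel: "ainv a \<bullet> (a \<bullet> b) = b" "a \<bullet> (ainv a \<bullet> b) = b" if "a \<in> Units alg" "b \<in> carrier alg" for a b
    using that U[OF that(1)] by (simp_all add: alg.m_assoc[symmetric] del: alg.m_assoc)
  consider "length us = 1" | "length us \<noteq> 1" "i = 1" | "length us \<noteq> 1" "i \<noteq> 1" "i = length us"
    | "length us \<noteq> 1" "i \<noteq> 1" "i < length us" using assms by linarith
  then show ?thesis
  proof cases
    case 1
    then obtain a where a: "us = [a]" by (auto simp: length_Suc_conv)
    have "i = 1" using assms 1 by simp
    then show ?thesis using assms(1) by (simp add: a transpose_args_def product_simps U)
  next
    case 2
    then obtain a b p where a: "us = a # b # p"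
      using assms by (metis One_nat_def Suc_le_length_iff length_Suc_conv list.exhaust list.size(3))
    have p: "product p \<in> carrier alg" using assms(1) by (intro product_closed) (auto simp: a)
    show ?thesis using assms(1) 2 p
      by (simp add: a transpose_args_def product_simps alg.m_assoc U)
  next
    case 3
    define m where "m = length us - 2"
    have m: "length us = Suc (Suc m)" using 3 assms by (simp add: m_def)
    define p a b where "p = take m us" and "a = us ! m" and "b = us ! Suc m"
    have a: "us = p @ [a, b]"
      using m id_take_nth_drop[of m us] Cons_nth_drop_Suc[of "Suc m" us] by (simp add: p_def a_def b_def)
    have p: "set p \<subseteq> carrier alg" using assms(1) by (auto simp: a)
    show ?thesis using assms(1) 3 p product_closed[OF p]
      by (simp add: a transpose_args_def Let_def product_append product_simps nth_append alg.m_assoc U)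
  next
    case 4
    define p where "p = take (i - 2) us"
    define q where "q = drop (Suc i) us"
    define a b c where "a = us ! (i - 2)" "b = us ! (i - 1)" "c = us ! i"
    have us: "us = p @ [a, b, c] @ q"
      using 4 assms id_take_nth_drop[of "i - 2" us] Cons_nth_drop_Suc[of "i - 1" us] Cons_nth_drop_Suc[of i us]
      by (simp add: p_def q_def a_b_c_def Suc_diff_Suc numeral_2_eq_2)
    have t: "transpose_args (\<bullet>) ainv i us = p @ [a \<bullet> b, ainv b, b \<bullet> c] @ q"
      using 4 by (simp add: transpose_args_def Let_def p_def q_def a_b_c_def)
    have p: "set p \<subseteq> carrier alg" "set q \<subseteq> carrier alg"
      and abc: "a \<in> Units alg" "b \<in> Units alg" "c \<in> Units alg"
      using assms(1) unfolding us by auto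
    then have "product (p @ [a \<bullet> b, ainv b, b \<bullet> c] @ q) = product (p @ [a, b, c] @ q)"
      by (simp add: product_append product_simps product_closed alg.m_assoc cancel U)
    then have "product (transpose_args (\<bullet>) ainv i us) = product us" unfolding t us[symmetric] .
    moreover have "product us \<in> carrier alg" using assms(1) product_unit by blast
    ultimately show ?thesis using 4 by simp
  qed
qed

section \<open>Multilinear cochains\<close>

abbreviation hcochains where "hcochains \<equiv> hoch_cochains G \<alpha>"
abbreviation hsym_cochains where "hsym_cochains \<equiv> sym_hoch_cochains G \<alpha>"
abbreviation hdiff where "hdiff \<equiv> hoch_diff G \<alpha>"

definition multilinear :: "nat \<Rightarrow> (('g \<Rightarrow> 'k) list \<Rightarrow> 'g \<Rightarrow> 'k) \<Rightarrow> bool"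
  where "multilinear n \<phi> \<longleftrightarrow> (\<forall>as\<in>tuples (carrier alg) n. \<forall>i<n. \<forall>a\<in>carrier alg. \<forall>b\<in>carrier alg. \<forall>c.
    \<phi> (as[i := a + b]) = \<phi> (as[i := a]) + \<phi> (as[i := b]) \<and>
    \<phi> (as[i := c \<cdot>\<^sub>k a]) = c \<cdot>\<^sub>k \<phi> (as[i := a]))"

lemma hcochains_iff:
  "\<phi> \<in> hcochains n \<longleftrightarrow> (\<forall>as\<in>tuples (carrier alg) n. \<phi> as \<in> carrier alg) \<and>
    (\<forall>as. as \<notin> tuples (carrier alg) n \<longrightarrow> \<phi> as = 0) \<and> multilinear n \<phi>"
  by (simp add: hoch_cochains_def Let_def multilinear_def)

lemma hcochain_in: "\<phi> \<in> hcochains n \<Longrightarrow> as \<in> tuples (carrier alg) n \<Longrightarrow> \<phi> as \<in> carrier alg"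
  by (simp add: hcochains_iff)

lemma multilinearD:
  assumes "multilinear n \<phi>" "as \<in> tuples (carrier alg) n" "i < n" "a \<in> carrier alg"
  shows "b \<in> carrier alg \<Longrightarrow> \<phi> (as[i := a + b]) = \<phi> (as[i := a]) + \<phi> (as[i := b])"
    "\<phi> (as[i := c \<cdot>\<^sub>k a]) = c \<cdot>\<^sub>k \<phi> (as[i := a])"
  using assms unfolding multilinear_def by blast+

lemma multilinear_add: "multilinear n \<phi> \<Longrightarrow> multilinear n \<psi> \<Longrightarrow> multilinear n (\<lambda>as. \<phi> as + \<psi> as)"
  unfolding multilinear_def by (simp add: vscale_distrib add_ac)

lemma multilinear_scale: "multilinear n \<phi> \<Longrightarrow> multilinear n (\<lambda>as. s \<cdot>\<^sub>k \<phi> as)"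
  unfolding multilinear_def by (simp add: vscale_distrib mult.commute)

lemma multilinear_sum:
  "(\<And>j. j \<in> J \<Longrightarrow> multilinear n (\<phi> j)) \<Longrightarrow> multilinear n (\<lambda>as. \<Sum>j\<in>J. \<phi> j as)"
  unfolding multilinear_def by (simp add: sum.distrib vscale_sum)

lemma multilinear_cong:
  assumes "multilinear n \<phi>" "\<And>as. as \<in> tuples (carrier alg) n \<Longrightarrow> \<phi> as = \<psi> as"
  shows "multilinear n \<psi>"
proof -
  have u: "as[i := a] \<in> tuples (carrier alg) n" if "as \<in> tuples (carrier alg) n" "a \<in> carrier alg" for as i a
    using that set_update_subset_insert[of as i a] by (auto simp: tuples_def)
  note A = vector_subspaceD[OF alg_subspace]
  show ?thesis unfolding multilinear_def
    using multilinearD[OF assms(1)] by (simp add: A u flip: assms(2))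
qed

lemma hcochains_subspace: "cochain_subspace (hcochains n)"
proof -
  note A = vector_subspaceD[OF alg_subspace]
  have "multilinear n 0" by (simp add: multilinear_def)
  moreover have "multilinear n (\<phi> + \<psi>)" if "multilinear n \<phi>" "multilinear n \<psi>" for \<phi> \<psi>
    using multilinear_add[OF that] by (simp add: plus_fun_def)
  moreover have "multilinear n (c \<odot>\<^sub>c \<phi>)" if "multilinear n \<phi>" for c \<phi>
    using multilinear_scale[OF that] by (simp add: cscale_def)
  ultimately show ?thesis by (simp add: cochain_subspace_def hcochains_iff A)
qed

lemma map_bar_tuple: "gs \<in> tuples (carrier G) n \<Longrightarrow> map bar gs \<in> tuples (carrier alg) n"
  by (auto simp: tuples_iff bar_closed)

lemma update_tuple: "as \<in> tuples S n \<Longrightarrow> a \<in> S \<Longrightarrow> as[i := a] \<in> tuples S n"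
  using set_update_subset_insert[of as i a] by (auto simp: tuples_def)

lemma expand_in_basis: "a \<in> carrier alg \<Longrightarrow> a = (\<Sum>g\<in>carrier G. a g \<cdot>\<^sub>k bar g)"
  using finite_carrier
  by (auto simp: fun_eq_iff fun_sum_apply alg_simps bar_def if_distrib[of "\<lambda>x. _ * x"] sum.delta' cong: if_cong)

text \<open>The induction on \<open>k\<close> replaces basis elements by arbitrary ones in the first \<open>k\<close> arguments, one
  argument at a time.\<close>

lemma multilinear_zero_on_basis:
  assumes m: "multilinear n \<phi>" and z: "\<And>gs. gs \<in> tuples (carrier G) n \<Longrightarrow> \<phi> (map bar gs) = 0"
    and as: "as \<in> tuples (carrier alg) n"
  shows "\<phi> as = 0"
proof -
  have "\<phi> as = 0" if "k \<le> n" "as \<in> tuples (carrier alg) n" "\<forall>i. k \<le> i \<longrightarrow> i < n \<longrightarrow> (\<exists>g\<in>carrier G. as ! i = bar g)"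
    for k as using that
  proof (induction k arbitrary: as)
    case 0
    then obtain g where g: "\<forall>i<n. g i \<in> carrier G \<and> as ! i = bar (g i)" by (metis zero_le)
    have "as = map bar (map g [0..<n])"
      using g tuplesD(1)[OF 0(2)] by (intro nth_equalityI) auto
    moreover have "map g [0..<n] \<in> tuples (carrier G) n" using g by (auto simp: tuples_iff)
    ultimately show ?case using z by metis
  next
    case (Suc k)
    note A = vector_subspaceD[OF alg_subspace]
    have k: "k < n" using Suc by simp
    have ak: "as ! k \<in> carrier alg" using tuplesD(2)[OF Suc.prems(2) k] .
    define L where "L a = \<phi> (as[k := a])" for a
    have L: "L (a + b) = L a + L b" "L (c \<cdot>\<^sub>k a) = c \<cdot>\<^sub>k L a" if "a \<in> carrier alg" "b \<in> carrier alg" for a b c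
      using multilinearD[OF m Suc.prems(2) k] that by (simp_all add: L_def)
    have L0: "L 0 = 0" using L(2)[OF A(1) A(1), of 0] by simp
    have L_sum: "L (\<Sum>g\<in>S. f g) = (\<Sum>g\<in>S. L (f g))" if "\<And>g. g \<in> S \<Longrightarrow> f g \<in> carrier alg" for S and f :: "'g \<Rightarrow> _"
      using that
    proof (induction S rule: infinite_finite_induct)
      case (insert x S)
      have "L (f x + sum f S) = L (f x) + L (sum f S)"
        using insert by (intro L vector_subspace_sum[OF alg_subspace]) auto
      also have "L (sum f S) = (\<Sum>g\<in>S. L (f g))" using insert by blast
      finally show ?case unfolding sum.insert[OF insert(1,2)] .
    qed (simp_all add: L0)
    have "\<phi> as = L (\<Sum>g\<in>carrier G. (as ! k) g \<cdot>\<^sub>k bar g)"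
      unfolding expand_in_basis[OF ak, symmetric] by (simp add: L_def)
    also have "\<dots> = (\<Sum>g\<in>carrier G. L ((as ! k) g \<cdot>\<^sub>k bar g))"
      by (rule L_sum) (simp add: A bar_closed)
    also have "\<dots> = (\<Sum>g\<in>carrier G. (as ! k) g \<cdot>\<^sub>k L (bar g))"
      by (intro sum.cong refl L(2)[OF bar_closed A(1)])
    also have "\<dots> = 0"
    proof (intro sum.neutral ballI)
      fix g assume g: "g \<in> carrier G"
      have "L (bar g) = 0" unfolding L_def
      proof (rule Suc.IH)
        show "as[k := bar g] \<in> tuples (carrier alg) n"
          by (rule update_tuple[OF Suc.prems(2) bar_closed[OF g]])
        show "\<forall>i. k \<le> i \<longrightarrow> i < n \<longrightarrow> (\<exists>h\<in>carrier G. as[k := bar g] ! i = bar h)"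
          using Suc.prems(3) g tuplesD(1)[OF Suc.prems(2)]
          by (auto simp: nth_list_update)
      qed (use k in simp)
      then show "(as ! k) g \<cdot>\<^sub>k L (bar g) = 0" by simp
    qed
    finally show ?case .
  qed
  from this[of n as] as show ?thesis by simp
qed

lemma hcochain_eqI:
  assumes "\<phi> \<in> hcochains n" "\<psi> \<in> hcochains n"
    and "\<And>gs. gs \<in> tuples (carrier G) n \<Longrightarrow> \<phi> (map bar gs) = \<psi> (map bar gs)"
  shows "\<phi> = \<psi>"
proof
  fix as
  have d: "\<phi> - \<psi> \<in> hcochains n" using assms(1,2) by (rule cochain_subspaceD(5)[OF hcochains_subspace])
  show "\<phi> as = \<psi> as"
  proof (cases "as \<in> tuples (carrier alg) n")
    case True
    have "(\<phi> - \<psi>) as = 0"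
    proof (rule multilinear_zero_on_basis[OF _ _ True])
      show "multilinear n (\<phi> - \<psi>)" using d by (simp add: hcochains_iff)
    qed (simp add: assms(3) fun_eq_iff)
    then show ?thesis by simp
  qed (use assms(1,2) in \<open>simp add: hcochains_iff\<close>)
qed

lemma finite_tuples: "finite (tuples (carrier G) n)"
proof -
  have "tuples (carrier G) n = {xs. set xs \<subseteq> carrier G \<and> length xs = n}" by (auto simp: tuples_def)
  then show ?thesis using finite_lists_length_eq[OF finite_carrier, of n] by simp
qed

lemma multilinear_extension_cochain:
  assumes "\<And>gs. gs \<in> tuples (carrier G) n \<Longrightarrow> F gs \<in> carrier alg"
  shows "multilinear_extension G \<alpha> n F \<in> hcochains n"
proof -
  note A = vector_subspaceD[OF alg_subspace]
  have "multilinear n (\<lambda>as. \<Sum>gs\<in>tuples (carrier G) n. (\<Prod>i<n. (as ! i) (gs ! i)) \<cdot>\<^sub>k F gs)"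
  proof (rule multilinear_sum)
    fix gs assume "gs \<in> tuples (carrier G) n"
    have p: "(\<Prod>j<n. (as[i := a] ! j) (gs ! j)) = a (gs ! i) * (\<Prod>j\<in>{..<n} - {i}. (as ! j) (gs ! j))"
      if "i < n" "length as = n" for as i and a :: "'g \<Rightarrow> 'k"
    proof -
      have "(\<Prod>j<n. (as[i := a] ! j) (gs ! j)) =
          (as[i := a] ! i) (gs ! i) * (\<Prod>j\<in>{..<n} - {i}. (as[i := a] ! j) (gs ! j))"
        using that by (intro prod.remove) auto
      also have "(\<Prod>j\<in>{..<n} - {i}. (as[i := a] ! j) (gs ! j)) = (\<Prod>j\<in>{..<n} - {i}. (as ! j) (gs ! j))"
        by (intro prod.cong refl) auto
      finally show ?thesis using that by simp
    qed
    show "multilinear n (\<lambda>as. (\<Prod>i<n. (as ! i) (gs ! i)) \<cdot>\<^sub>k F gs)"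
      unfolding multilinear_def
      by (auto simp: p tuplesD(1) distrib_right vscale_distrib mult.assoc)
  qed
  then have "multilinear n (multilinear_extension G \<alpha> n F)"
    by (rule multilinear_cong) (simp add: multilinear_extension_def)
  moreover have "multilinear_extension G \<alpha> n F as \<in> carrier alg" for as
    unfolding multilinear_extension_def using A assms by (auto intro!: vector_subspace_sum[OF alg_subspace])
  ultimately show ?thesis by (simp add: hcochains_iff) (simp add: multilinear_extension_def)
qed

lemma multilinear_extension_bar:
  assumes "gs \<in> tuples (carrier G) n"
  shows "multilinear_extension G \<alpha> n F (map bar gs) = F gs"
proof -
  have "(\<Prod>i<n. (map bar gs ! i) (hs ! i)) = (if hs = gs then 1 else (0 :: 'k))"
    if hs: "hs \<in> tuples (carrier G) n" for hs
  proof (cases "hs = gs")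
    case False
    then obtain i where "i < n" "hs ! i \<noteq> gs ! i"
      using tuplesD(1)[OF hs] tuplesD(1)[OF assms] by (auto simp: list_eq_iff_nth_eq)
    then have "(map bar gs ! i) (hs ! i) = (0 :: 'k)" using tuplesD(1)[OF assms] by (simp add: bar_def)
    with \<open>i < n\<close> False show ?thesis by (auto intro!: prod_zero)
  qed (use tuplesD(1)[OF assms] in \<open>auto simp: bar_def\<close>)
  then have "multilinear_extension G \<alpha> n F (map bar gs) =
      (\<Sum>hs\<in>tuples (carrier G) n. (if hs = gs then 1 else 0) \<cdot>\<^sub>k F hs)"
    unfolding multilinear_extension_def using map_bar_tuple[OF assms] by (auto intro!: sum.cong)
  also have "\<dots> = (\<Sum>hs\<in>tuples (carrier G) n. if hs = gs then F hs else 0)"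
    by (intro sum.cong refl) auto
  also have "\<dots> = F gs" using assms finite_tuples by (simp add: sum.delta')
  finally show ?thesis .
qed

end

context twisted_group_algebra
begin

section \<open>The Hochschild complex as a complex of group cochains\<close>

definition conj :: "'g \<Rightarrow> ('g \<Rightarrow> 'k) \<Rightarrow> 'g \<Rightarrow> 'k"
  where "conj g a = bar g \<bullet> a \<bullet> ainv (bar g)"

text \<open>A scalar cancels in a conjugation, so any element over \<open>g\<close> conjugates like \<open>bar g\<close>. This makes
  conjugation an action of \<open>G\<close>, although \<open>g \<mapsto> bar g\<close> is not multiplicative.\<close>

lemma conj_over:
  assumes "lies_over u g" "a \<in> carrier alg"
  shows "u \<bullet> a \<bullet> ainv u = conj g a"
proof -
  obtain c where c: "c \<noteq> 0" "u = c \<cdot>\<^sub>k bar g" and g: "g \<in> carrier G"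
    using assms(1) by (auto simp: lies_over_def)
  have "ainv u = inverse c \<cdot>\<^sub>k ainv (bar g)"
    unfolding c(2) by (rule ainv_scale[OF over_unit[OF over_bar[OF g]] c(1)])
  then show ?thesis using c(1) unfolding c(2) by (simp add: conj_def amult_linear)
qed

lemma conj_action: "linear_action G (carrier alg) conj"
proof
  show "vector_subspace (carrier alg)" by (rule alg_subspace)
  show "conj g v \<in> carrier alg" for g v by (simp add: conj_def amult_closed)
  show "conj g (v + w) = conj g v + conj g w" "conj g (c \<cdot>\<^sub>k v) = c \<cdot>\<^sub>k conj g v" for g v w c
    by (simp_all add: conj_def amult_linear)
  show "conj \<one> v = v" if "v \<in> carrier alg" for v
    using that by (simp add: conj_def flip: alg_simps(2))
  show "conj (g \<otimes> h) v = conj g (conj h v)"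
    if g: "g \<in> carrier G" "h \<in> carrier G" and v: "v \<in> carrier alg" for g h v
  proof -
    have u: "bar g \<in> Units alg" "bar h \<in> Units alg" using over_unit over_bar g by auto
    have "conj (g \<otimes> h) v = (bar g \<bullet> bar h) \<bullet> v \<bullet> ainv (bar g \<bullet> bar h)"
      by (rule conj_over[symmetric]) (intro over_amult over_bar g v)+
    then show ?thesis using u v bar_closed g by (simp add: ainv_amult conj_def alg.m_assoc)
  qed
qed

text \<open>Compare the coefficients at \<open>u \<otimes> g\<close> in \<open>conj g a \<bullet> bar g = bar g \<bullet> a\<close>.\<close>

lemma conj_coefficient:
  assumes "g \<in> carrier G" "u \<in> carrier G" "a \<in> carrier alg"
  shows "conj g a u * \<alpha> u g = \<alpha> g (inv g \<otimes> u \<otimes> g) * a (inv g \<otimes> u \<otimes> g)"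
proof -
  have u: "bar g \<in> Units alg" using over_unit over_bar assms(1) by auto
  have "conj g a \<bullet> bar g = bar g \<bullet> a"
    using u assms bar_closed by (simp add: conj_def alg.m_assoc)
  then have "conj g a u * \<alpha> u g = (bar g \<bullet> a) (u \<otimes> g)" using amult_bar[OF assms(1,2), of "conj g a"] by simp
  then show ?thesis using assms by (simp add: bar_amult m_assoc)
qed

text \<open>The classical passage from Hochschild cochains of a group algebra to group cochains with
  coefficients in the algebra under conjugation:
  \<open>(g\<^sub>1, \<dots>, g\<^sub>n) \<mapsto> \<phi>(bar g\<^sub>1, \<dots>, bar g\<^sub>n) (bar g\<^sub>1 \<cdots> bar g\<^sub>n)\<^sup>-\<^sup>1\<close>.\<close>

definition twist :: "nat \<Rightarrow> (('g \<Rightarrow> 'k) list \<Rightarrow> 'g \<Rightarrow> 'k) \<Rightarrow> 'g list \<Rightarrow> 'g \<Rightarrow> 'k"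
  where "twist n \<phi> = (\<lambda>gs. if gs \<in> tuples (carrier G) n
    then \<phi> (map bar gs) \<bullet> ainv (product (map bar gs)) else 0)"

lemma list_over_units:
  assumes "list_all2 lies_over us gs"
  shows "set us \<subseteq> Units alg" "set us \<subseteq> carrier alg"
proof -
  show "set us \<subseteq> Units alg"
    using assms over_unit by (auto simp: list_all2_conv_all_nth set_conv_nth)
  then show "set us \<subseteq> carrier alg" using alg.Units_closed by blast
qed

lemma list_over_bar: "gs \<in> tuples (carrier G) n \<Longrightarrow> list_all2 lies_over (map bar gs) gs"
  by (auto simp: list_all2_conv_all_nth tuples_iff over_bar)

lemma list_over_merge:
  assumes "list_all2 lies_over us gs" "1 \<le> j" "j < length gs"
  shows "list_all2 lies_over (merge_at (\<bullet>) j us) (merge_at (\<otimes>) j gs)"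
proof (rule list_all2_all_nthI)
  have l: "length us = length gs" and o: "\<And>i. i < length gs \<Longrightarrow> lies_over (us ! i) (gs ! i)"
    using assms(1) by (auto simp: list_all2_conv_all_nth)
  then show "length (merge_at (\<bullet>) j us) = length (merge_at (\<otimes>) j gs)"
    using assms by (simp add: length_merge_at)
  fix k assume "k < length (merge_at (\<bullet>) j us)"
  then have "k < length gs - 1" using l assms by (simp add: length_merge_at)
  then show "lies_over (merge_at (\<bullet>) j us ! k) (merge_at (\<otimes>) j gs ! k)"
    using l o assms by (simp add: nth_merge_at over_amult)
qed

lemma list_over_transpose:
  assumes "list_all2 lies_over us gs" "1 \<le> i" "i \<le> length gs"
  shows "list_all2 lies_over (transpose_args (\<bullet>) ainv i us) (transpose_args (\<otimes>) (m_inv G) i gs)"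
proof (rule list_all2_all_nthI)
  have l: "length us = length gs" and o: "\<And>i. i < length gs \<Longrightarrow> lies_over (us ! i) (gs ! i)"
    using assms(1) by (auto simp: list_all2_conv_all_nth)
  then show "length (transpose_args (\<bullet>) ainv i us) = length (transpose_args (\<otimes>) (m_inv G) i gs)"
    using assms by (simp add: length_transpose_args)
  fix k assume "k < length (transpose_args (\<bullet>) ainv i us)"
  then have "k < length gs" using l assms by (simp add: length_transpose_args)
  then show "lies_over (transpose_args (\<bullet>) ainv i us ! k) (transpose_args (\<otimes>) (m_inv G) i gs ! k)"
    using l o assms by (simp add: nth_transpose_args over_amult over_inverse(2))
qed

text \<open>Scaling the \<open>i\<close>-th argument scales \<open>\<phi>\<close> by multilinearity and the inverse of the product by the
  reciprocal. Hence arbitrary elements over the \<open>g\<^sub>i\<close> may stand in for the basis elements, in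
  particular products and inverses of basis elements; no value of \<open>\<alpha>\<close> has to be tracked.\<close>

lemma twist_over:
  assumes \<phi>: "\<phi> \<in> hcochains n" and gs: "gs \<in> tuples (carrier G) n" and us: "list_all2 lies_over us gs"
  shows "\<phi> us \<bullet> ainv (product us) = twist n \<phi> gs"
proof -
  have l: "length gs = n" "length us = n" using gs us by (auto simp: tuples_iff list_all2_conv_all_nth)
  \<comment> \<open>The first \<open>k\<close> arguments replaced by the basis elements below them.\<close>
  define w where "w k = map bar (take k gs) @ drop k us" for k
  have "\<phi> (w k) \<bullet> ainv (product (w k)) = \<phi> us \<bullet> ainv (product us)" if "k \<le> n" for k using that
  proof (induction k)
    case (Suc k)
    then have k: "k < n" by simp
    then have "lies_over (us ! k) (gs ! k)" using us l by (auto simp: list_all2_conv_all_nth)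
    then obtain c where c: "c \<noteq> 0" "us ! k = c \<cdot>\<^sub>k bar (gs ! k)" and g: "gs ! k \<in> carrier G"
      by (auto simp: lies_over_def)
    have w: "list_all2 lies_over (w (Suc k)) gs"
    proof (rule list_all2_all_nthI)
      show "length (w (Suc k)) = length gs" using k l by (simp add: w_def)
      fix i assume "i < length (w (Suc k))"
      then have i: "i < n" using k l by (simp add: w_def)
      then show "lies_over (w (Suc k) ! i) (gs ! i)"
        using us gs l k by (auto simp: w_def nth_append list_all2_conv_all_nth tuples_iff over_bar)
    qed
    have "w k = (w (Suc k))[k := c \<cdot>\<^sub>k bar (gs ! k)]" "w (Suc k) = (w (Suc k))[k := bar (gs ! k)]"
      using k l c(2) by (auto intro!: nth_equalityI simp: w_def nth_append nth_list_update)
    moreover have "w (Suc k) \<in> tuples (carrier alg) n"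
      using list_over_units(2)[OF w] k l by (simp add: tuples_def w_def)
    ultimately have "\<phi> (w k) = c \<cdot>\<^sub>k \<phi> (w (Suc k))" "product (w k) = c \<cdot>\<^sub>k product (w (Suc k))"
      using multilinearD(2)[of n \<phi> "w (Suc k)" k "bar (gs ! k)" c] product_update_scale[of k "w (Suc k)" "bar (gs ! k)" c]
        \<phi> k g by (simp_all add: hcochains_iff bar_closed tuples_def)
    moreover have "ainv (c \<cdot>\<^sub>k product (w (Suc k))) = inverse c \<cdot>\<^sub>k ainv (product (w (Suc k)))"
      by (rule ainv_scale[OF product_unit[OF list_over_units(1)[OF w]] c(1)])
    ultimately have "\<phi> (w k) \<bullet> ainv (product (w k)) = \<phi> (w (Suc k)) \<bullet> ainv (product (w (Suc k)))"
      using c(1) by (simp add: amult_linear)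
    with Suc show ?case by simp
  qed (simp add: w_def)
  from this[of n] show ?thesis using l gs by (simp add: w_def twist_def)
qed

lemma twist_closed:
  assumes "\<phi> \<in> hcochains n"
  shows "twist n \<phi> \<in> group_cochains G (carrier alg) n"
  by (simp add: group_cochains_def twist_def amult_closed)

lemma twist_linear: "linear_on S (twist n)"
  by (auto simp: linear_on_def twist_def fun_eq_iff amult_linear)

lemma untwist:
  assumes "\<phi> \<in> hcochains n" "gs \<in> tuples (carrier G) n"
  shows "\<phi> (map bar gs) = twist n \<phi> gs \<bullet> product (map bar gs)"
proof -
  note u = product_unit[OF list_over_units(1)[OF list_over_bar[OF assms(2)]]]
  then show ?thesis
    using hcochain_in[OF assms(1) map_bar_tuple[OF assms(2)]] assms(2)
    by (simp add: twist_def alg.m_assoc alg.Units_closed)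
qed

lemma twist_inj:
  assumes "\<phi> \<in> hcochains n" "\<psi> \<in> hcochains n" "twist n \<phi> = twist n \<psi>"
  shows "\<phi> = \<psi>"
  using assms(1,2) by (rule hcochain_eqI) (simp add: untwist[OF assms(1)] untwist[OF assms(2)] assms(3))

lemma transposition_closed:
  assumes "\<phi> \<in> hcochains n" "1 \<le> i" "i \<le> n"
  shows "hoch_transposition G \<alpha> n i \<phi> \<in> hcochains n"
  unfolding hoch_transposition_def Let_def
proof (rule multilinear_extension_cochain)
  fix gs assume gs: "gs \<in> tuples (carrier G) n"
  let ?ts = "transpose_args (\<bullet>) ainv i (map bar gs)"
  have t: "list_all2 lies_over ?ts (transpose_args (\<otimes>) (m_inv G) i gs)"
    using list_over_transpose[OF list_over_bar[OF gs]] assms gs by (simp add: tuples_iff)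
  have "?ts \<in> tuples (carrier alg) n"
    using list_over_units(2)[OF t] assms gs by (simp add: tuples_def length_transpose_args)
  then have "\<phi> ?ts \<in> carrier alg" by (rule hcochain_in[OF assms(1)])
  then show "- (if i = n then (if i = 1 then bar (gs ! 0) \<bullet> \<phi> ?ts else \<phi> ?ts) \<bullet> bar (gs ! (n - 1))
      else if i = 1 then bar (gs ! 0) \<bullet> \<phi> ?ts else \<phi> ?ts) \<in> carrier alg"
    by (intro vector_subspaceD(4)[OF alg_subspace]) (simp add: amult_closed)
qed

text \<open>Let \<open>Q\<close> be the product of the arguments and \<open>e\<close>, \<open>f\<close> the outer factors of the transposition, equal
  to \<open>\<one>\<close> where there is none. The transposed list has product \<open>e\<^sup>-\<^sup>1Qf\<^sup>-\<^sup>1\<close>, so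
  \<open>e\<phi>f Q\<^sup>-\<^sup>1 = e (\<phi> \<cdot> fQ\<^sup>-\<^sup>1e) e\<^sup>-\<^sup>1\<close> is the value of the twisted cochain, conjugated by \<open>e\<close>.\<close>

lemma twist_transposition:
  assumes \<phi>: "\<phi> \<in> hcochains n" and i: "1 \<le> i" "i \<le> n"
  shows "twist n (hoch_transposition G \<alpha> n i \<phi>) = group_transposition G conj n i (twist n \<phi>)"
proof
  fix gs
  show "twist n (hoch_transposition G \<alpha> n i \<phi>) gs = group_transposition G conj n i (twist n \<phi>) gs"
  proof (cases "gs \<in> tuples (carrier G) n")
    case gs: True
    then have l: "length gs = n" by (rule tuplesD)
    let ?us = "map bar gs" let ?ts = "transpose_args (\<bullet>) ainv i ?us"
    let ?Q = "product ?us"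
    define e f where "e = (if i = 1 then bar (gs ! 0) else \<one>\<^bsub>alg\<^esub>)"
      and "f = (if i = n then bar (gs ! (n - 1)) else \<one>\<^bsub>alg\<^esub>)"
    note o = list_over_bar[OF gs]
    have t: "list_all2 lies_over ?ts (transpose_args (\<otimes>) (m_inv G) i gs)"
      using list_over_transpose[OF o] i l by simp
    have tg: "transpose_args (\<otimes>) (m_inv G) i gs \<in> tuples (carrier G) n"
      by (rule tuples_transpose_args[OF gs i]) auto
    have "gs ! 0 \<in> carrier G" "gs ! (n - 1) \<in> carrier G" using tuplesD(2)[OF gs] i by auto
    then have ef: "e \<in> Units alg" "f \<in> Units alg" using over_unit over_bar by (auto simp: e_def f_def)
    have Q: "?Q \<in> Units alg" by (rule product_unit[OF list_over_units(1)[OF o]])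
    have v: "\<phi> ?ts \<in> carrier alg"
      using list_over_units(2)[OF t] i l by (intro hcochain_in[OF \<phi>]) (simp add: tuples_def length_transpose_args)
    note C = alg.Units_closed[OF ef(1)] alg.Units_closed[OF ef(2)] alg.Units_closed[OF Q]
    have "product ?ts = ainv e \<bullet> ?Q \<bullet> ainv f"
      using product_transpose[OF list_over_units(1)[OF o] i(1)] i l by (simp add: e_def f_def)
    then have "ainv (product ?ts) = f \<bullet> ainv ?Q \<bullet> e"
      using ef Q C by (simp add: ainv_amult alg.m_assoc)
    then have T: "\<phi> ?ts \<bullet> (f \<bullet> ainv ?Q \<bullet> e) = twist n \<phi> (transpose_args (\<otimes>) (m_inv G) i gs)"
      using twist_over[OF \<phi> tg t] by simp
    have ev: "(if i = 1 then bar (gs ! 0) \<bullet> \<phi> ?ts else \<phi> ?ts) = e \<bullet> \<phi> ?ts"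
      using v by (simp add: e_def)
    have wf: "(if i = n then w \<bullet> bar (gs ! (n - 1)) else w) = w \<bullet> f" if "w \<in> carrier alg" for w
      using that by (simp add: f_def)
    have "hoch_transposition G \<alpha> n i \<phi> ?us = - (e \<bullet> \<phi> ?ts \<bullet> f)"
      unfolding hoch_transposition_def Let_def multilinear_extension_bar[OF gs]
      unfolding ev by (simp only: wf amult_closed)
    then have "twist n (hoch_transposition G \<alpha> n i \<phi>) gs = - (e \<bullet> \<phi> ?ts \<bullet> f \<bullet> ainv ?Q)"
      using gs by (simp add: twist_def amult_uminus)
    also have "e \<bullet> \<phi> ?ts \<bullet> f \<bullet> ainv ?Q = e \<bullet> (\<phi> ?ts \<bullet> (f \<bullet> ainv ?Q \<bullet> e)) \<bullet> ainv e"
      using ef Q C v by (simp add: alg.m_assoc)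
    also have "\<dots> = (if i = 1 then conj (gs ! 0) (twist n \<phi> (transpose_args (\<otimes>) (m_inv G) i gs))
        else twist n \<phi> (transpose_args (\<otimes>) (m_inv G) i gs))"
      unfolding T by (simp add: e_def conj_def twist_def amult_closed amult_zero)
    finally show ?thesis using gs by (simp add: group_transposition_def Let_def fun_eq_iff)
  qed (simp add: twist_def group_transposition_def)
qed

lemma drop_update: "(drop 1 (as[Suc i := a])) = (drop 1 as)[i := a]"
  by (cases as) simp_all

lemma multilinear_left_factor:
  assumes "multilinear n \<phi>"
  shows "multilinear (Suc n) (\<lambda>as. (as ! 0) \<bullet> \<phi> (drop 1 as))"
  unfolding multilinear_def
proof (intro ballI allI impI)
  fix as i a b c
  assume as: "as \<in> tuples (carrier alg) (Suc n)" and i: "i < Suc n" and a: "a \<in> carrier alg" "b \<in> carrier alg"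
  note l = tuplesD(1)[OF as]
  show "(as[i := a + b] ! 0) \<bullet> \<phi> (drop 1 (as[i := a + b])) =
      (as[i := a] ! 0) \<bullet> \<phi> (drop 1 (as[i := a])) + (as[i := b] ! 0) \<bullet> \<phi> (drop 1 (as[i := b])) \<and>
    (as[i := c \<cdot>\<^sub>k a] ! 0) \<bullet> \<phi> (drop 1 (as[i := c \<cdot>\<^sub>k a])) =
      c \<cdot>\<^sub>k ((as[i := a] ! 0) \<bullet> \<phi> (drop 1 (as[i := a])))"
  proof (cases i)
    case 0
    then show ?thesis using l by (simp add: amult_linear)
  next
    case (Suc k)
    note M = multilinearD[OF assms tuples_drop[OF as], of k a]
    show ?thesis using l Suc i a M by (simp add: drop_update amult_linear del: drop_update_swap One_nat_def)
  qed
qed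

lemma multilinear_right_factor:
  assumes "multilinear n \<phi>"
  shows "multilinear (Suc n) (\<lambda>as. \<phi> (take n as) \<bullet> (as ! n))"
  unfolding multilinear_def
proof (intro ballI allI impI)
  fix as i a b c
  assume as: "as \<in> tuples (carrier alg) (Suc n)" and i: "i < Suc n" and a: "a \<in> carrier alg" "b \<in> carrier alg"
  note l = tuplesD(1)[OF as]
  show "\<phi> (take n (as[i := a + b])) \<bullet> (as[i := a + b] ! n) =
      \<phi> (take n (as[i := a])) \<bullet> (as[i := a] ! n) + \<phi> (take n (as[i := b])) \<bullet> (as[i := b] ! n) \<and>
    \<phi> (take n (as[i := c \<cdot>\<^sub>k a])) \<bullet> (as[i := c \<cdot>\<^sub>k a] ! n) =
      c \<cdot>\<^sub>k (\<phi> (take n (as[i := a])) \<bullet> (as[i := a] ! n))"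
  proof (cases "i = n")
    case True
    then show ?thesis using l by (simp add: amult_linear)
  next
    case False
    then have "i < n" using i by simp
    note M = multilinearD[OF assms tuples_take[OF as] this a(1)]
    show ?thesis using l i False a M by (simp add: take_update_swap amult_linear)
  qed
qed

lemma merge_update:
  assumes "1 \<le> j" "j < length as" "i < length as"
  shows "merge_at (\<bullet>) j (as[i := a]) =
    (if i < j - 1 then (merge_at (\<bullet>) j as)[i := a]
     else if i = j - 1 then (merge_at (\<bullet>) j as)[j - 1 := a \<bullet> (as ! j)]
     else if i = j then (merge_at (\<bullet>) j as)[j - 1 := (as ! (j - 1)) \<bullet> a]
     else (merge_at (\<bullet>) j as)[i - 1 := a])"
  using assms by (intro nth_equalityI) (auto simp: length_merge_at nth_merge_at nth_list_update)

text \<open>As a function of any one argument, the merged list changes in a single entry, and linearly so.\<close>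

lemma multilinear_merge:
  assumes m: "multilinear n \<phi>" and j: "1 \<le> j" "j \<le> n"
  shows "multilinear (Suc n) (\<lambda>as. \<phi> (merge_at (\<bullet>) j as))"
  unfolding multilinear_def
proof (intro ballI allI impI)
  fix as i a b c
  assume as: "as \<in> tuples (carrier alg) (Suc n)" and i: "i < Suc n" and a: "a \<in> carrier alg" "b \<in> carrier alg"
  note l = tuplesD(1)[OF as]
  have t: "merge_at (\<bullet>) j as \<in> tuples (carrier alg) n"
    using tuples_merge_at[OF as j] amult_closed by blast
  note U = merge_update[OF j(1), of as i]
  have "\<exists>k h. k < n \<and> (\<forall>x\<in>carrier alg. h x \<in> carrier alg) \<and> (\<forall>x y. h (x + y) = h x + h y) \<and>
    (\<forall>c x. h (c \<cdot>\<^sub>k x) = c \<cdot>\<^sub>k h x) \<and> (\<forall>x. merge_at (\<bullet>) j (as[i := x]) = (merge_at (\<bullet>) j as)[k := h x])"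
  proof -
    consider "i < j - 1" | "i = j - 1" | "i = j" | "i > j" by linarith
    then show ?thesis
    proof cases
      case 1
      then show ?thesis using U l j i by (intro exI[of _ i] exI[of _ "\<lambda>x. x"]) auto
    next
      case 2
      then show ?thesis using U l j i
        by (intro exI[of _ "j - 1"] exI[of _ "\<lambda>x. x \<bullet> (as ! j)"]) (auto simp: amult_linear amult_closed)
    next
      case 3
      then have "i \<noteq> j - 1" "\<not> i < j - 1" using j by auto
      then show ?thesis using U l j i 3
        by (intro exI[of _ "j - 1"] exI[of _ "\<lambda>x. (as ! (j - 1)) \<bullet> x"]) (auto simp: amult_linear amult_closed)
    next
      case 4
      then show ?thesis using U l j i by (intro exI[of _ "i - 1"] exI[of _ "\<lambda>x. x"]) auto
    qed
  qed
  then obtain k h where k: "k < n" and h: "\<And>x. x \<in> carrier alg \<Longrightarrow> h x \<in> carrier alg"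
      "\<And>x y. h (x + y) = h x + h y" "\<And>c x. h (c \<cdot>\<^sub>k x) = c \<cdot>\<^sub>k h x"
      "\<And>x. merge_at (\<bullet>) j (as[i := x]) = (merge_at (\<bullet>) j as)[k := h x]"
    by blast
  show "\<phi> (merge_at (\<bullet>) j (as[i := a + b])) =
      \<phi> (merge_at (\<bullet>) j (as[i := a])) + \<phi> (merge_at (\<bullet>) j (as[i := b])) \<and>
    \<phi> (merge_at (\<bullet>) j (as[i := c \<cdot>\<^sub>k a])) = c \<cdot>\<^sub>k \<phi> (merge_at (\<bullet>) j (as[i := a]))"
    unfolding h(2-4) using multilinearD[OF m t k h(1)[OF a(1)]] h(1)[OF a(2)] by blast
qed

lemma hdiff_eq:
  "hdiff n \<phi> as = (if as \<in> tuples (carrier alg) (Suc n) then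
    (as ! 0) \<bullet> \<phi> (drop 1 as) + (\<Sum>j=1..n. (-1) ^ j \<cdot>\<^sub>k \<phi> (merge_at (\<bullet>) j as))
      + (-1) ^ Suc n \<cdot>\<^sub>k (\<phi> (take n as) \<bullet> (as ! n)) else 0)"
  by (simp add: hoch_diff_def Let_def)

lemma hdiff_closed:
  assumes "\<phi> \<in> hcochains n"
  shows "hdiff n \<phi> \<in> hcochains (Suc n)"
proof -
  have m: "multilinear n \<phi>" using assms by (simp add: hcochains_iff)
  have "multilinear (Suc n) (\<lambda>as. (as ! 0) \<bullet> \<phi> (drop 1 as)
      + (\<Sum>j=1..n. (-1) ^ j \<cdot>\<^sub>k \<phi> (merge_at (\<bullet>) j as)) + (-1) ^ Suc n \<cdot>\<^sub>k (\<phi> (take n as) \<bullet> (as ! n)))"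
    by (intro multilinear_add multilinear_sum multilinear_scale multilinear_merge
        multilinear_left_factor multilinear_right_factor m) auto
  then have "multilinear (Suc n) (hdiff n \<phi>)"
    by (rule multilinear_cong) (simp add: hdiff_eq)
  moreover have "hdiff n \<phi> as \<in> carrier alg" if as: "as \<in> tuples (carrier alg) (Suc n)" for as
  proof -
    note A = vector_subspaceD[OF alg_subspace]
    have "(\<Sum>j=1..n. (-1) ^ j \<cdot>\<^sub>k \<phi> (merge_at (\<bullet>) j as)) \<in> carrier alg"
      by (intro vector_subspace_sum[OF alg_subspace] A(3) hcochain_in[OF assms] tuples_merge_at[OF as])
        (auto simp: amult_closed)
    then show ?thesis using as unfolding hdiff_eq by (auto intro!: A amult_closed)
  qed
  ultimately show ?thesis by (simp add: hcochains_iff) (simp add: hdiff_eq)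
qed

lemma hdiff_linear: "linear_on S (hdiff n)"
proof -
  have "hdiff n (\<phi> + \<psi>) as = hdiff n \<phi> as + hdiff n \<psi> as" for \<phi> \<psi> as
    by (simp add: hdiff_eq vscale_distrib sum.distrib amult_linear)
  moreover have "hdiff n (c \<odot>\<^sub>c \<phi>) as = c \<cdot>\<^sub>k hdiff n \<phi> as" for c \<phi> as
    by (simp add: hdiff_eq vscale_distrib vscale_sum mult.commute amult_linear)
  ultimately show ?thesis by (auto simp: linear_on_def fun_eq_iff)
qed

text \<open>Left multiplication by \<open>bar g\<^sub>1\<close> becomes conjugation once the product is divided out, right
  multiplication by \<open>bar g\<^sub>n\<^sub>+\<^sub>1\<close> cancels, and merging arguments preserves the product.\<close>

lemma twist_diff:
  assumes \<phi>: "\<phi> \<in> hcochains n"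
  shows "twist (Suc n) (hdiff n \<phi>) = group_diff G conj n (twist n \<phi>)"
proof
  fix gs
  show "twist (Suc n) (hdiff n \<phi>) gs = group_diff G conj n (twist n \<phi>) gs"
  proof (cases "gs \<in> tuples (carrier G) (Suc n)")
    case gs: True
    then have l: "length gs = Suc n" by (rule tuplesD)
    let ?us = "map bar gs" let ?Q = "product ?us"
    note o = list_over_bar[OF gs]
    note us = map_bar_tuple[OF gs]
    have d: "map bar (drop 1 gs) = drop 1 ?us" "map bar (take n gs) = take n ?us"
      by (simp_all add: drop_map take_map)
    have od: "list_all2 lies_over (drop 1 ?us) (drop 1 gs)" "list_all2 lies_over (take n ?us) (take n gs)"
      using list_over_bar[OF tuples_drop[OF gs]] list_over_bar[OF tuples_take[OF gs]] unfolding d by auto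
    have g: "gs ! 0 \<in> carrier G" "gs ! n \<in> carrier G" using tuplesD(2)[OF gs] by auto
    note u = over_unit[OF over_bar[OF g(1)]] over_unit[OF over_bar[OF g(2)]]
    note Ud = product_unit[OF list_over_units(1)[OF od(1)]] product_unit[OF list_over_units(1)[OF od(2)]]
    note C = alg.Units_closed[OF u(1)] alg.Units_closed[OF u(2)] alg.Units_closed[OF Ud(1)] alg.Units_closed[OF Ud(2)]
    have in_alg: "\<phi> (drop 1 ?us) \<in> carrier alg" "\<phi> (take n ?us) \<in> carrier alg"
      using hcochain_in[OF \<phi>] tuples_drop[OF us] tuples_take[OF us] by auto
    have "?us = bar (gs ! 0) # drop 1 ?us" using l by (cases gs) auto
    then have "?Q = bar (gs ! 0) \<bullet> product (drop 1 ?us)" by (metis product_simps(2))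
    then have "(bar (gs ! 0) \<bullet> \<phi> (drop 1 ?us)) \<bullet> ainv ?Q
        = bar (gs ! 0) \<bullet> (\<phi> (drop 1 ?us) \<bullet> ainv (product (drop 1 ?us))) \<bullet> ainv (bar (gs ! 0))"
      using u Ud C in_alg(1) by (simp add: ainv_amult alg.m_assoc)
    then have first: "(bar (gs ! 0) \<bullet> \<phi> (drop 1 ?us)) \<bullet> ainv ?Q = conj (gs ! 0) (twist n \<phi> (drop 1 gs))"
      unfolding twist_over[OF \<phi> tuples_drop[OF gs] od(1)] conj_def .
    have "?us = take n ?us @ [bar (gs ! n)]" using l take_Suc_conv_app_nth[of n ?us] by simp
    then have "?Q = product (take n ?us) \<bullet> bar (gs ! n)"
      using C product_append[of "take n ?us" "[bar (gs ! n)]"] list_over_units(2)[OF od(2)]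
      by (metis alg.r_one empty_subsetI insert_subset list.simps(15) empty_set product_simps)
    then have "(\<phi> (take n ?us) \<bullet> bar (gs ! n)) \<bullet> ainv ?Q
        = \<phi> (take n ?us) \<bullet> ((bar (gs ! n) \<bullet> ainv (bar (gs ! n))) \<bullet> ainv (product (take n ?us)))"
      using u Ud C in_alg(2) by (simp only: ainv_amult alg.m_assoc alg.m_closed alg.Units_inv_closed)
    also have "\<dots> = \<phi> (take n ?us) \<bullet> ainv (product (take n ?us))" using u Ud by simp
    finally have last: "(\<phi> (take n ?us) \<bullet> bar (gs ! n)) \<bullet> ainv ?Q = twist n \<phi> (take n gs)"
      unfolding twist_over[OF \<phi> tuples_take[OF gs] od(2)] .
    have mid: "\<phi> (merge_at (\<bullet>) j ?us) \<bullet> ainv ?Q = twist n \<phi> (merge_at (\<otimes>) j gs)" if j: "1 \<le> j" "j \<le> n" for j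
    proof -
      have "product (merge_at (\<bullet>) j ?us) = ?Q"
        using list_over_units(2)[OF o] j l by (intro product_merge) auto
      moreover have "merge_at (\<otimes>) j gs \<in> tuples (carrier G) n" using tuples_merge_at[OF gs j] by auto
      ultimately show ?thesis
        using twist_over[OF \<phi> _ list_over_merge[OF o j(1)]] j l by simp
    qed
    have "twist (Suc n) (hdiff n \<phi>) gs = (bar (gs ! 0) \<bullet> \<phi> (drop 1 ?us)) \<bullet> ainv ?Q
        + (\<Sum>j=1..n. (-1) ^ j \<cdot>\<^sub>k (\<phi> (merge_at (\<bullet>) j ?us) \<bullet> ainv ?Q))
        + (-1) ^ Suc n \<cdot>\<^sub>k ((\<phi> (take n ?us) \<bullet> bar (gs ! n)) \<bullet> ainv ?Q)"
      using gs us l by (simp add: twist_def hdiff_eq amult_linear amult_sum)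
    also have "(\<Sum>j=1..n. (-1) ^ j \<cdot>\<^sub>k (\<phi> (merge_at (\<bullet>) j ?us) \<bullet> ainv ?Q))
        = (\<Sum>j=1..n. (-1) ^ j \<cdot>\<^sub>k twist n \<phi> (merge_at (\<otimes>) j gs))"
      by (intro sum.cong refl) (simp add: mid)
    finally show ?thesis unfolding first last using gs by (simp add: group_diff_def fun_eq_iff)
  qed (simp add: twist_def group_diff_def)
qed

sublocale conj: linear_action G "carrier alg" conj by (rule conj_action)

text \<open>Since \<open>twist\<close> is injective and respects transpositions, symmetry may be tested after twisting. This
  transports \<open>\<delta>\<^sup>2 = 0\<close> and the subcomplex property from group cochains.\<close>

lemma hsym_cochains_iff:
  "\<phi> \<in> hsym_cochains n \<longleftrightarrow> \<phi> \<in> hcochains n \<and> twist n \<phi> \<in> conj.sym_cochains n"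
proof -
  have "hoch_transposition G \<alpha> n i \<phi> = \<phi> \<longleftrightarrow> group_transposition G conj n i (twist n \<phi>) = twist n \<phi>"
    if "\<phi> \<in> hcochains n" "1 \<le> i" "i \<le> n" for i
    using twist_transposition[OF that] twist_inj[OF transposition_closed[OF that] that(1)] by metis
  then show ?thesis by (auto simp: sym_hoch_cochains_def sym_group_cochains_def twist_closed)
qed

lemma hdiff_hdiff:
  assumes "\<phi> \<in> hcochains n"
  shows "hdiff (Suc n) (hdiff n \<phi>) = 0"
proof (rule twist_inj)
  show "0 \<in> hcochains (Suc (Suc n))" by (rule cochain_subspaceD(1)[OF hcochains_subspace])
  have "twist (Suc (Suc n)) (hdiff (Suc n) (hdiff n \<phi>)) = 0"
    using assms by (simp add: twist_diff hdiff_closed conj.diff_diff twist_closed)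
  also have "0 = twist (Suc (Suc n)) 0" by (auto simp: twist_def fun_eq_iff amult_zero)
  finally show "twist (Suc (Suc n)) (hdiff (Suc n) (hdiff n \<phi>)) = twist (Suc (Suc n)) 0" .
qed (intro hdiff_closed assms)

lemma hoch_complex: "cochain_complex hcochains hdiff"
  by (intro cochain_complex.intro hcochains_subspace hdiff_closed hdiff_linear hdiff_hdiff)

lemma hsym_complex: "cochain_complex hsym_cochains hdiff"
proof
  show "cochain_subspace (hsym_cochains n)" for n
    using cochain_subspaceD[OF hcochains_subspace] cochain_subspaceD[OF conj.sym_cochains_subspace]
      linear_onD[OF twist_linear hcochains_subspace]
    by (auto simp: cochain_subspace_def hsym_cochains_iff)
  show "hdiff n \<phi> \<in> hsym_cochains (Suc n)" if "\<phi> \<in> hsym_cochains n" for n \<phi>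
    using that by (simp add: hsym_cochains_iff hdiff_closed twist_diff conj.sym_diff_closed)
  show "hdiff (Suc n) (hdiff n \<phi>) = 0" if "\<phi> \<in> hsym_cochains n" for n \<phi>
    using that by (simp add: hsym_cochains_iff hdiff_hdiff)
qed (rule hdiff_linear)

lemma twist_chain_map: "chain_map hcochains hdiff conj.cochains conj.diff twist"
  by (intro chain_map.intro hoch_complex conj.complex chain_map_axioms.intro twist_closed twist_linear
      twist_diff[symmetric])

lemma twist_sym_chain_map: "chain_map hsym_cochains hdiff conj.sym_cochains conj.diff twist"
proof (intro chain_map.intro hsym_complex conj.sym_complex chain_map_axioms.intro twist_linear)
  show "\<phi> \<in> hsym_cochains n \<Longrightarrow> twist n \<phi> \<in> conj.sym_cochains n"
    "\<phi> \<in> hsym_cochains n \<Longrightarrow> conj.diff n (twist n \<phi>) = twist (Suc n) (hdiff n \<phi>)" for n \<phi>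
    by (simp_all add: hsym_cochains_iff twist_diff)
qed

end

section \<open>Projection to a centralizer\<close>

lemma chain_map_comp:
  assumes "chain_map C d E e f" "chain_map E e C' d' g" "\<And>n \<phi>. \<phi> \<in> C n \<Longrightarrow> h n \<phi> = g n (f n \<phi>)"
  shows "chain_map C d C' d' h"
proof -
  interpret F: chain_map C d E e f by fact
  interpret G: chain_map E e C' d' g by fact
  show ?thesis
  proof
    fix n
    show "linear_on (C n) (h n)"
      unfolding linear_on_def
      using cochain_subspaceD[OF F.source.subspace] F.map_closed linear_onD[OF F.map_linear F.source.subspace]
        linear_onD[OF G.map_linear F.target.subspace] by (simp add: assms(3))
  qed (simp_all add: assms(3) F.map_closed G.map_closed G.map_diff F.map_diff F.source.diff_closed)
qed

text \<open>If \<open>t\<close> is an injective chain map, a map \<open>g\<close> whose composite \<open>t \<circ> g\<close> is a chain map is one itself.\<close>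

lemma chain_map_lift:
  assumes "chain_map C d E e f" "chain_map D \<delta> E e t"
    and inj: "\<And>n \<phi> \<psi>. \<phi> \<in> D n \<Longrightarrow> \<psi> \<in> D n \<Longrightarrow> t n \<phi> = t n \<psi> \<Longrightarrow> \<phi> = \<psi>"
    and lift: "\<And>n \<phi>. \<phi> \<in> C n \<Longrightarrow> g n \<phi> \<in> D n" "\<And>n \<phi>. \<phi> \<in> C n \<Longrightarrow> t n (g n \<phi>) = f n \<phi>"
  shows "chain_map C d D \<delta> g"
proof -
  interpret F: chain_map C d E e f by fact
  interpret T: chain_map D \<delta> E e t by fact
  note C = cochain_subspaceD[OF F.source.subspace] and D = cochain_subspaceD[OF T.source.subspace]
  note L = linear_onD[OF F.map_linear F.source.subspace] linear_onD[OF T.map_linear T.source.subspace]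
  show ?thesis
  proof
    show "linear_on (C n) (g n)" for n
      unfolding linear_on_def by (auto intro!: inj[of _ n] simp: lift C D L)
    show "\<delta> n (g n \<phi>) = g (Suc n) (d n \<phi>)" if "\<phi> \<in> C n" for n \<phi>
      using that by (intro inj[of _ "Suc n"])
        (simp_all add: lift T.source.diff_closed F.source.diff_closed F.map_diff flip: T.map_diff)
  qed (rule lift)
qed

context group
begin

lemma centralizer_subgroup:
  assumes "x \<in> carrier G"
  shows "subgroup (centralizer G x) G"
proof
  show "inv h \<in> centralizer G x" if "h \<in> centralizer G x" for h
  proof -
    have h: "h \<in> carrier G" "h \<otimes> x = x \<otimes> h" using that by (auto simp: centralizer_def)
    have "inv h \<otimes> x = inv h \<otimes> (x \<otimes> h) \<otimes> inv h" using h(1) assms by (simp add: m_assoc)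
    also have "\<dots> = x \<otimes> inv h" using h(1) assms unfolding h(2)[symmetric] by (simp flip: m_assoc)
    finally show ?thesis using h by (simp add: centralizer_def)
  qed
  show "h \<otimes> l \<in> centralizer G x" if "h \<in> centralizer G x" "l \<in> centralizer G x" for h l
  proof -
    have h: "h \<in> carrier G" "h \<otimes> x = x \<otimes> h" "l \<in> carrier G" "l \<otimes> x = x \<otimes> l"
      using that by (auto simp: centralizer_def)
    have "h \<otimes> l \<otimes> x = h \<otimes> (x \<otimes> l)" using h assms by (simp add: m_assoc)
    also have "\<dots> = x \<otimes> (h \<otimes> l)" using h assms by (simp flip: m_assoc)
    finally show ?thesis using h by (simp add: centralizer_def)
  qed
qed (use assms in \<open>auto simp: centralizer_def\<close>)

lemma centralizer_group_simps:
  "carrier (centralizer_group G x) = centralizer G x"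
  "g \<otimes>\<^bsub>centralizer_group G x\<^esub> h = g \<otimes> h" "\<one>\<^bsub>centralizer_group G x\<^esub> = \<one>"
  by (simp_all add: centralizer_group_def)

lemma centralizer_is_group: "x \<in> carrier G \<Longrightarrow> group (centralizer_group G x)"
  using subgroup.subgroup_is_group[OF centralizer_subgroup is_group] by (simp add: centralizer_group_def)

lemma quotients_centralizer:
  assumes "x \<in> carrier G" "\<And>i. y i \<in> centralizer G x"
  shows "quotients (centralizer_group G x) n y = quotients G n y"
  using m_inv_consistent[OF centralizer_subgroup[OF assms(1)] assms(2)]
  by (simp add: quotients_def centralizer_group_def)

lemma centralizer_carrier: "h \<in> centralizer G x \<Longrightarrow> h \<in> carrier G"
  by (simp add: centralizer_def)

lemma tuples_centralizer: "hs \<in> tuples (centralizer G x) n \<Longrightarrow> hs \<in> tuples (carrier G) n"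
  by (auto simp: tuples_def centralizer_def)

lemma centralizer_center: "x \<in> group_center G \<Longrightarrow> centralizer G x = carrier G"
  by (auto simp: group_center_def centralizer_def)

lemma centralizer_group_center: "x \<in> group_center G \<Longrightarrow> centralizer_group G x = G"
  by (simp add: centralizer_group_def centralizer_center)

text \<open>Every sequence is recovered from its first point and its consecutive quotients.\<close>

lemma base_partial_products:
  assumes "\<And>i. y i \<in> carrier G" "i \<le> n"
  shows "y 0 \<otimes> partial_products G (quotients G n y) i = y i"
  using assms
proof (induction n arbitrary: y i)
  case 0
  then show ?case by (simp add: partial_products_simps)
next
  case (Suc n)
  show ?case
  proof (cases i)
    case (Suc k)
    have p: "partial_products G (quotients G n (y \<circ> Suc)) k \<in> carrier G"
      by (rule partial_products_closed[OF quotients_tuple]) (simp add: Suc.prems)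
    have "y 0 \<otimes> partial_products G (quotients G (Suc n) y) i =
        y 0 \<otimes> ((inv (y 0) \<otimes> y (Suc 0)) \<otimes> partial_products G (quotients G n (y \<circ> Suc)) k)"
      by (simp add: Suc quotients_Suc partial_products_simps)
    also have "\<dots> = (y \<circ> Suc) 0 \<otimes> partial_products G (quotients G n (y \<circ> Suc)) k"
      using p Suc.prems(1) by (simp flip: m_assoc)
    also have "\<dots> = (y \<circ> Suc) k" using Suc.prems Suc by (intro Suc.IH) auto
    finally show ?thesis by (simp add: Suc)
  qed (simp add: partial_products_simps Suc.prems)
qed

lemma quotients_cong:
  "(\<And>i. i \<le> n \<Longrightarrow> x i = y i) \<Longrightarrow> quotients G n x = quotients G n y"
  by (simp add: quotients_def)

end

lemma line_iff: "v \<in> line x \<longleftrightarrow> (\<exists>c. v = c \<cdot>\<^sub>k bar x)"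
  by (auto simp: line_def)

lemma line_coefficient: "v \<in> line x \<Longrightarrow> v = v x \<cdot>\<^sub>k bar x"
  by (auto simp: line_iff bar_def)

lemma line_subspace: "vector_subspace (line x :: ('g \<Rightarrow> 'k::field) set)"
proof -
  have "0 = (0 :: 'k) \<cdot>\<^sub>k bar x" by simp
  then have "0 \<in> (line x :: ('g \<Rightarrow> 'k) set)" unfolding line_iff by blast
  moreover have "v + w \<in> line x" if vw: "v \<in> line x" "w \<in> line x" for v w :: "'g \<Rightarrow> 'k"
  proof -
    obtain c e where "v = c \<cdot>\<^sub>k bar x" "w = e \<cdot>\<^sub>k bar x" using vw by (auto simp: line_iff)
    then have "v + w = (c + e) \<cdot>\<^sub>k bar x" by (simp add: vscale_distrib)
    then show ?thesis unfolding line_iff by blast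
  qed
  moreover have "s \<cdot>\<^sub>k v \<in> line x" if "v \<in> line x" for s and v :: "'g \<Rightarrow> 'k"
    using that by (auto simp: line_iff)
  ultimately show ?thesis by (simp add: vector_subspace_def)
qed

context twisted_group_algebra
begin

lemma line_alg: "x \<in> carrier G \<Longrightarrow> v \<in> line x \<Longrightarrow> v \<in> carrier alg"
  using vector_subspaceD(3)[OF alg_subspace bar_closed] by (auto simp: line_iff)

text \<open>The action on the line \<open>k x\<close> is the restriction of conjugation, which makes it an action.\<close>

lemma conj_line:
  assumes "x \<in> carrier G" "h \<in> centralizer G x" "v \<in> line x"
  shows "conj h v = line_action \<alpha> x h v"
proof -
  obtain c where v: "v = c \<cdot>\<^sub>k bar x" using assms(3) by (auto simp: line_iff)
  have h: "h \<in> carrier G" "h \<otimes> x = x \<otimes> h" using assms(2) by (auto simp: centralizer_def)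
  have u: "bar h \<in> Units alg" using over_unit over_bar h(1) by auto
  have "bar h \<bullet> bar x = (\<alpha> h x * inverse (\<alpha> x h)) \<cdot>\<^sub>k (bar x \<bullet> bar h)"
    using h assms(1) cocycle(1)[of x h] by (simp add: bar_bar mult.assoc)
  then have "conj h v = c \<cdot>\<^sub>k (\<alpha> h x * inverse (\<alpha> x h)) \<cdot>\<^sub>k (bar x \<bullet> bar h \<bullet> ainv (bar h))"
    by (simp add: conj_def v amult_linear)
  also have "bar x \<bullet> bar h \<bullet> ainv (bar h) = bar x"
    using u assms(1) h(1) bar_closed by (simp add: alg.m_assoc)
  finally show ?thesis unfolding line_action_def v vscale_simps(4) by (simp only: mult_ac)
qed

text \<open>Taking the coefficient at \<open>x\<close> is equivariant under the centralizer of \<open>x\<close>, because \<open>x\<close> is the only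
  element that \<open>h\<close> conjugates to \<open>x\<close>.\<close>

lemma conj_centralizer_coefficient:
  assumes "x \<in> carrier G" "h \<in> centralizer G x" "a \<in> carrier alg"
  shows "conj h a x = \<alpha> h x * inverse (\<alpha> x h) * a x"
proof -
  have h: "h \<in> carrier G" "h \<otimes> x = x \<otimes> h" using assms(2) by (auto simp: centralizer_def)
  have "inv h \<otimes> x \<otimes> h = (inv h \<otimes> h) \<otimes> x" using h(1) assms(1) by (simp only: m_assoc inv_closed h(2))
  then have "inv h \<otimes> x \<otimes> h = x" using h assms(1) by (simp only: l_inv l_one)
  then show ?thesis
    using conj_coefficient[OF h(1) assms(1,3)] cocycle(1)[OF assms(1) h(1)] by (simp add: field_simps)
qed

lemma line_linear_action:
  assumes "x \<in> carrier G"
  shows "linear_action (centralizer_group G x) (line x) (line_action \<alpha> x)"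
proof -
  interpret C: group "centralizer_group G x" by (rule centralizer_is_group[OF assms])
  have closed: "line_action \<alpha> x g v \<in> line x" if "v \<in> line x" for g v
    unfolding line_action_def by (rule vector_subspaceD(3)[OF line_subspace that])
  show ?thesis
  proof (intro linear_action.intro C.is_group linear_action_axioms.intro)
    show "line_action \<alpha> x \<one>\<^bsub>centralizer_group G x\<^esub> v = v" if "v \<in> line x" for v
      using assms by (simp add: centralizer_group_simps line_action_def cocycle)
    show "line_action \<alpha> x (g \<otimes>\<^bsub>centralizer_group G x\<^esub> h) v = line_action \<alpha> x g (line_action \<alpha> x h v)"
      if g: "g \<in> carrier (centralizer_group G x)" "h \<in> carrier (centralizer_group G x)" and v: "v \<in> line x" for g h v
    proof -
      have c: "g \<in> centralizer G x" "h \<in> centralizer G x" "g \<otimes> h \<in> centralizer G x"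
        using g C.m_closed[OF g] by (auto simp: centralizer_group_simps)
      then show ?thesis
        using conj_line[OF assms c(3) v] conj_line[OF assms c(2) v] conj_line[OF assms c(1) closed[OF v]]
          conj.act_mult[OF _ _ line_alg[OF assms v]] by (simp add: centralizer_group_simps centralizer_carrier)
    qed
  qed (auto simp: line_subspace vector_subspaceD(3)[OF line_subspace] line_action_def vscale_distrib mult.commute)
qed

definition project :: "'g \<Rightarrow> nat \<Rightarrow> ('g list \<Rightarrow> 'g \<Rightarrow> 'k) \<Rightarrow> 'g list \<Rightarrow> 'g \<Rightarrow> 'k"
  where "project x n \<psi> = (\<lambda>hs. if hs \<in> tuples (centralizer G x) n then \<psi> hs x \<cdot>\<^sub>k bar x else 0)"

text \<open>The coefficient at \<open>x\<close> is itself the linear functional, and the points are left as they are.\<close>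

lemma project_natural:
  assumes x: "x \<in> carrier G"
  shows "natural_map G (carrier alg) conj (centralizer_group G x) (line x) (line_action \<alpha> x) (project x)"
proof (intro natural_map.intro natural_map_axioms.intro conj_action line_linear_action x)
  interpret L: linear_action "centralizer_group G x" "line x" "line_action \<alpha> x" by (rule line_linear_action[OF x])
  show "project x n \<psi> \<in> L.cochains n" for n \<psi>
    by (auto simp: L.cochains_iff project_def centralizer_group_simps line_iff)
  fix u
  have "L.hmg n (project x n \<psi>) y u = conj.hmg n \<psi> ((\<lambda>g. g) \<circ> y) x * bar x u"
    if \<psi>: "\<psi> \<in> conj.cochains n" and y: "\<forall>i. y i \<in> carrier (centralizer_group G x)" for n \<psi> y
  proof -
    have y: "y i \<in> centralizer G x" for i using y by (simp add: centralizer_group_simps)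
    let ?q = "quotients G n y"
    have q: "?q \<in> tuples (centralizer G x) n"
      using L.quotients_tuple[of y n] y quotients_centralizer[OF x y] by (simp add: centralizer_group_simps)
    have "L.hmg n (project x n \<psi>) y u = \<alpha> (y 0) x * inverse (\<alpha> x (y 0)) * \<psi> ?q x * bar x u"
      using q by (simp add: homogeneous_def quotients_centralizer[OF x y] project_def line_action_def)
    also have "\<alpha> (y 0) x * inverse (\<alpha> x (y 0)) * \<psi> ?q x = conj.hmg n \<psi> y x"
      using conj_centralizer_coefficient[OF x y conj.cochain_in[OF \<psi> tuples_centralizer[OF q]], of 0]
      by (simp add: homogeneous_def)
    finally show ?thesis by (simp add: comp_def)
  qed
  then show "\<exists>t s. t \<in> carrier (centralizer_group G x) \<rightarrow> carrier G \<and>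
      (\<forall>v w. s (v + w) = s v + s w) \<and> (\<forall>c v. s (c \<cdot>\<^sub>k v) = c * s v) \<and>
      (\<forall>n \<psi> y. \<psi> \<in> conj.cochains n \<longrightarrow> (\<forall>i. y i \<in> carrier (centralizer_group G x)) \<longrightarrow>
        L.hmg n (project x n \<psi>) y u = s (conj.hmg n \<psi> (t \<circ> y)))"
    by (intro exI[of _ "\<lambda>g. g"] exI[of _ "\<lambda>v. v x * bar x u"])
      (auto simp: centralizer_group_simps distrib_right intro: centralizer_carrier)
qed

lemma pi_map_eq_project:
  assumes "\<phi> \<in> hcochains n"
  shows "pi_map G \<alpha> x n \<phi> = project x n (twist n \<phi>)"
proof
  fix hs
  show "pi_map G \<alpha> x n \<phi> hs = project x n (twist n \<phi>) hs"
  proof (cases "hs \<in> tuples (centralizer G x) n")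
    case True
    then have hs: "hs \<in> tuples (carrier G) n" by (rule tuples_centralizer)
    have "foldl (\<bullet>) (\<phi> (map bar hs)) (map (\<lambda>h. ainv (bar h)) (rev hs))
        = foldl (\<bullet>) (\<phi> (map bar hs)) (map ainv (rev (map bar hs)))"
      by (simp only: rev_map map_map o_def)
    also have "\<dots> = twist n \<phi> hs"
      using foldl_inverses[OF hcochain_in[OF assms map_bar_tuple[OF hs]] list_over_units(1)[OF list_over_bar[OF hs]]] hs
      unfolding twist_def by presburger
    finally have "foldl (\<bullet>) (\<phi> (map bar hs)) (map (\<lambda>h. ainv (bar h)) (rev hs)) = twist n \<phi> hs" .
    then show ?thesis unfolding pi_map_def Let_def project_def using True by presburger
  qed (simp add: pi_map_def Let_def project_def)
qed

lemma pi_chain_maps: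
  assumes "x \<in> carrier G"
  defines "C \<equiv> group_cochains (centralizer_group G x) (line x)"
    and "CS \<equiv> sym_group_cochains (centralizer_group G x) (line x) (line_action \<alpha> x)"
    and "d \<equiv> group_diff (centralizer_group G x) (line_action \<alpha> x)"
  shows "chain_map hcochains hdiff C d (pi_map G \<alpha> x)" "chain_map hsym_cochains hdiff CS d (pi_map G \<alpha> x)"
proof -
  interpret natural_map G "carrier alg" conj "centralizer_group G x" "line x" "line_action \<alpha> x" "project x"
    by (rule project_natural[OF assms(1)])
  show "chain_map hcochains hdiff C d (pi_map G \<alpha> x)"
    unfolding C_def d_def
  proof (rule chain_map_comp[OF twist_chain_map chain_map])
    show "pi_map G \<alpha> x n \<phi> = project x n (twist n \<phi>)" if "\<phi> \<in> hcochains n" for n \<phi>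
      using that by (rule pi_map_eq_project)
  qed
  show "chain_map hsym_cochains hdiff CS d (pi_map G \<alpha> x)"
    unfolding CS_def d_def
  proof (rule chain_map_comp[OF twist_sym_chain_map sym_chain_map])
    show "pi_map G \<alpha> x n \<phi> = project x n (twist n \<phi>)" if "\<phi> \<in> hsym_cochains n" for n \<phi>
      using that unfolding hsym_cochains_iff by (intro pi_map_eq_project) blast
  qed
qed

text \<open>A map into Hochschild cochains need only be known after twisting: since \<open>twist\<close> is injective and
  detects symmetry, naturality of the twisted map \<open>F\<close> yields both conclusions for \<open>\<nu>\<close>.\<close>

lemma lift_chain_maps:
  assumes "natural_map H (line x) act G (carrier alg) conj F"
    and nu: "\<And>n \<psi>. \<psi> \<in> group_cochains H (line x) n \<Longrightarrow> \<nu> n \<psi> \<in> hcochains n"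
      "\<And>n \<psi>. \<psi> \<in> group_cochains H (line x) n \<Longrightarrow> twist n (\<nu> n \<psi>) = F n \<psi>"
  shows "chain_map (group_cochains H (line x)) (group_diff H act) hcochains hdiff \<nu>"
    "chain_map (sym_group_cochains H (line x) act) (group_diff H act) hsym_cochains hdiff \<nu>"
proof -
  interpret natural_map H "line x" act G "carrier alg" conj F by fact
  show "chain_map source.cochains source.diff hcochains hdiff \<nu>"
  proof (rule chain_map_lift[OF chain_map twist_chain_map])
    show "\<phi> = \<psi>" if "\<phi> \<in> hcochains n" "\<psi> \<in> hcochains n" "twist n \<phi> = twist n \<psi>" for n \<phi> \<psi>
      using that by (rule twist_inj)
  qed (use nu in blast)+
  show "chain_map source.sym_cochains source.diff hsym_cochains hdiff \<nu>"
  proof (rule chain_map_lift[OF sym_chain_map twist_sym_chain_map])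
    show "\<phi> = \<psi>" if "\<phi> \<in> hsym_cochains n" "\<psi> \<in> hsym_cochains n" "twist n \<phi> = twist n \<psi>" for n \<phi> \<psi>
      using that unfolding hsym_cochains_iff by (intro twist_inj) blast+
    fix n \<psi> assume \<psi>: "\<psi> \<in> source.sym_cochains n"
    then have \<psi>': "\<psi> \<in> source.cochains n" by (simp add: source.sym_cochains_iff)
    show "twist n (\<nu> n \<psi>) = F n \<psi>" by (rule nu(2)[OF \<psi>'])
    with sym_closed[OF \<psi>] nu(1)[OF \<psi>'] show "\<nu> n \<psi> \<in> hsym_cochains n"
      by (simp add: hsym_cochains_iff)
  qed
qed

section \<open>Central elements\<close>

lemma inclusion_natural:
  assumes "x \<in> group_center G"
  shows "natural_map G (line x) (line_action \<alpha> x) G (carrier alg) conj (\<lambda>n \<psi>. \<psi>)"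
proof -
  have x: "x \<in> carrier G" using assms by (simp add: group_center_def)
  interpret L: linear_action G "line x" "line_action \<alpha> x"
    using line_linear_action[OF x] by (simp add: centralizer_group_center assms)
  show ?thesis
  proof (intro natural_map.intro natural_map_axioms.intro conj_action L.linear_action_axioms)
    show "\<psi> \<in> L.cochains n \<Longrightarrow> \<psi> \<in> conj.cochains n" for n \<psi>
      using line_alg[OF x] by (auto simp: L.cochains_iff conj.cochains_iff)
    fix u
    have "conj.hmg n \<psi> y u = L.hmg n \<psi> ((\<lambda>g. g) \<circ> y) u"
      if \<psi>: "\<psi> \<in> L.cochains n" and y: "\<forall>i. y i \<in> carrier G" for n \<psi> y
      using conj_line[OF x _ L.cochain_in[OF \<psi> quotients_tuple], of "y 0" y] y
      by (simp add: homogeneous_def comp_def centralizer_center assms)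
    then show "\<exists>t s. t \<in> carrier G \<rightarrow> carrier G \<and>
        (\<forall>v w. s (v + w) = s v + s w) \<and> (\<forall>c v. s (c \<cdot>\<^sub>k v) = c * s v) \<and>
        (\<forall>n \<psi> y. \<psi> \<in> L.cochains n \<longrightarrow> (\<forall>i. y i \<in> carrier G) \<longrightarrow> conj.hmg n \<psi> y u = s (L.hmg n \<psi> (t \<circ> y)))"
      by (intro exI[of _ "\<lambda>g. g"] exI[of _ "\<lambda>v. v u"]) auto
  qed
qed

text \<open>Twisting divides by the product by which \<open>nu_central\<close> multiplies, so what remains is the inclusion of
  the line into the algebra.\<close>

lemma nu_central_lift:
  assumes "x \<in> group_center G" "\<psi> \<in> group_cochains G (line x) n"
  shows "nu_central G \<alpha> n \<psi> \<in> hcochains n" "twist n (nu_central G \<alpha> n \<psi>) = \<psi>"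
proof -
  have x: "x \<in> carrier G" using assms by (simp add: group_center_def)
  have \<psi>: "\<psi> gs \<in> carrier alg" if "gs \<in> tuples (carrier G) n" for gs
    using assms(2) that line_alg[OF x] by (simp add: group_cochains_def)
  have f: "foldl (\<bullet>) (\<psi> gs) (map bar gs) = \<psi> gs \<bullet> product (map bar gs)" if gs: "gs \<in> tuples (carrier G) n" for gs
    by (rule foldl_amult[OF \<psi>[OF gs] list_over_units(2)[OF list_over_bar[OF gs]]])
  show "nu_central G \<alpha> n \<psi> \<in> hcochains n"
    unfolding nu_central_def Let_def by (rule multilinear_extension_cochain) (simp add: f amult_closed)
  show "twist n (nu_central G \<alpha> n \<psi>) = \<psi>"
  proof
    fix gs
    show "twist n (nu_central G \<alpha> n \<psi>) gs = \<psi> gs"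
    proof (cases "gs \<in> tuples (carrier G) n")
      case True
      have "product (map bar gs) \<in> Units alg"
        by (rule product_unit[OF list_over_units(1)[OF list_over_bar[OF True]]])
      then show ?thesis using True f[OF True] \<psi>[OF True]
        by (simp add: twist_def nu_central_def Let_def multilinear_extension_bar alg.m_assoc alg.Units_closed)
    qed (use assms(2) in \<open>simp add: twist_def group_cochains_def\<close>)
  qed
qed

lemma nu_central_chain_maps:
  assumes "x \<in> group_center G"
  shows "chain_map (group_cochains G (line x)) (group_diff G (line_action \<alpha> x)) hcochains hdiff (nu_central G \<alpha>)"
    "chain_map (sym_group_cochains G (line x) (line_action \<alpha> x)) (group_diff G (line_action \<alpha> x))
      hsym_cochains hdiff (nu_central G \<alpha>)"
  by (rule lift_chain_maps[OF inclusion_natural[OF assms] nu_central_lift[OF assms]]; assumption)+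

lemma pi_nu_central:
  assumes "x \<in> group_center G" "y \<in> group_center G" "\<psi> \<in> group_cochains G (line y) n"
  shows "pi_map G \<alpha> x n (nu_central G \<alpha> n \<psi>) = (if x = y then \<psi> else 0)"
proof
  fix hs
  have "project x n \<psi> hs = (if x = y then \<psi> else 0) hs"
  proof (cases "hs \<in> tuples (carrier G) n")
    case True
    then have v: "\<psi> hs \<in> line y" using assms(3) by (simp add: group_cochains_def)
    show ?thesis
    proof (cases "x = y")
      case False
      have "\<psi> hs x = 0" using False by (subst line_coefficient[OF v]) (simp add: bar_def)
      then show ?thesis using False by (simp add: project_def)
    qed (use True line_coefficient[OF v] assms in \<open>simp add: project_def centralizer_center\<close>)
  qed (use assms in \<open>auto simp: project_def centralizer_center group_cochains_def\<close>)
  then show "pi_map G \<alpha> x n (nu_central G \<alpha> n \<psi>) hs = (if x = y then \<psi> else 0) hs"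
    using nu_central_lift[OF assms(2,3)] by (simp add: pi_map_eq_project)
qed

end

section \<open>Conjugacy classes and coset walks\<close>

locale coset_transfer = twisted_group_algebra G "trivial_cocycle :: 'g \<Rightarrow> 'g \<Rightarrow> 'k::field"
  for G :: "('g, 'm) monoid_scheme" (structure) +
  fixes x :: 'g and m :: nat and \<gamma> :: "nat \<Rightarrow> 'g"
  assumes x: "x \<in> carrier G" and cosets: "right_coset_decomposition G (centralizer G x) m \<gamma>"
begin

abbreviation H where "H \<equiv> centralizer G x"
abbreviation walk where "walk \<equiv> coset_walk G H m \<gamma>"

lemma \<gamma>_closed: "j \<in> {1..m} \<Longrightarrow> \<gamma> j \<in> carrier G" and \<gamma>_1: "\<gamma> 1 = \<one>"
  using cosets by (auto simp: right_coset_decomposition_def)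

lemma H_subgroup: "subgroup H G"
  by (rule centralizer_subgroup[OF x])

lemmas H = subgroup.m_closed[OF H_subgroup] subgroup.m_inv_closed[OF H_subgroup]
  subgroup.one_closed[OF H_subgroup] centralizer_carrier[of _ x]

lemma in_coset_iff:
  assumes "j \<in> {1..m}" "g \<in> carrier G"
  shows "g \<in> H #> \<gamma> j \<longleftrightarrow> g \<otimes> inv (\<gamma> j) \<in> H"
proof
  assume "g \<in> H #> \<gamma> j"
  then obtain h where "h \<in> H" "g = h \<otimes> \<gamma> j" by (auto simp: r_coset_def)
  then show "g \<otimes> inv (\<gamma> j) \<in> H" using \<gamma>_closed[OF assms(1)] H(4) by (simp add: m_assoc)
next
  assume "g \<otimes> inv (\<gamma> j) \<in> H"
  moreover have "g = (g \<otimes> inv (\<gamma> j)) \<otimes> \<gamma> j" using \<gamma>_closed[OF assms(1)] assms(2) by (simp add: m_assoc)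
  ultimately show "g \<in> H #> \<gamma> j" unfolding r_coset_def by blast
qed

lemma ex1_coset:
  assumes "g \<in> carrier G"
  shows "\<exists>!j. j \<in> {1..m} \<and> g \<otimes> inv (\<gamma> j) \<in> H"
proof -
  have U: "carrier G = (\<Union>j\<in>{1..m}. H #> \<gamma> j)" and D: "disjoint_family_on (\<lambda>j. H #> \<gamma> j) {1..m}"
    using cosets by (auto simp: right_coset_decomposition_def)
  obtain j where j: "j \<in> {1..m}" "g \<in> H #> \<gamma> j" using assms U by blast
  moreover have "i = j" if "i \<in> {1..m}" "g \<in> H #> \<gamma> i" for i
    using that j D unfolding disjoint_family_on_def by blast
  ultimately show ?thesis using in_coset_iff[OF _ assms] by blast
qed

definition coset_index :: "'g \<Rightarrow> nat"
  where "coset_index g = (THE j. j \<in> {1..m} \<and> g \<otimes> inv (\<gamma> j) \<in> H)"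

definition coset_part :: "'g \<Rightarrow> 'g"
  where "coset_part g = g \<otimes> inv (\<gamma> (coset_index g))"

lemma coset_index:
  assumes "g \<in> carrier G"
  shows "coset_index g \<in> {1..m}" "g \<otimes> inv (\<gamma> (coset_index g)) \<in> H"
  using theI'[OF ex1_coset[OF assms]] by (simp_all add: coset_index_def)

lemma coset_index_eqI:
  "g \<in> carrier G \<Longrightarrow> j \<in> {1..m} \<Longrightarrow> g \<otimes> inv (\<gamma> j) \<in> H \<Longrightarrow> coset_index g = j"
  using ex1_coset[of g] coset_index[of g] by blast

lemma coset_part:
  assumes "g \<in> carrier G"
  shows "coset_part g \<in> H" "g = coset_part g \<otimes> \<gamma> (coset_index g)"
  using coset_index[OF assms] assms \<gamma>_closed by (simp_all add: coset_part_def m_assoc)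

text \<open>The decomposition \<open>g = h \<gamma>\<^sub>s\<close> with \<open>h \<in> H\<close> is compatible with left translation by \<open>H\<close>.\<close>

lemma coset_part_left:
  assumes "h \<in> H" "g \<in> carrier G"
  shows "coset_index (h \<otimes> g) = coset_index g" "coset_part (h \<otimes> g) = h \<otimes> coset_part g"
proof -
  note c = coset_index[OF assms(2)] \<gamma>_closed[OF coset_index(1)[OF assms(2)]] H(4)[OF assms(1)]
  have e: "h \<otimes> g \<otimes> inv (\<gamma> (coset_index g)) = h \<otimes> (g \<otimes> inv (\<gamma> (coset_index g)))"
    using c assms by (simp add: m_assoc)
  show i: "coset_index (h \<otimes> g) = coset_index g"
    by (rule coset_index_eqI) (use c assms e H(1) in auto)
  show "coset_part (h \<otimes> g) = h \<otimes> coset_part g" unfolding coset_part_def i by (rule e)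
qed

lemma coset_part_\<gamma>:
  assumes "j \<in> {1..m}"
  shows "coset_index (\<gamma> j) = j" "coset_part (\<gamma> j) = \<one>"
proof -
  show i: "coset_index (\<gamma> j) = j" using assms \<gamma>_closed H(3) by (intro coset_index_eqI) auto
  show "coset_part (\<gamma> j) = \<one>" unfolding coset_part_def i using \<gamma>_closed[OF assms] by simp
qed

lemma index_1: "1 \<in> {1..m}"
  using coset_index(1)[OF one_closed] by auto

lemma coset_part_H: "h \<in> H \<Longrightarrow> coset_part h = h"
  using coset_part_left(2)[of h \<one>] coset_part_\<gamma>(2)[OF index_1] H(4) \<gamma>_1 by simp

lemma coset_step_eq:
  assumes "j \<in> {1..m}" "g \<in> carrier G"
  shows "coset_step G H m \<gamma> j g = (coset_part (\<gamma> j \<otimes> g), coset_index (\<gamma> j \<otimes> g))"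
  unfolding coset_step_def
proof (rule the_equality)
  have c: "\<gamma> j \<otimes> g \<in> carrier G" using \<gamma>_closed assms by simp
  show "fst (coset_part (\<gamma> j \<otimes> g), coset_index (\<gamma> j \<otimes> g)) \<in> H \<and>
      snd (coset_part (\<gamma> j \<otimes> g), coset_index (\<gamma> j \<otimes> g)) \<in> {1..m} \<and>
      \<gamma> j \<otimes> g = fst (coset_part (\<gamma> j \<otimes> g), coset_index (\<gamma> j \<otimes> g)) \<otimes>
        \<gamma> (snd (coset_part (\<gamma> j \<otimes> g), coset_index (\<gamma> j \<otimes> g)))"
    using coset_part[OF c] coset_index(1)[OF c] by simp
  fix p assume p: "fst p \<in> H \<and> snd p \<in> {1..m} \<and> \<gamma> j \<otimes> g = fst p \<otimes> \<gamma> (snd p)"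
  then have "coset_index (\<gamma> j \<otimes> g) = snd p" "coset_part (\<gamma> j \<otimes> g) = fst p"
    using coset_part_left[of "fst p" "\<gamma> (snd p)"] coset_part_\<gamma>[of "snd p"] \<gamma>_closed H(4) by auto
  then show "p = (coset_part (\<gamma> j \<otimes> g), coset_index (\<gamma> j \<otimes> g))" by simp
qed

text \<open>The walk from \<open>\<gamma> j\<close> records the consecutive quotients of the \<open>H\<close>-parts of
  \<open>\<gamma>\<^sub>j, \<gamma>\<^sub>j g\<^sub>1, \<gamma>\<^sub>j g\<^sub>1 g\<^sub>2, \<dots>\<close>; this is what makes it natural in homogeneous coordinates.\<close>

lemma coset_walk_eq:
  assumes "j \<in> {1..m}" "gs \<in> tuples (carrier G) n"
  shows "walk j gs =
    quotients G n (\<lambda>i. coset_part (\<gamma> j \<otimes> partial_products G gs i))"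
  using assms
proof (induction gs arbitrary: j n)
  case Nil
  then show ?case by (auto simp: tuples_def quotients_def)
next
  case (Cons g gs)
  then obtain k where n: "n = Suc k" and gs: "gs \<in> tuples (carrier G) k" and g: "g \<in> carrier G"
    by (cases n) (auto simp: tuples_def)
  define h s where "h = coset_part (\<gamma> j \<otimes> g)" and "s = coset_index (\<gamma> j \<otimes> g)"
  have c: "\<gamma> j \<in> carrier G" "\<gamma> j \<otimes> g \<in> carrier G" using \<gamma>_closed Cons.prems(1) g by auto
  have h: "h \<in> H" "h \<in> carrier G" "s \<in> {1..m}" "\<gamma> j \<otimes> g = h \<otimes> \<gamma> s" "\<gamma> s \<in> carrier G"
    using coset_part[OF c(2)] coset_index(1)[OF c(2)] H(4) \<gamma>_closed by (auto simp: h_def s_def)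
  have p: "partial_products G gs i \<in> carrier G" for i by (rule partial_products_closed[OF gs])
  \<comment> \<open>After the first step the walk continues from \<open>\<gamma> s\<close>; translation by \<open>h\<close> returns it to \<open>\<gamma> j \<otimes> g\<close>.\<close>
  have step: "coset_part (\<gamma> j \<otimes> (g \<otimes> partial_products G gs i)) = h \<otimes> coset_part (\<gamma> s \<otimes> partial_products G gs i)" for i
  proof -
    have "\<gamma> j \<otimes> (g \<otimes> partial_products G gs i) = h \<otimes> (\<gamma> s \<otimes> partial_products G gs i)"
      using c g p h by (metis m_assoc)
    then show ?thesis using coset_part_left(2)[OF h(1)] h(5) p by simp
  qed
  have q: "coset_part (\<gamma> s \<otimes> partial_products G gs i) \<in> carrier G" for i
    using coset_part(1) h(5) p H(4) by simp
  have "walk j (g # gs) = h # walk s gs"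
    using coset_step_eq[OF Cons.prems(1) g] by (simp add: h_def s_def)
  also have "walk s gs =
      quotients G k (\<lambda>i. h \<otimes> coset_part (\<gamma> s \<otimes> partial_products G gs i))"
    using Cons.IH[OF h(3) gs] quotients_translate[OF h(2) q] by simp
  also have "h # \<dots> = quotients G n (\<lambda>i. coset_part (\<gamma> j \<otimes> partial_products G (g # gs) i))"
    using c g h coset_part_\<gamma>(2)[OF Cons.prems(1)] coset_part_\<gamma>(2)[OF h(3)] h_def[symmetric]
    unfolding n quotients_Suc by (simp add: partial_products_simps step comp_def)
  finally show ?case .
qed

lemma coset_walk_tuple:
  assumes "j \<in> {1..m}" "gs \<in> tuples (carrier G) n"
  shows "walk j gs \<in> tuples H n"
proof -
  have "coset_part (\<gamma> j \<otimes> partial_products G gs i) \<in> H" for i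
    using coset_part(1) \<gamma>_closed[OF assms(1)] partial_products_closed[OF assms(2)] by simp
  then show ?thesis
    unfolding coset_walk_eq[OF assms] by (simp add: tuples_iff nth_quotients H)
qed

text \<open>The twisted form of \<open>nu_class\<close>: since \<open>\<psi>\<close> has values in the line of \<open>x\<close>, the factor \<open>x\<^sup>-\<^sup>1\<close> turns \<open>\<psi>\<close> into
  a scalar, and the product of the arguments is divided out.\<close>

definition transfer :: "nat \<Rightarrow> ('g list \<Rightarrow> 'g \<Rightarrow> 'k) \<Rightarrow> 'g list \<Rightarrow> 'g \<Rightarrow> 'k"
  where "transfer n \<psi> = (\<lambda>gs. if gs \<in> tuples (carrier G) n
    then \<Sum>j=1..m. \<psi> (walk j gs) x \<cdot>\<^sub>k bar (inv (\<gamma> j) \<otimes> x \<otimes> \<gamma> j) else 0)"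

text \<open>Both conjugates of \<open>x\<close> agree exactly if \<open>g \<gamma>\<^sub>j\<^sup>-\<^sup>1\<close> centralizes \<open>x\<close>, that is, if \<open>g \<in> H\<gamma>\<^sub>j\<close>.\<close>

lemma conjugate_eq_iff:
  assumes "g \<in> carrier G" "j \<in> {1..m}"
  shows "inv g \<otimes> x \<otimes> g = inv (\<gamma> j) \<otimes> x \<otimes> \<gamma> j \<longleftrightarrow> j = coset_index g"
proof -
  note c = assms(1) \<gamma>_closed[OF assms(2)] x
  have "inv g \<otimes> x \<otimes> g = inv (\<gamma> j) \<otimes> x \<otimes> \<gamma> j \<longleftrightarrow>
      g \<otimes> (inv g \<otimes> x \<otimes> g) \<otimes> inv (\<gamma> j) = g \<otimes> (inv (\<gamma> j) \<otimes> x \<otimes> \<gamma> j) \<otimes> inv (\<gamma> j)"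
    using c by simp
  also have "g \<otimes> (inv g \<otimes> x \<otimes> g) \<otimes> inv (\<gamma> j) = (g \<otimes> inv g) \<otimes> (x \<otimes> (g \<otimes> inv (\<gamma> j)))"
    using c by (simp only: m_assoc m_closed inv_closed)
  also have "\<dots> = x \<otimes> (g \<otimes> inv (\<gamma> j))" using c by simp
  also have "g \<otimes> (inv (\<gamma> j) \<otimes> x \<otimes> \<gamma> j) \<otimes> inv (\<gamma> j) = g \<otimes> inv (\<gamma> j) \<otimes> x \<otimes> (\<gamma> j \<otimes> inv (\<gamma> j))"
    using c by (simp only: m_assoc m_closed inv_closed)
  also have "\<dots> = g \<otimes> inv (\<gamma> j) \<otimes> x" using c by simp
  also have "x \<otimes> (g \<otimes> inv (\<gamma> j)) = g \<otimes> inv (\<gamma> j) \<otimes> x \<longleftrightarrow> g \<otimes> inv (\<gamma> j) \<in> H"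
    using c by (auto simp: centralizer_def)
  also have "\<dots> \<longleftrightarrow> j = coset_index g"
    using coset_index_eqI[OF assms] coset_index(2)[OF assms(1)] by auto
  finally show ?thesis .
qed

text \<open>Only the coset of \<open>g\<close> contributes. Writing \<open>g = h \<gamma>\<^sub>s\<close>, the walk from \<open>\<gamma>\<^sub>s\<close> may be replaced by the one
  from \<open>g\<close>, as translation by \<open>h\<close> does not change quotients. So every \<open>g\<close> that conjugates \<open>x\<close> to the given
  element computes the same coefficient.\<close>

lemma transfer_coefficient:
  assumes "g \<in> carrier G" "gs \<in> tuples (carrier G) n"
  shows "transfer n \<psi> gs (inv g \<otimes> x \<otimes> g)
    = \<psi> (quotients G n (\<lambda>i. coset_part (g \<otimes> partial_products G gs i))) x"
proof -
  define s where "s = coset_index g"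
  note s = coset_index(1)[OF assms(1)]
  have p: "partial_products G gs i \<in> carrier G" for i by (rule partial_products_closed[OF assms(2)])
  note h = coset_part[OF assms(1)]
  have step: "coset_part (g \<otimes> partial_products G gs i) = coset_part g \<otimes> coset_part (\<gamma> s \<otimes> partial_products G gs i)" for i
  proof -
    have "g \<otimes> partial_products G gs i = coset_part g \<otimes> (\<gamma> s \<otimes> partial_products G gs i)"
      using h H(4)[OF h(1)] \<gamma>_closed[OF s] p m_assoc[of "coset_part g" "\<gamma> s" "partial_products G gs i"]
      by (simp add: s_def)
    then show ?thesis using coset_part_left(2)[OF h(1)] \<gamma>_closed[OF s] p by (simp add: s_def)
  qed
  have q: "coset_part (\<gamma> s \<otimes> partial_products G gs i) \<in> carrier G" for i
    using coset_part(1) \<gamma>_closed[OF s] p H(4) by (simp add: s_def)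
  have "transfer n \<psi> gs (inv g \<otimes> x \<otimes> g) =
      (\<Sum>j=1..m. \<psi> (walk j gs) x * bar (inv (\<gamma> j) \<otimes> x \<otimes> \<gamma> j) (inv g \<otimes> x \<otimes> g))"
    using assms(2) by (simp add: transfer_def fun_sum_apply)
  also have "\<dots> = (\<Sum>j=1..m. if j = s then \<psi> (walk j gs) x else 0)"
    by (rule sum.cong[OF refl]) (simp add: bar_def conjugate_eq_iff[OF assms(1)] s_def)
  also have "\<dots> = \<psi> (walk s gs) x"
    using s by (simp add: sum.delta s_def del: One_nat_def)
  also have "walk s gs =
      quotients G n (\<lambda>i. coset_part g \<otimes> coset_part (\<gamma> s \<otimes> partial_products G gs i))"
    using coset_walk_eq[OF s assms(2)] quotients_translate[OF H(4)[OF h(1)] q] by (simp add: s_def)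
  finally show ?thesis unfolding step .
qed

lemma transfer_zero:
  assumes "u \<notin> conjugacy_class G x"
  shows "transfer n \<psi> gs u = 0"
proof -
  have "u \<noteq> inv (\<gamma> j) \<otimes> x \<otimes> \<gamma> j" if "j \<in> {1..m}" for j
    using assms \<gamma>_closed[OF that] by (auto simp: conjugacy_class_def)
  then show ?thesis by (auto simp: transfer_def fun_sum_apply bar_def intro!: sum.neutral)
qed

lemma transfer_closed: "transfer n \<psi> \<in> conj.cochains n"
proof -
  have "transfer n \<psi> gs \<in> carrier alg" for gs
  proof -
    have "\<psi> (walk j gs) x \<cdot>\<^sub>k bar (inv (\<gamma> j) \<otimes> x \<otimes> \<gamma> j) \<in> carrier alg" if "j \<in> {1..m}" for j
      using x \<gamma>_closed[OF that] by (intro vector_subspaceD(3)[OF alg_subspace bar_closed]) simp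
    then show ?thesis
      unfolding transfer_def using vector_subspaceD(1)[OF alg_subspace]
      by (auto intro!: vector_subspace_sum[OF alg_subspace])
  qed
  then show ?thesis by (simp add: conj.cochains_iff) (simp add: transfer_def)
qed

lemma conj_trivial:
  assumes "g \<in> carrier G" "a \<in> carrier alg"
  shows "conj g a u = (if u \<in> carrier G then a (inv g \<otimes> u \<otimes> g) else 0)"
  using conj_coefficient[OF assms(1) _ assms(2), of u] conj.act_closed[OF assms] by (auto simp: alg_simps)

text \<open>In homogeneous coordinates the coefficient of the transfer at \<open>g\<^sup>-\<^sup>1 x g\<close> is the original cochain
  at the \<open>H\<close>-parts of the translates by \<open>g\<close>.\<close>

lemma transfer_natural:
  "natural_map (centralizer_group G x) (line x) (line_action trivial_cocycle x) G (carrier alg) conj transfer"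
proof (intro natural_map.intro natural_map_axioms.intro conj_action line_linear_action x transfer_closed)
  interpret L: linear_action "centralizer_group G x" "line x" "line_action (trivial_cocycle :: 'g \<Rightarrow> 'g \<Rightarrow> 'k) x"
    by (rule line_linear_action[OF x])
  fix u
  show "\<exists>t s. t \<in> carrier G \<rightarrow> carrier (centralizer_group G x) \<and>
      (\<forall>v w. s (v + w) = s v + s w) \<and> (\<forall>c v. s (c \<cdot>\<^sub>k v) = c * s v) \<and>
      (\<forall>n \<psi> y. \<psi> \<in> L.cochains n \<longrightarrow> (\<forall>i. y i \<in> carrier G) \<longrightarrow>
        conj.hmg n (transfer n \<psi>) y u = s (L.hmg n \<psi> (t \<circ> y)))"
  proof (cases "u \<in> conjugacy_class G x")
    case True
    then obtain g where g: "g \<in> carrier G" "u = inv g \<otimes> x \<otimes> g" by (auto simp: conjugacy_class_def)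
    have "conj.hmg n (transfer n \<psi>) y u = L.hmg n \<psi> ((\<lambda>a. coset_part (g \<otimes> a)) \<circ> y) x"
      if y: "\<forall>i. y i \<in> carrier G" for n \<psi> y
    proof -
      let ?q = "quotients G n y"
      have q: "?q \<in> tuples (carrier G) n" by (rule quotients_tuple) (use y in blast)
      have p: "partial_products G ?q i \<in> carrier G" for i by (rule partial_products_closed[OF q])
      have y0: "y 0 \<in> carrier G" "g \<otimes> y 0 \<in> carrier G" using y g by auto
      have t: "transfer n \<psi> ?q \<in> carrier alg" by (rule conj.cochain_in[OF transfer_closed q])
      \<comment> \<open>The action of \<open>y 0\<close> moves the coefficient to the element obtained by conjugating with \<open>g \<otimes> y 0\<close>.\<close>
      have "inv (y 0) \<otimes> u \<otimes> y 0 = inv (g \<otimes> y 0) \<otimes> x \<otimes> (g \<otimes> y 0)"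
        using g y0 x by (simp add: inv_mult_group m_assoc)
      moreover have "u \<in> carrier G" using g x by simp
      ultimately have "conj.hmg n (transfer n \<psi>) y u = transfer n \<psi> ?q (inv (g \<otimes> y 0) \<otimes> x \<otimes> (g \<otimes> y 0))"
        by (simp add: homogeneous_def conj_trivial[OF y0(1) t])
      also have "\<dots> = \<psi> (quotients G n (\<lambda>i. coset_part ((g \<otimes> y 0) \<otimes> partial_products G ?q i))) x"
        by (rule transfer_coefficient[OF y0(2) q])
      also have "quotients G n (\<lambda>i. coset_part ((g \<otimes> y 0) \<otimes> partial_products G ?q i)) =
          quotients G n ((\<lambda>a. coset_part (g \<otimes> a)) \<circ> y)"
      proof (rule quotients_cong)
        fix i assume "i \<le> n"
        have "y 0 \<otimes> partial_products G ?q i = y i"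
          by (rule base_partial_products) (use y \<open>i \<le> n\<close> in auto)
        then have "(g \<otimes> y 0) \<otimes> partial_products G ?q i = g \<otimes> y i" using g y0 p by (simp add: m_assoc)
        then show "coset_part ((g \<otimes> y 0) \<otimes> partial_products G ?q i) = ((\<lambda>a. coset_part (g \<otimes> a)) \<circ> y) i"
          by simp
      qed
      also have "\<dots> = quotients (centralizer_group G x) n ((\<lambda>a. coset_part (g \<otimes> a)) \<circ> y)"
        by (rule quotients_centralizer[OF x, symmetric]) (use y g coset_part(1) in simp)
      finally show ?thesis by (simp add: homogeneous_def line_action_trivial)
    qed
    then show ?thesis
      using g coset_part(1)
      by (intro exI[of _ "\<lambda>a. coset_part (g \<otimes> a)"] exI[of _ "\<lambda>v. v x"]) (auto simp: centralizer_group_simps)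
  next
    case False
    have "conj.hmg n (transfer n \<psi>) y u = 0" if y: "\<forall>i. y i \<in> carrier G" for n \<psi> y
    proof -
      have y0: "y 0 \<in> carrier G" using y by auto
      have q: "quotients G n y \<in> tuples (carrier G) n" by (rule quotients_tuple) (use y in blast)
      have t: "transfer n \<psi> (quotients G n y) \<in> carrier alg"
        by (rule conj.cochain_in[OF transfer_closed q])
      have "inv (y 0) \<otimes> u \<otimes> y 0 \<notin> conjugacy_class G x" if u: "u \<in> carrier G"
      proof
        assume "inv (y 0) \<otimes> u \<otimes> y 0 \<in> conjugacy_class G x"
        then obtain g where g: "g \<in> carrier G" "inv (y 0) \<otimes> u \<otimes> y 0 = inv g \<otimes> x \<otimes> g"
          by (auto simp: conjugacy_class_def)
        have "u = (y 0 \<otimes> inv (y 0)) \<otimes> u \<otimes> (y 0 \<otimes> inv (y 0))" using u y0 by simp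
        also have "\<dots> = y 0 \<otimes> (inv (y 0) \<otimes> u \<otimes> y 0) \<otimes> inv (y 0)"
          using u y0 by (simp only: m_assoc m_closed inv_closed)
        also have "\<dots> = inv (g \<otimes> inv (y 0)) \<otimes> x \<otimes> (g \<otimes> inv (y 0))"
          unfolding g(2) using g(1) y0 x by (simp add: inv_mult_group m_assoc)
        finally have "u \<in> conjugacy_class G x" using g(1) y0 by (auto simp: conjugacy_class_def)
        with False show False ..
      qed
      then show ?thesis
        by (simp add: homogeneous_def conj_trivial[OF y0 t] transfer_zero)
    qed
    then show ?thesis
      using H(3) by (intro exI[of _ "\<lambda>_. \<one>"] exI[of _ "\<lambda>_. 0"]) (auto simp: centralizer_group_simps)
  qed
qed

lemma nu_class_lift:
  assumes "\<psi> \<in> group_cochains (centralizer_group G x) (line x) n"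
  shows "nu_class G x m \<gamma> n \<psi> \<in> hcochains n" "twist n (nu_class G x m \<gamma> n \<psi>) = transfer n \<psi>"
proof -
  let ?c = "\<lambda>j. inv (\<gamma> j) \<otimes> x \<otimes> \<gamma> j"
  have summand: "foldl (\<otimes>\<^bsub>alg\<^esub>) (\<psi> (walk j gs)) (map bar ([inv x, ?c j] @ gs))
      = (\<psi> (walk j gs) x \<cdot>\<^sub>k bar (?c j)) \<otimes>\<^bsub>alg\<^esub> product (map bar gs)"
    if j: "j \<in> {1..m}" and gs: "gs \<in> tuples (carrier G) n" for j gs
  proof -
    have v: "\<psi> (walk j gs) \<in> line x"
      using assms coset_walk_tuple[OF j gs] by (simp add: group_cochains_def centralizer_group_simps)
    have c: "?c j \<in> carrier G" using x \<gamma>_closed[OF j] by simp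
    note P = alg.Units_closed[OF product_unit[OF list_over_units(1)[OF list_over_bar[OF gs]]]]
    have "foldl (\<otimes>\<^bsub>alg\<^esub>) (\<psi> (walk j gs)) (map bar ([inv x, ?c j] @ gs))
        = \<psi> (walk j gs) \<otimes>\<^bsub>alg\<^esub> product (map bar ([inv x, ?c j] @ gs))"
      using gs x c by (intro foldl_amult line_alg[OF x v]) (auto simp: tuples_def bar_closed)
    also have "\<dots> = \<psi> (walk j gs) \<otimes>\<^bsub>alg\<^esub> bar (inv x) \<otimes>\<^bsub>alg\<^esub> bar (?c j) \<otimes>\<^bsub>alg\<^esub> product (map bar gs)"
      using line_alg[OF x v] x c P bar_closed by (simp add: product_simps alg.m_assoc)
    also have "\<psi> (walk j gs) \<otimes>\<^bsub>alg\<^esub> bar (inv x) = \<psi> (walk j gs) x \<cdot>\<^sub>k \<one>\<^bsub>alg\<^esub>"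
      using x by (subst line_coefficient[OF v]) (simp add: amult_linear bar_bar alg_simps(2))
    also have "(\<psi> (walk j gs) x \<cdot>\<^sub>k \<one>\<^bsub>alg\<^esub>) \<otimes>\<^bsub>alg\<^esub> bar (?c j) = \<psi> (walk j gs) x \<cdot>\<^sub>k bar (?c j)"
      using bar_closed[OF c] by (simp only: amult_linear alg.l_one)
    finally show ?thesis .
  qed
  have F: "(\<Sum>j=1..m. foldl (\<otimes>\<^bsub>alg\<^esub>) (\<psi> (walk j gs)) (map bar ([inv x, ?c j] @ gs)))
      = transfer n \<psi> gs \<otimes>\<^bsub>alg\<^esub> product (map bar gs)" if gs: "gs \<in> tuples (carrier G) n" for gs
  proof -
    have "(\<Sum>j=1..m. foldl (\<otimes>\<^bsub>alg\<^esub>) (\<psi> (walk j gs)) (map bar ([inv x, ?c j] @ gs)))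
        = (\<Sum>j=1..m. (\<psi> (walk j gs) x \<cdot>\<^sub>k bar (?c j)) \<otimes>\<^bsub>alg\<^esub> product (map bar gs))"
      by (intro sum.cong refl summand gs)
    then show ?thesis using gs unfolding transfer_def amult_sum[symmetric] by presburger
  qed
  show "nu_class G x m \<gamma> n \<psi> \<in> hcochains n"
    unfolding nu_class_def Let_def
    by (rule multilinear_extension_cochain) (simp only: F amult_closed)
  show "twist n (nu_class G x m \<gamma> n \<psi>) = transfer n \<psi>"
  proof
    fix gs
    show "twist n (nu_class G x m \<gamma> n \<psi>) gs = transfer n \<psi> gs"
    proof (cases "gs \<in> tuples (carrier G) n")
      case True
      have P: "product (map bar gs) \<in> Units alg"
        by (rule product_unit[OF list_over_units(1)[OF list_over_bar[OF True]]])
      have "nu_class G x m \<gamma> n \<psi> (map bar gs) = transfer n \<psi> gs \<otimes>\<^bsub>alg\<^esub> product (map bar gs)"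
        unfolding nu_class_def Let_def multilinear_extension_bar[OF True] by (rule F[OF True])
      then show ?thesis using True P conj.cochain_in[OF transfer_closed True]
        by (simp add: twist_def alg.m_assoc alg.Units_closed)
    qed (simp add: twist_def transfer_def)
  qed
qed

lemma nu_class_chain_maps:
  defines "C \<equiv> group_cochains (centralizer_group G x) (line x)"
    and "CS \<equiv> sym_group_cochains (centralizer_group G x) (line x) (line_action trivial_cocycle x)"
    and "d \<equiv> group_diff (centralizer_group G x) (line_action trivial_cocycle x)"
  shows "chain_map C d hcochains hdiff (nu_class G x m \<gamma>)"
    "chain_map CS d hsym_cochains hdiff (nu_class G x m \<gamma>)"
proof -
  have l: "nu_class G x m \<gamma> n \<psi> \<in> hcochains n" "twist n (nu_class G x m \<gamma> n \<psi>) = transfer n \<psi>"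
    if "\<psi> \<in> group_cochains (centralizer_group G x) (line x) n" for n \<psi>
    using nu_class_lift[OF that] .
  show "chain_map C d hcochains hdiff (nu_class G x m \<gamma>)"
    unfolding C_def d_def by (rule lift_chain_maps(1)[OF transfer_natural l])
  show "chain_map CS d hsym_cochains hdiff (nu_class G x m \<gamma>)"
    unfolding CS_def d_def by (rule lift_chain_maps(2)[OF transfer_natural l])
qed

text \<open>For \<open>y = x\<close> take \<open>g = \<one>\<close> in the formula for the coefficients: elements of \<open>H\<close> are their own
  \<open>H\<close>-parts because \<open>\<gamma>\<^sub>1 = \<one>\<close>. For \<open>y\<close> outside the conjugacy class of \<open>x\<close> the coefficient vanishes.\<close>

lemma pi_nu_class:
  fixes \<psi> :: "'g list \<Rightarrow> 'g \<Rightarrow> 'k"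
  assumes "y = x \<or> y \<notin> conjugacy_class G x"
    and \<psi>: "\<psi> \<in> group_cochains (centralizer_group G x) (line x) n"
  shows "pi_map G trivial_cocycle y n (nu_class G x m \<gamma> n \<psi>) = (if y = x then \<psi> else 0)"
proof
  fix hs
  have "project y n (transfer n \<psi>) hs = (if y = x then \<psi> else 0) hs"
  proof (cases "y = x")
    case False
    then show ?thesis using assms(1) by (simp add: project_def transfer_zero)
  next
    case y: True
    show ?thesis
    proof (cases "hs \<in> tuples H n")
      case True
      then have hs: "hs \<in> tuples (carrier G) n" by (rule tuples_centralizer)
      have "set hs \<subseteq> H" using True by (simp add: tuples_def)
      then have pH: "partial_products G hs i \<in> H" for i
      proof -
        have "set ks \<subseteq> H \<Longrightarrow> foldr (\<otimes>) ks \<one> \<in> H" for ks by (induction ks) (auto simp: H)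
        moreover have "set (take i hs) \<subseteq> H" using \<open>set hs \<subseteq> H\<close> set_take_subset[of i hs] by blast
        ultimately show ?thesis by (simp add: partial_products_def)
      qed
      have "transfer n \<psi> hs x = \<psi> (quotients G n (\<lambda>i. coset_part (\<one> \<otimes> partial_products G hs i))) x"
        using transfer_coefficient[OF one_closed hs, of \<psi>] x by simp
      also have "(\<lambda>i. coset_part (\<one> \<otimes> partial_products G hs i)) = partial_products G hs"
        using coset_part_H[OF pH] H(4)[OF pH] by (simp add: fun_eq_iff)
      finally have "transfer n \<psi> hs x = \<psi> hs x" by (simp add: quotients_partial_products[OF hs])
      moreover have "\<psi> hs \<in> line x" using \<psi> True by (simp add: group_cochains_def centralizer_group_simps)
      ultimately show ?thesis using True y line_coefficient[of "\<psi> hs" x] by (simp add: project_def)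
    qed (use \<psi> y in \<open>simp add: project_def group_cochains_def centralizer_group_simps\<close>)
  qed
  then show "pi_map G trivial_cocycle y n (nu_class G x m \<gamma> n \<psi>) hs = (if y = x then \<psi> else 0) hs"
    using nu_class_lift[OF \<psi>] by (simp add: pi_map_eq_project)
qed

end

section \<open>The splittings\<close>

text \<open>Both \<open>x\<close> and \<open>y\<close> represent the class of \<open>y\<close>.\<close>

lemma representatives_not_conjugate:
  assumes "group G" "class_representatives G reps" "x \<in> reps" "y \<in> reps" "y \<in> conjugacy_class G x"
  shows "y = x"
proof -
  interpret group G by fact
  have "y \<in> carrier G" using assms by (auto simp: class_representatives_def)
  moreover from this have "y \<in> conjugacy_class G y"
    unfolding conjugacy_class_def by (intro image_eqI[of _ _ "\<one>\<^bsub>G\<^esub>"]) auto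
  ultimately show ?thesis using assms by (auto simp: class_representatives_def)
qed

lemma (in twisted_group_algebra) central_split_family:
  "split_family (group_center G) (\<lambda>x. sym_group_cochains G (line x) (line_action \<alpha> x))
    (\<lambda>x. group_diff G (line_action \<alpha> x)) hsym_cochains hdiff
    (\<lambda>x. nu_central G \<alpha>) (pi_map G \<alpha>)"
proof (rule split_family.intro)
  show "finite (group_center G)"
    using finite_carrier by (rule finite_subset[rotated]) (auto simp: group_center_def)
  show "cochain_complex hsym_cochains hdiff" by (rule hsym_complex)
  fix x y n \<psi> assume x: "x \<in> group_center G"
  then have x': "x \<in> carrier G" by (simp add: group_center_def)
  show "chain_map (sym_group_cochains G (line x) (line_action \<alpha> x)) (group_diff G (line_action \<alpha> x))
      hsym_cochains hdiff (nu_central G \<alpha>)"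
    by (rule nu_central_chain_maps(2)[OF x])
  show "chain_map hsym_cochains hdiff
      (sym_group_cochains G (line x) (line_action \<alpha> x)) (group_diff G (line_action \<alpha> x)) (pi_map G \<alpha> x)"
    using pi_chain_maps(2)[OF x'] by (simp add: centralizer_group_center x)
  assume "y \<in> group_center G" "\<psi> \<in> sym_group_cochains G (line y) (line_action \<alpha> y) n"
  then show "pi_map G \<alpha> x n (nu_central G \<alpha> n \<psi>) = (if x = y then \<psi> else 0)"
    using pi_nu_central[OF x] by (simp add: sym_group_cochains_def)
qed

lemma class_split_family:
  fixes G :: "('g, 'm) monoid_scheme"
  defines "\<epsilon> \<equiv> (trivial_cocycle :: 'g \<Rightarrow> 'g \<Rightarrow> 'k::field)" and "H \<equiv> centralizer_group G"
  assumes G: "twisted_group_algebra G \<epsilon>" and reps: "class_representatives G reps"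
    and \<gamma>: "\<forall>x\<in>reps. right_coset_decomposition G (centralizer G x) (m x) (\<gamma> x)"
  shows "split_family reps (\<lambda>x. sym_group_cochains (H x) (line x) (line_action \<epsilon> x))
    (\<lambda>x. group_diff (H x) (line_action \<epsilon> x)) (sym_hoch_cochains G \<epsilon>) (hoch_diff G \<epsilon>)
    (\<lambda>x. nu_class G x (m x) (\<gamma> x)) (pi_map G \<epsilon>)"
proof -
  interpret twisted_group_algebra G \<epsilon> by (rule G)
  have T: "coset_transfer TYPE('k) G x (m x) (\<gamma> x)" if "x \<in> reps" for x
    using G reps \<gamma> that unfolding \<epsilon>_def
    by (auto intro!: coset_transfer.intro coset_transfer_axioms.intro simp: class_representatives_def)
  show ?thesis
  proof (rule split_family.intro)
    show "finite reps"
      using finite_carrier reps by (auto simp: class_representatives_def intro: finite_subset)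
    show "cochain_complex hsym_cochains hdiff" by (rule hsym_complex)
    fix x y n \<psi> assume x: "x \<in> reps"
    show "chain_map (sym_group_cochains (H x) (line x) (line_action \<epsilon> x)) (group_diff (H x) (line_action \<epsilon> x))
        hsym_cochains hdiff (nu_class G x (m x) (\<gamma> x))"
      using coset_transfer.nu_class_chain_maps(2)[OF T[OF x]] by (simp add: \<epsilon>_def H_def)
    show "chain_map hsym_cochains hdiff (sym_group_cochains (H x) (line x) (line_action \<epsilon> x))
        (group_diff (H x) (line_action \<epsilon> x)) (pi_map G \<epsilon> x)"
      using pi_chain_maps(2)[of x] x reps by (auto simp: H_def class_representatives_def)
    assume y: "y \<in> reps" and \<psi>: "\<psi> \<in> sym_group_cochains (H y) (line y) (line_action \<epsilon> y) n"
    show "pi_map G \<epsilon> x n (nu_class G y (m y) (\<gamma> y) n \<psi>) = (if x = y then \<psi> else 0)"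
    proof -
      have "x = y \<or> x \<notin> conjugacy_class G y"
        using representatives_not_conjugate[OF is_group reps y x] by blast
      then show ?thesis
        using coset_transfer.pi_nu_class[OF T[OF y], of x \<psi> n] \<psi>
        by (simp add: \<epsilon>_def H_def sym_group_cochains_def)
    qed
  qed
qed

lemma (in twisted_group_algebra) central_maps:
  assumes "x \<in> group_center G"
  defines "d \<equiv> group_diff G (line_action \<alpha> x)" and "CS \<equiv> sym_group_cochains G (line x) (line_action \<alpha> x)"
  shows "cochain_map (group_cochains G (line x)) d hcochains hdiff (nu_central G \<alpha>)"
    "cochain_map hcochains hdiff (group_cochains G (line x)) d (pi_map G \<alpha> x)"
    "induces_on_cohomology CS d hsym_cochains hdiff n (nu_central G \<alpha> n)"
    "induces_on_cohomology hsym_cochains hdiff CS d n (pi_map G \<alpha> x n)"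
proof -
  have "x \<in> carrier G" using assms(1) by (simp add: group_center_def)
  note pi = pi_chain_maps[OF this, unfolded centralizer_group_center[OF assms(1)]]
  note nu = nu_central_chain_maps[OF assms(1)]
  show "cochain_map (group_cochains G (line x)) d hcochains hdiff (nu_central G \<alpha>)"
    "cochain_map hcochains hdiff (group_cochains G (line x)) d (pi_map G \<alpha> x)"
    "induces_on_cohomology CS d hsym_cochains hdiff n (nu_central G \<alpha> n)"
    "induces_on_cohomology hsym_cochains hdiff CS d n (pi_map G \<alpha> x n)"
    unfolding d_def CS_def
    by (rule chain_map.cochain_map[OF nu(1)] chain_map.cochain_map[OF pi(1)]
        chain_map.induces[OF nu(2)] chain_map.induces[OF pi(2)])+
qed

lemma (in coset_transfer) class_maps:
  defines "d \<equiv> group_diff (centralizer_group G x) (line_action (trivial_cocycle :: 'g \<Rightarrow> 'g \<Rightarrow> 'k) x)"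
    and "C \<equiv> group_cochains (centralizer_group G x) (line x)"
    and "CS \<equiv> sym_group_cochains (centralizer_group G x) (line x) (line_action trivial_cocycle x)"
  shows "cochain_map C d hcochains hdiff (nu_class G x m \<gamma>)"
    "cochain_map hcochains hdiff C d (pi_map G trivial_cocycle x)"
    "induces_on_cohomology CS d hsym_cochains hdiff n (nu_class G x m \<gamma> n)"
    "induces_on_cohomology hsym_cochains hdiff CS d n (pi_map G trivial_cocycle x n)"
  unfolding d_def C_def CS_def
  by (rule chain_map.cochain_map[OF nu_class_chain_maps(1)] chain_map.cochain_map[OF pi_chain_maps(1)[OF x]]
      chain_map.induces[OF nu_class_chain_maps(2)] chain_map.induces[OF pi_chain_maps(2)[OF x]])+

theorem theorem2p1:
  fixes G :: "('g, 'm) monoid_scheme"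
    and \<alpha> :: "'g \<Rightarrow> 'g \<Rightarrow> 'k::field"
    and reps :: "'g set"
    and n :: nat
  assumes "group G" and "finite (carrier G)"
    and "two_cocycle G \<alpha>"
    and "class_representatives G reps"
  shows
    "(let Z = group_center G;
          K = (ring_of_type_algebra :: 'k ring);
          C = (\<lambda>x. group_cochains G (line x));
          CS = (\<lambda>x. sym_group_cochains G (line x) (line_action \<alpha> x));
          d = (\<lambda>x. group_diff G (line_action \<alpha> x));
          D = hoch_cochains G \<alpha>;
          DS = sym_hoch_cochains G \<alpha>;
          \<delta> = hoch_diff G \<alpha>;
          \<nu> = (\<lambda>x. nu_central G \<alpha>);
          \<pi> = (\<lambda>x. pi_map G \<alpha> x);
          sumHS = direct_sum Z (\<lambda>x. HS G (line x) (line_action \<alpha> x) n);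
          HHSG = HHS G \<alpha> n;
          sum\<nu> = sum_of_maps Z HHSG (\<lambda>x. induced_map DS \<delta> n (\<nu> x n));
          tup\<pi> = tuple_of_maps Z (\<lambda>x. induced_map (CS x) (d x) n (\<pi> x n))
      in (\<forall>x\<in>Z. cochain_map (C x) (d x) D \<delta> (\<nu> x) \<and> cochain_map D \<delta> (C x) (d x) (\<pi> x) \<and>
            induces_on_cohomology (CS x) (d x) DS \<delta> n (\<nu> x n) \<and>
            induces_on_cohomology DS \<delta> (CS x) (d x) n (\<pi> x n)) \<and>
         linear_hom K sumHS HHSG sum\<nu> \<and> inj_on sum\<nu> (carrier sumHS) \<and>
         linear_hom K HHSG sumHS tup\<pi> \<and> tup\<pi> ` carrier HHSG = carrier sumHS \<and>
         (\<forall>c\<in>carrier sumHS. tup\<pi> (sum\<nu> c) = c))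
     \<and>
     (\<forall>(m :: 'g \<Rightarrow> nat) (\<gamma> :: 'g \<Rightarrow> nat \<Rightarrow> 'g).
       (\<forall>x\<in>reps. right_coset_decomposition G (centralizer G x) (m x) (\<gamma> x)) \<longrightarrow>
       (let K = (ring_of_type_algebra :: 'k ring);
            \<epsilon> = (trivial_cocycle :: 'g \<Rightarrow> 'g \<Rightarrow> 'k);
            H = centralizer_group G;
            C = (\<lambda>x. group_cochains (H x) (line x));
            CS = (\<lambda>x. sym_group_cochains (H x) (line x) (line_action \<epsilon> x));
            d = (\<lambda>x. group_diff (H x) (line_action \<epsilon> x));
            D = hoch_cochains G \<epsilon>;
            DS = sym_hoch_cochains G \<epsilon>;
            \<delta> = hoch_diff G \<epsilon>;
            \<nu> = (\<lambda>x. nu_class G x (m x) (\<gamma> x));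
            \<pi> = (\<lambda>x. pi_map G \<epsilon> x);
            sumHS = direct_sum reps (\<lambda>x. HS (H x) (line x) (line_action \<epsilon> x) n);
            HHSG = HHS G \<epsilon> n;
            sum\<nu> = sum_of_maps reps HHSG (\<lambda>x. induced_map DS \<delta> n (\<nu> x n));
            tup\<pi> = tuple_of_maps reps (\<lambda>x. induced_map (CS x) (d x) n (\<pi> x n))
        in (\<forall>x\<in>reps. cochain_map (C x) (d x) D \<delta> (\<nu> x) \<and> cochain_map D \<delta> (C x) (d x) (\<pi> x) \<and>
              induces_on_cohomology (CS x) (d x) DS \<delta> n (\<nu> x n) \<and>
              induces_on_cohomology DS \<delta> (CS x) (d x) n (\<pi> x n)) \<and>
           linear_hom K sumHS HHSG sum\<nu> \<and> inj_on sum\<nu> (carrier sumHS) \<and>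
           linear_hom K HHSG sumHS tup\<pi> \<and> tup\<pi> ` carrier HHSG = carrier sumHS \<and>
           (\<forall>c\<in>carrier sumHS. tup\<pi> (sum\<nu> c) = c)))"
proof (rule conjI, goal_cases)
  case 1
  interpret twisted_group_algebra G \<alpha>
    by (intro twisted_group_algebra.intro twisted_group_algebra_axioms.intro assms)
  show ?case
    unfolding Let_def HS_def HHS_def
    by (intro conjI ballI central_maps split_family.splitting(1-4)[OF central_split_family]
        split_family.splitting(5)[OF central_split_family, THEN bspec])
next
  case 2
  have T: "twisted_group_algebra G (trivial_cocycle :: 'g \<Rightarrow> 'g \<Rightarrow> 'k)"
    using assms by (intro twisted_group_algebra.intro twisted_group_algebra_axioms.intro) (auto simp: two_cocycle_def)
  show ?case
  proof (intro allI impI, goal_cases)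
    case (1 m \<gamma>)
    have C: "coset_transfer TYPE('k) G x (m x) (\<gamma> x)" if "x \<in> reps" for x
      using T assms(4) 1 that
      by (auto intro!: coset_transfer.intro coset_transfer_axioms.intro simp: class_representatives_def)
    note S = split_family.splitting[OF class_split_family[OF T assms(4) 1]]
    show ?case
      unfolding Let_def HS_def HHS_def
      by (intro conjI ballI coset_transfer.class_maps[OF C] S(1-4) S(5)[THEN bspec])
  qed
qed

end
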